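(* Let $d\geq 2$, $R_0>0$, $\Omega=B(0,R_0)\subset\mathbb{R}^d$, and let $u_0\in L^1_{c+}(\Omega)$ be bounded and radially non-increasing with radius function $r_0$ (so $\{u_0\geq t\}=B(0,r_0(t))$), and assume $r_0(\sup u_0)>0$. Let $\lambda:[0,+\infty[\to\mathbb{R}_+$ be the function given by the preceding result, so that $t\mapsto u_t$, $u_t(x)=\min(u_0(x),\lambda(t))$, is a minimizing movement for $\overline{W}$ in $L^1_{c+}(\Omega)$ starting from $u_0$. Then for every $t\in\mathbb{R}_+$ with $\lambda(t)>0$: if $\lambda(t)$ is a continuity point of $r_0$, then $\lambda$ is differentiable at $t$ and \[ \lambda'(t)=-\frac{\omega_d}{\alpha_d^2}\frac{1}{r_0(\lambda(t))^{2d}}; \] otherwise, \[ -\frac{\omega_d}{r_0(\lambda(t)+)^{2d}\alpha_d^2}\leq\liminf_{\varepsilon\to 0}\frac{\lambda(t+\varepsilon)-\lambda(t)}{\varepsilon}\leq\limsup_{\varepsilon\to 0}\frac{\lambda(t+\varepsilon)-\lambda(t)}{\varepsilon}\leq-\frac{\omega_d}{r_0(\lambda(t)-)^{2d}\alpha_d^2}, \] both for $\varepsilon\to 0^+$ and for $\varepsilon\to 0^-$.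
   Context: $\alpha_d$ is the volume of the unit ball of $\mathbb{R}^d$ and $\omega_d$ the area of the unit sphere of $\mathbb{R}^d$. $r_0(s+)$ and $r_0(s-)$ denote the right and left limits of the non-increasing function $r_0$ at $s$. $L^1_{c+}(\Omega)=\{u\in L^1(\mathbb{R}^d) : u\geq 0,\ \operatorname{supp}(u)\subset\Omega\}$ with the $L^1$ norm. A function $u$ is radially non-increasing with radius function $r:\mathbb{R}\to\mathbb{R}_+$ if $\{u\geq t\}=\overline{B}(0,r(t))$ up to a negligible set for almost every $t$. For $u\in C^2_c(\Omega)$, $W(u)=\frac{1}{(d-1)^{d-1}}\int_{\mathbb{R}^d}|\nabla u|\,\big|\operatorname{div}\frac{\nabla u}{|\nabla u|}\big|^{d-1}dx$ (integrand $0$ where $\nabla u=0$), $W(u)=+\infty$ otherwise on $L^1(\Omega)$, and $\overline{W}(u,\Omega)=\inf\{\liminf_n W(u_n): u_n\to u\text{ in }L^1(\Omega)\}$. Minimizing movement: for $\tau>0$, $x_\tau(0)=u_0$, $x_\tau(n+1)$ a minimizer over $L^1_{c+}(\Omega)$ of $y\mapsto\overline{W}(y,\Omega)+\frac{1}{2\tau}\|y-x_\tau(n)\|_{L^1}^2$, $u_\tau(t)=x_\tau([t/\tau])$; a minimizing movement is a uniform limit of such $u_\tau$ along some $\tau_i\to 0$. The preceding result asserts, under these hypotheses, that there is a minimizing movement of the form $u_t=\min(u_0,\lambda(t))$ with $\lambda$ Lipschitz, non-increasing, $\lambda(0)=\sup u_0$, vanishing in finite time. *)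

theory Defs
  imports "HOL-Analysis.Analysis" "HOL-Probability.Essential_Supremum"
begin

definition dim_d :: "('n::finite) itself \<Rightarrow> nat" where
  "dim_d _ = CARD('n)"

text \<open>alpha_d = volume of the unit ball, omega_d = area of the unit sphere = d * alpha_d.\<close>
definition alpha_d :: "('n::finite) itself \<Rightarrow> real" where
  "alpha_d _ = measure lborel (ball (0::real^'n) 1)"

definition omega_d :: "('n::finite) itself \<Rightarrow> real" where
  "omega_d T = real CARD('n) * alpha_d T"

definition grad :: "(real^'n::finite \<Rightarrow> real) \<Rightarrow> real^'n \<Rightarrow> real^'n" where
  "grad u x = (\<chi> i. frechet_derivative u (at x) (axis i 1))"

definition divg :: "(real^'n::finite \<Rightarrow> real^'n) \<Rightarrow> real^'n \<Rightarrow> real" where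
  "divg F x = (\<Sum>i\<in>UNIV. frechet_derivative F (at x) (axis i 1) $ i)"

definition C2c :: "(real^'n::finite) set \<Rightarrow> (real^'n \<Rightarrow> real) \<Rightarrow> bool" where
  "C2c \<Omega> u \<longleftrightarrow>
     (\<exists>g H. (\<forall>x. (u has_derivative (\<lambda>h. g x \<bullet> h)) (at x)) \<and>
            (\<forall>x. (g has_derivative H x) (at x)) \<and>
            (\<forall>v. continuous_on UNIV (\<lambda>x. H x v))) \<and>
     compact (closure {x. u x \<noteq> 0}) \<and> closure {x. u x \<noteq> 0} \<subseteq> \<Omega>"

definition Wdens :: "(real^'n::finite \<Rightarrow> real) \<Rightarrow> real^'n \<Rightarrow> real" where
  "Wdens u x = (if grad u x = 0 then 0
      else norm (grad u x) *
           \<bar>divg (\<lambda>y. grad u y /\<^sub>R norm (grad u y)) x\<bar> ^ (CARD('n) - 1))"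

definition W :: "(real^'n::finite) set \<Rightarrow> (real^'n \<Rightarrow> real) \<Rightarrow> ennreal" where
  "W \<Omega> u = (if C2c \<Omega> u
      then ennreal (1 / real (CARD('n) - 1) ^ (CARD('n) - 1)) * (\<integral>\<^sup>+ x. ennreal (Wdens u x) \<partial>lborel)
      else \<infinity>)"

definition L1dist :: "(real^'n::finite \<Rightarrow> real) \<Rightarrow> (real^'n \<Rightarrow> real) \<Rightarrow> ennreal" where
  "L1dist u v = (\<integral>\<^sup>+ x. ennreal \<bar>u x - v x\<bar> \<partial>lborel)"

definition L1dist_on :: "(real^'n::finite) set \<Rightarrow> (real^'n \<Rightarrow> real) \<Rightarrow> (real^'n \<Rightarrow> real) \<Rightarrow> ennreal" where
  "L1dist_on \<Omega> u v = (\<integral>\<^sup>+ x. ennreal \<bar>u x - v x\<bar> * indicator \<Omega> x \<partial>lborel)"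

definition Wbar :: "(real^'n::finite) set \<Rightarrow> (real^'n \<Rightarrow> real) \<Rightarrow> ennreal" where
  "Wbar \<Omega> u = (INF s \<in> {s. (\<lambda>n. L1dist_on \<Omega> (s n) u) \<longlonglongrightarrow> 0}. liminf (\<lambda>n. W \<Omega> (s n)))"

text \<open>L^1_{c+}(Omega): nonnegative integrable functions whose (essential, closed) support lies in Omega.\<close>
definition L1cp :: "(real^'n::finite) set \<Rightarrow> (real^'n \<Rightarrow> real) set" where
  "L1cp \<Omega> = {u. integrable lborel u \<and> (AE x in lborel. 0 \<le> u x) \<and>
                  (\<exists>K. closed K \<and> K \<subseteq> \<Omega> \<and> (AE x in lborel. x \<notin> K \<longrightarrow> u x = 0))}"

definition MM_step :: "(real^'n::finite) set \<Rightarrow> real \<Rightarrow> (real^'n \<Rightarrow> real) \<Rightarrow> (real^'n \<Rightarrow> real) \<Rightarrow> bool" where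
  "MM_step \<Omega> \<tau> x y \<longleftrightarrow> y \<in> L1cp \<Omega> \<and>
     (\<forall>z\<in>L1cp \<Omega>. Wbar \<Omega> y + ennreal (1 / (2 * \<tau>)) * (L1dist y x)\<^sup>2
                  \<le> Wbar \<Omega> z + ennreal (1 / (2 * \<tau>)) * (L1dist z x)\<^sup>2)"

definition disc_scheme :: "(real^'n::finite) set \<Rightarrow> real \<Rightarrow> (real^'n \<Rightarrow> real) \<Rightarrow> (nat \<Rightarrow> real^'n \<Rightarrow> real) \<Rightarrow> bool" where
  "disc_scheme \<Omega> \<tau> u0 x \<longleftrightarrow> x 0 = u0 \<and> (\<forall>n. MM_step \<Omega> \<tau> (x n) (x (Suc n)))"

definition min_movement :: "(real^'n::finite) set \<Rightarrow> (real^'n \<Rightarrow> real) \<Rightarrow> (real \<Rightarrow> real^'n \<Rightarrow> real) \<Rightarrow> bool" where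
  "min_movement \<Omega> u0 u \<longleftrightarrow>
     (\<exists>\<tau> X. (\<forall>i. \<tau> i > 0) \<and> \<tau> \<longlonglongrightarrow> 0 \<and> (\<forall>i. disc_scheme \<Omega> (\<tau> i) u0 (X i)) \<and>
        (\<lambda>i. SUP t\<in>{0..}. L1dist (X i (nat \<lfloor>t / \<tau> i\<rfloor>)) (u t)) \<longlonglongrightarrow> 0)"

definition radial_noninc :: "(real^'n::finite \<Rightarrow> real) \<Rightarrow> (real \<Rightarrow> real) \<Rightarrow> bool" where
  "radial_noninc u r \<longleftrightarrow> (\<forall>t. 0 \<le> r t) \<and>
     (AE t in lborel. 0 < t \<longrightarrow>
        ({x. t \<le> u x} - cball 0 (r t)) \<union> (cball 0 (r t) - {x. t \<le> u x}) \<in> null_sets lborel)"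

definition low_bd :: "('n::finite) itself \<Rightarrow> real \<Rightarrow> ereal" where
  "low_bd T r = (if r = 0 then -\<infinity>
      else ereal (- omega_d T / (r ^ (2 * CARD('n)) * (alpha_d T)\<^sup>2)))"

end

theory Submission
  imports Defs
begin

text \<open>Two facts about the relaxed energy drive everything: \<open>Wbar\<close> is at least \<open>\<omega>\<^sub>d\<close> times the
  essential supremum, and it is at most that for radially non-increasing functions.

  The lower bound avoids the coarea formula. With \<open>n = \<nabla>u / |\<nabla>u|\<close>, the map
  \<open>x \<mapsto> - (d u(x))\<^bsup>1/d\<^esup> n(x)\<close> has Jacobian \<open>|\<nabla>u|\<close> times the Gauss curvature of the level set, and
  the arithmetic-geometric mean inequality bounds this by the density of \<open>W\<close> at the points where
  the level set touches its convex hull. Maximising linear functionals over the superlevel sets shows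
  that the image of these points covers the ball of volume \<open>\<omega>\<^sub>d max u\<close> up to a null set. The exceptional
  set comes from critical points: along each ray it is the image of a bounded set of reals under a map
  that moves points quadratically, hence null, and Fubini concludes. The upper bound superposes radial
  cutoffs, for which \<open>W\<close> is computed exactly.

  Consequently a step of the scheme from \<open>min u\<^sub>0 l\<close> is \<open>min u\<^sub>0 m\<close> where \<open>m\<close> minimises
  \<open>\<omega>\<^sub>d s + (1/2\<tau>) (\<integral> (min u\<^sub>0 l - min u\<^sub>0 s))\<^sup>2\<close>, so that \<open>(l - m) / \<tau>\<close> lies between
  \<open>\<omega>\<^sub>d / |{u\<^sub>0 \<ge> m}|\<^sup>2\<close> and \<open>\<omega>\<^sub>d / |{u\<^sub>0 \<ge> l}|\<^sup>2\<close>. Summing over the steps and letting \<open>\<tau>\<close> tend to 0 gives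
  two-sided bounds for the difference quotients of \<open>\<lambda>\<close>.\<close>

section \<open>Determinants of maps that are symmetric on a hyperplane\<close>

text \<open>The radius (d u)^(1/d) is forced: if rho^d / d = u, then d rho / d u = rho^(1-d), which
  cancels the factor rho^(d-1) that scaling the unit normal by rho puts into the Jacobian. Only a
  covering of the ball is needed, so multiplicities never matter, and at contact points the
  principal curvatures have one sign, which the mean inequality requires. The obstacle is
  regularity: for d \<ge> 3 a C2 function can have critical values of positive measure, so Sard's
  theorem cannot discard the critical points. The way out is that along a fixed direction the
  support values are real numbers, and a critical support point lets \<open>u\<close> drop only
  quadratically in the distance between two of them. In the scheme, the integral that penalises a
  level s has derivative minus the measure of {u_0 \<ge> s}, and this jumps where r_0 does.
  Comparison with nearby levels on one side therefore replaces the Euler-Lagrange equation, and the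
  limit inherits different bounds from above and from below. The constant omega_d / alpha_d^2
  appears because a ball of radius r has squared volume alpha_d^2 r^(2d).\<close>

lemma symmetric_eigenvector:
  fixes f :: "'a::euclidean_space \<Rightarrow> 'a"
  assumes f: "linear f" and V: "subspace V" "V \<noteq> {0}" and fV: "f ` V \<subseteq> V"
    and sym: "\<And>x y. x \<in> V \<Longrightarrow> y \<in> V \<Longrightarrow> f x \<bullet> y = x \<bullet> f y"
  obtains x c where "x \<in> V" "norm x = 1" "f x = c *\<^sub>R x"
proof -
  let ?S = "V \<inter> sphere 0 1"
  obtain v where v: "v \<in> V" "v \<noteq> 0" using V subspace_0 by blast
  have cS: "compact ?S" using V(1) by (simp add: closed_subspace closed_Int_compact)
  have "v /\<^sub>R norm v \<in> ?S" using v V(1) by (simp add: subspace_scale)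
  then have ne: "?S \<noteq> {}" by blast
  have "continuous_on ?S (\<lambda>x. f x \<bullet> x)"
    using f by (intro continuous_intros linear_continuous_on) (simp add: linear_conv_bounded_linear)
  \<comment> \<open>The eigenvector is a maximiser of the Rayleigh quotient on the unit sphere of
    \<open>V\<close>: its first variation in directions orthogonal to \<open>x\<close> has to
    vanish.\<close>
  from continuous_attains_sup[OF cS ne this]
  obtain x where x: "x \<in> ?S" and mx: "\<And>y. y \<in> ?S \<Longrightarrow> f y \<bullet> y \<le> f x \<bullet> x" by blast
  define c where "c = f x \<bullet> x"
  have xV: "x \<in> V" and nx: "norm x = 1" using x by auto
  have quad: "f y \<bullet> y \<le> c * (y \<bullet> y)" if "y \<in> V" for y
  proof (cases "y = 0")
    case True then show ?thesis using f by (simp add: linear_0)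
  next
    case False
    have "f (y /\<^sub>R norm y) \<bullet> (y /\<^sub>R norm y) \<le> c"
      unfolding c_def using False that V(1) by (intro mx) (simp add: subspace_scale)
    then have "(f y \<bullet> y) / (norm y)\<^sup>2 \<le> c"
      using f by (simp add: linear_scale power2_eq_square divide_inverse ac_simps)
    then show ?thesis using False by (simp add: divide_le_eq power2_norm_eq_inner)
  qed
  have orth: "f x \<bullet> y = 0" if y: "y \<in> V" "x \<bullet> y = 0" for y
  proof -
    have *: "2 * t * (f x \<bullet> y) + t\<^sup>2 * (f y \<bullet> y) \<le> c * t\<^sup>2 * (y \<bullet> y)" for t
    proof -
      have m: "x + t *\<^sub>R y \<in> V" using xV y V(1) by (simp add: subspace_add subspace_scale)
      have "f (x + t *\<^sub>R y) \<bullet> (x + t *\<^sub>R y) \<le> c * ((x + t *\<^sub>R y) \<bullet> (x + t *\<^sub>R y))"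
        by (rule quad[OF m])
      moreover have "f (x + t *\<^sub>R y) \<bullet> (x + t *\<^sub>R y) = c + 2 * t * (f x \<bullet> y) + t\<^sup>2 * (f y \<bullet> y)"
        using f sym[OF y(1) xV]
        by (simp add: linear_add linear_scale inner_add inner_commute c_def power2_eq_square algebra_simps)
      moreover have "(x + t *\<^sub>R y) \<bullet> (x + t *\<^sub>R y) = 1 + t\<^sup>2 * (y \<bullet> y)"
        using y(2) nx by (simp add: inner_add inner_commute power2_eq_square norm_eq_1 algebra_simps)
      ultimately have "c + 2 * t * (f x \<bullet> y) + t\<^sup>2 * (f y \<bullet> y) \<le> c * (1 + t\<^sup>2 * (y \<bullet> y))" by simp
      then show ?thesis by (simp add: algebra_simps)
    qed
    define a b where "a = f x \<bullet> y" and "b = c * (y \<bullet> y) - f y \<bullet> y"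
    have **: "2 * t * a \<le> t\<^sup>2 * b" for t using *[of t] by (simp add: a_def b_def algebra_simps)
    have b0: "b \<ge> 0" using quad[OF y(1)] by (simp add: b_def)
    \<comment> \<open>The value t = a / b would minimise t^2 b - 2 t a and refute \<open>**\<close>
      unless a = 0; the shift by 1 allows b = 0.\<close>
    define e where "e = a / (b+1)"
    have ae: "a = e * (b + 1)" using b0 by (simp add: e_def)
    have "2 * e * a \<le> e\<^sup>2 * b" by (rule **)
    then have "(2 * e * a) * (b+1)\<^sup>2 \<le> e\<^sup>2 * b * (b+1)\<^sup>2" by (intro mult_right_mono) auto
    then have "2 * a\<^sup>2 * (b+1) \<le> a\<^sup>2 * b" by (simp add: ae power2_eq_square ac_simps)
    then have "a\<^sup>2 * (b + 2) \<le> 0" by (simp add: algebra_simps)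
    then have "a\<^sup>2 \<le> 0" using b0 by (simp add: mult_le_0_iff)
    then show ?thesis by (simp add: a_def)
  qed
  define z where "z = f x - c *\<^sub>R x"
  have zV: "z \<in> V" using xV fV V(1) by (auto simp: z_def intro!: subspace_diff subspace_scale)
  have xz: "x \<bullet> z = 0" using nx by (simp add: z_def inner_diff inner_commute c_def norm_eq_1)
  have "z \<bullet> z = f x \<bullet> z - c * (x \<bullet> z)" by (simp add: z_def inner_diff_left)
  also have "\<dots> = 0" using orth[OF zV xz] xz by simp
  finally have "f x = c *\<^sub>R x" by (simp add: z_def)
  then show ?thesis using that xV nx by blast
qed

text \<open>Spectral theorem by induction on the dimension: the complement of an eigenvector in
  \<open>V\<close> is invariant because \<open>f\<close> is symmetric there. Symmetry is asked on
  \<open>V\<close> only, since the differentials to come are symmetric on a hyperplane and not on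
  the whole space.\<close>

lemma symmetric_eigenbasis:
  fixes f :: "'a::euclidean_space \<Rightarrow> 'a"
  assumes f: "linear f" and V: "subspace V" and fV: "f ` V \<subseteq> V"
    and sym: "\<And>x y. x \<in> V \<Longrightarrow> y \<in> V \<Longrightarrow> f x \<bullet> y = x \<bullet> f y"
  shows "\<exists>B\<subseteq>V. pairwise orthogonal B \<and> (\<forall>b\<in>B. norm b = 1) \<and> span B = V \<and> (\<forall>b\<in>B. \<exists>c. f b = c *\<^sub>R b)"
  using V fV sym
proof (induction "dim V" arbitrary: V rule: less_induct)
  case less
  show ?case
  proof (cases "V = {0}")
    case True
    then show ?thesis by (intro exI[of _ "{}"]) auto
  next
    case False
    obtain x c where x: "x \<in> V" "norm x = 1" "f x = c *\<^sub>R x"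
      using symmetric_eigenvector[OF f less.prems(1) False less.prems(2,3)] by blast
    define V' where "V' = {v \<in> V. x \<bullet> v = 0}"
    have sV': "subspace V'"
      using less.prems(1) by (auto simp: V'_def subspace_def inner_add_right)
    have "x \<notin> V'" using x(2) by (auto simp: V'_def norm_eq_1)
    then have "V' \<subset> V" using x(1) unfolding V'_def by blast
    then have "dim V' < dim V"
      using sV' less.prems(1) by (metis dim_psubset span_eq_iff)
    moreover have "f ` V' \<subseteq> V'"
    proof -
      have "x \<bullet> f v = 0" if "v \<in> V" "x \<bullet> v = 0" for v
        using less.prems(3)[OF x(1) that(1)] that(2) x(3) by simp
      then show ?thesis using less.prems(2) by (auto simp: V'_def)
    qed
    ultimately obtain B where B: "B \<subseteq> V'" "pairwise orthogonal B" "\<forall>b\<in>B. norm b = 1"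
      "span B = V'" "\<forall>b\<in>B. \<exists>c. f b = c *\<^sub>R b"
      using less.hyps[of V'] sV' less.prems(3) by (auto simp: V'_def)
    have po: "pairwise orthogonal (insert x B)"
      using B(1,2) unfolding V'_def pairwise_insert by (auto simp: orthogonal_def inner_commute)
    have "v \<in> span (insert x B)" if v: "v \<in> V" for v
    proof -
      have "v - (x \<bullet> v) *\<^sub>R x \<in> V'"
        using v x(1,2) less.prems(1)
        by (auto simp: V'_def subspace_diff subspace_scale inner_diff_right norm_eq_1)
      then have "v - (x \<bullet> v) *\<^sub>R x \<in> span B" by (simp add: B(4))
      then show ?thesis by (auto simp: span_insert)
    qed
    moreover have "insert x B \<subseteq> V" using x(1) B(1) by (auto simp: V'_def)
    ultimately have "span (insert x B) = V"
      using less.prems(1) by (metis span_minimal subsetI subset_antisym)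
    then show ?thesis
      using po B(3,5) x \<open>insert x B \<subseteq> V\<close> by (intro exI[of _ "insert x B"]) auto
  qed
qed

lemma prod_le_power_mean:
  fixes x :: "'a \<Rightarrow> real"
  assumes "finite S" and x: "\<And>i. i \<in> S \<Longrightarrow> x i \<ge> 0"
  shows "(\<Prod>i\<in>S. x i) \<le> ((\<Sum>i\<in>S. x i) / card S) ^ card S"
proof (cases "S = {}")
  case False
  then have c: "card S > 0" using assms(1) by (simp add: card_gt_0_iff)
  have "(\<Prod>i\<in>S. x i) powr (1 / card S) \<le> (\<Sum>i\<in>S. x i) / card S"
    using arith_geom_mean[OF assms(1) False x] by (simp add: sum_divide_distrib)
  then have "((\<Prod>i\<in>S. x i) powr (1 / card S)) ^ card S \<le> ((\<Sum>i\<in>S. x i) / card S) ^ card S"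
    by (intro power_mono) auto
  moreover have "((\<Prod>i\<in>S. x i) powr (1 / card S)) ^ card S = (\<Prod>i\<in>S. x i)"
  proof (cases "(\<Prod>i\<in>S. x i) = 0")
    case False
    then have "(\<Prod>i\<in>S. x i) > 0" using prod_nonneg[of S x] x by force
    then show ?thesis using c by (simp add: powr_realpow[symmetric] powr_powr)
  qed (use c in auto)
  ultimately show ?thesis by simp
qed simp

text \<open>In an orthonormal basis made of \<open>n\<close> and eigenvectors of \<open>f\<close> in
  its complement, every column but that of \<open>n\<close> is diagonal. Hence the determinant is
  the entry at \<open>n\<close> times the product of the eigenvalues, whose sum is the trace without
  that entry, and the arithmetic-geometric mean inequality applies.\<close>

lemma det_le_mean_orthogonal_complement:
  fixes f :: "real^'n::finite \<Rightarrow> real^'n"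
  assumes f: "linear f" and n: "norm n = 1"
    and fU: "\<And>x. n \<bullet> x = 0 \<Longrightarrow> n \<bullet> f x = 0"
    and sym: "\<And>x y. n \<bullet> x = 0 \<Longrightarrow> n \<bullet> y = 0 \<Longrightarrow> f x \<bullet> y = x \<bullet> f y"
    and psd: "\<And>x. n \<bullet> x = 0 \<Longrightarrow> 0 \<le> f x \<bullet> x"
  shows "\<bar>det (matrix f)\<bar> \<le> \<bar>n \<bullet> f n\<bar> *
     ((trace (matrix f) - n \<bullet> f n) / real (CARD('n) - 1)) ^ (CARD('n) - 1)"
proof -
  define U where "U = {x. n \<bullet> x = 0}"
  have "subspace U" by (auto simp: U_def subspace_hyperplane)
  moreover have "f ` U \<subseteq> U" using fU by (auto simp: U_def)
  ultimately obtain B where B: "B \<subseteq> U" "pairwise orthogonal B" "\<forall>b\<in>B. norm b = 1"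
      "span B = U" "\<forall>b\<in>B. \<exists>c. f b = c *\<^sub>R b"
    using symmetric_eigenbasis[OF f, of U] sym by (auto simp: U_def)
  define B' where "B' = insert n B"
  have nB: "n \<notin> B" using B(1) n by (auto simp: U_def)
  have po: "pairwise orthogonal B'"
    using B(1,2) unfolding B'_def U_def pairwise_insert by (auto simp: orthogonal_def inner_commute)
  have n1: "norm b = 1" if "b \<in> B'" for b using that B(3) n by (auto simp: B'_def)
  have ind: "independent B'"
    using pairwise_orthogonal_independent[OF po] n1 by fastforce
  have "v \<in> span B'" for v
  proof -
    have "v - (n \<bullet> v) *\<^sub>R n \<in> span B"
      using n by (simp add: B(4) U_def inner_diff_right norm_eq_1)
    then show ?thesis by (auto simp: span_insert B'_def)
  qed
  then have "span B' = UNIV" by auto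
  then have cB: "card B' = CARD('n)" and fB: "finite B'"
    using ind by (auto simp: dim_eq_card[of B' UNIV] independent_bound_general dest: dim_eq_card_independent)
      (metis dim_UNIV DIM_cart DIM_real mult.right_neutral dim_eq_card_independent dim_span ind)
  then obtain \<phi> :: "'n \<Rightarrow> real^'n" where \<phi>: "bij_betw \<phi> UNIV B'"
    using finite_same_card_bij[of "UNIV::'n set" B'] by auto
  obtain k where k: "\<phi> k = n" using \<phi> by (metis B'_def bij_betw_def imageE insertI1)
  have kB: "\<phi> i \<in> B" if "i \<noteq> k" for i
    using \<phi> that k unfolding bij_betw_def B'_def inj_on_def by (metis UNIV_I insertE rangeI)
  have \<phi>o: "\<phi> i \<bullet> \<phi> j = (if i = j then 1 else 0)" for i j
  proof (cases "i = j")
    case True then show ?thesis using n1[of "\<phi> i"] \<phi> by (auto simp: bij_betw_def norm_eq_1)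
  next
    case False
    then have "\<phi> i \<noteq> \<phi> j" using \<phi> by (auto simp: bij_betw_def inj_on_def)
    then show ?thesis using po \<phi> False by (auto simp: pairwise_def bij_betw_def orthogonal_def)
  qed
  define Q :: "real^'n^'n" where "Q = (\<chi> i j. \<phi> j $ i)"
  have QQ: "transpose Q ** Q = mat 1"
    using \<phi>o by (simp add: vec_eq_iff matrix_matrix_mult_def transpose_def Q_def mat_def inner_vec_def)
  then have QQ': "Q ** transpose Q = mat 1" using matrix_left_right_inverse by blast
  define M where "M = transpose Q ** (matrix f ** Q)"
  have fm: "f x = matrix f *v x" for x using f by (simp add: matrix_works linear_matrix_vector_mul_eq)
  have Mij: "M $ i $ j = \<phi> i \<bullet> f (\<phi> j)" for i j
    by (simp add: M_def fm matrix_matrix_mult_def matrix_vector_mult_def transpose_def Q_def inner_vec_def)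
  have "det M = det (transpose Q ** Q) * det (matrix f)"
    by (simp add: M_def det_mul det_transpose)
  then have dM: "det M = det (matrix f)" by (simp add: QQ)
  have tM: "trace M = trace (matrix f)"
    unfolding M_def by (subst trace_mul_sym) (simp add: matrix_mul_assoc[symmetric] QQ')
  \<comment> \<open>The value 1 at \<open>k\<close> leaves the column of \<open>n\<close> untouched:
    \<open>f n\<close> need not be a multiple of \<open>n\<close>, so only the eigenvalues are split
    off as a diagonal factor.\<close>
  define c where "c j = (if j = k then 1 else \<phi> j \<bullet> f (\<phi> j))" for j
  have fj: "f (\<phi> j) = c j *\<^sub>R \<phi> j" if jk: "j \<noteq> k" for j
  proof -
    obtain e where e: "f (\<phi> j) = e *\<^sub>R \<phi> j" using B(5) kB[OF jk] by blast
    then show ?thesis using jk \<phi>o[of j j] by (simp add: c_def)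
  qed
  have c0: "c j \<ge> 0" for j
    using psd[of "\<phi> j"] kB[of j] B(1) by (auto simp: c_def U_def inner_commute)
  define y where "y = (\<chi> i. M $ i $ k)"
  \<comment> \<open>The identity with column \<open>k\<close> replaced by \<open>y\<close>, written
    with \<open>mat 1 *v y\<close> to match the form that \<open>cramer_lemma\<close>
    evaluates.\<close>
  define N :: "real^'n^'n" where "N = (\<chi> i j. if j = k then (mat 1 *v y) $ i else mat 1 $ i $ j)"
  have "M = N ** (\<chi> i j. if i = j then c j else 0)"
  proof -
    have "M $ i $ j = (\<Sum>l\<in>UNIV. N $ i $ l * (if l = j then c j else 0))" for i j
    proof -
      have "(\<Sum>l\<in>UNIV. N $ i $ l * (if l = j then c j else 0)) = N $ i $ j * c j"
        by (simp add: if_distrib[of "(*) _"] cong: if_cong)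
      note * = this
      show ?thesis
      proof (cases "j = k")
        case False
        then show ?thesis using * by (simp add: N_def Mij fj[OF False] \<phi>o mat_def)
      qed (unfold *, simp add: N_def y_def c_def)
    qed
    then show ?thesis by (simp add: vec_eq_iff matrix_matrix_mult_def)
  qed
  then have "det M = det N * (\<Prod>j\<in>UNIV. c j)"
    by (simp add: det_mul det_diagonal)
  also have "det N = y $ k" unfolding N_def by (subst cramer_lemma) simp
  also have "y $ k = n \<bullet> f n" by (simp add: y_def Mij k)
  also have "(\<Prod>j\<in>UNIV. c j) = (\<Prod>j\<in>UNIV-{k}. c j)"
    by (rule prod.mono_neutral_right) (auto simp: c_def)
  finally have "\<bar>det (matrix f)\<bar> = \<bar>n \<bullet> f n\<bar> * (\<Prod>j\<in>UNIV-{k}. c j)"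
    using c0 by (simp add: dM abs_mult prod_nonneg)
  also have "(\<Prod>j\<in>UNIV-{k}. c j) \<le> ((\<Sum>j\<in>UNIV-{k}. c j) / card (UNIV-{k})) ^ card (UNIV-{k})"
    using c0 by (intro prod_le_power_mean) auto
  also have "(\<Sum>j\<in>UNIV-{k}. c j) = (\<Sum>j\<in>UNIV-{k}. M $ j $ j)"
    by (intro sum.cong) (auto simp: c_def Mij)
  also have "\<dots> = trace M - M $ k $ k"
    by (simp add: trace_def sum_diff1)
  also have "\<dots> = trace (matrix f) - n \<bullet> f n" by (simp add: tM Mij k)
  finally show ?thesis by (simp add: mult_left_mono)
qed

section \<open>Measure of images\<close>

text \<open>The image of a Borel set is only known to be Lebesgue measurable, hence the detour
  through a Borel subset \<open>B\<close> of it. If the right-hand side is infinite nothing is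
  claimed; otherwise it supplies the integrability of the Jacobian that the image theorems
  require.\<close>

lemma emeasure_subset_image_le_wellorder:
  fixes f :: "real^'m::{finite,wellorder} \<Rightarrow> real^'m::_"
  assumes E: "E \<in> sets borel"
    and der: "\<And>x. x \<in> E \<Longrightarrow> (f has_derivative f' x) (at x within E)"
    and J: "J \<in> borel_measurable borel"
    and det: "\<And>x. x \<in> E \<Longrightarrow> \<bar>det (matrix (f' x))\<bar> \<le> J x"
    and B: "B \<in> sets borel" "B \<subseteq> f ` E"
  shows "emeasure lborel B \<le> (\<integral>\<^sup>+x. ennreal (J x) * indicator E x \<partial>lborel)"
proof (cases "(\<integral>\<^sup>+x. ennreal (J x) * indicator E x \<partial>lborel) = \<infinity>")
  case False
  define D where "D x = \<bar>det (matrix (f' x))\<bar>" for x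
  have EL: "E \<in> sets lebesgue" using E by simp
  have Dm: "D \<in> borel_measurable (lebesgue_on E)"
    unfolding D_def using borel_measurable_det_Jacobian[OF EL der] by simp
  have JE: "(\<integral>\<^sup>+x. ennreal (J x) * indicator E x \<partial>lborel) = (\<integral>\<^sup>+x. ennreal (J x) \<partial>(lebesgue_on E))"
    using E J by (simp add: nn_integral_restrict_space nn_integral_completion)
  have le: "(\<integral>\<^sup>+x. ennreal (D x) \<partial>(lebesgue_on E)) \<le> (\<integral>\<^sup>+x. ennreal (J x) \<partial>(lebesgue_on E))"
    using det by (intro nn_integral_mono) (auto simp: D_def space_restrict_space intro!: ennreal_leI)
  have Di: "integrable (lebesgue_on E) D"
  proof (rule integrableI_bounded[OF Dm])
    have "(\<integral>\<^sup>+x. ennreal (J x) \<partial>(lebesgue_on E)) < \<infinity>"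
      using False JE by (simp add: less_top)
    then have "(\<integral>\<^sup>+x. ennreal (D x) \<partial>(lebesgue_on E)) < \<infinity>" by (rule le_less_trans[OF le])
    then show "(\<integral>\<^sup>+x. ennreal (norm (D x)) \<partial>(lebesgue_on E)) < \<infinity>" by (simp add: D_def)
  qed
  then have "D integrable_on E" by (rule integrable_on_lebesgue_on[OF _ EL])
  then have *: "f ` E \<in> lmeasurable" "measure lebesgue (f ` E) \<le> integral E D"
    unfolding D_def
    by - (rule measurable_differentiable_image[OF EL der] measure_differentiable_image[OF EL der]; assumption)+
  have "emeasure lborel B = emeasure lebesgue B" using B by (simp add: emeasure_completion)
  also have "\<dots> \<le> emeasure lebesgue (f ` E)"
    using B * by (intro emeasure_mono) auto
  also have "\<dots> = ennreal (measure lebesgue (f ` E))"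
    using * by (simp add: emeasure_eq_measure2 fmeasurableD2)
  also have "\<dots> \<le> ennreal (integral E D)" using * by (intro ennreal_leI)
  also have "integral E D = integral\<^sup>L (lebesgue_on E) D"
    using Di EL by (simp add: lebesgue_integral_eq_integral)
  also have "ennreal \<dots> = (\<integral>\<^sup>+x. ennreal (D x) \<partial>(lebesgue_on E))"
    using Di by (intro nn_integral_eq_integral[symmetric]) (auto simp: D_def)
  finally show ?thesis using le JE by simp
qed simp

text \<open>The library's theorems on measures of differentiable images require a well-ordered index type; this
  is a copy of a finite type with an arbitrary well-order.\<close>
typedef 'a wo = "UNIV :: 'a set" morphisms unwo mkwo ..

lemma mkwo_unwo [simp]: "mkwo (unwo x) = x" "unwo (mkwo i) = i"
  by (simp_all add: unwo_inverse mkwo_inverse)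

lemma bij_unwo: "bij unwo"
  by (metis bijI' mkwo_unwo)

instance wo :: (finite) finite
proof
  show "finite (UNIV :: 'a wo set)"
    using bij_unwo[where 'a='a] by (metis bij_betw_finite finite)
qed

lemma card_wo: "CARD('a wo) = CARD('a)"
  using bij_unwo[where 'a='a] by (metis bij_betw_same_card)

definition wo_index :: "'a::finite wo \<Rightarrow> nat" where
  "wo_index = (SOME f. inj f)"

lemma inj_wo_index: "inj (wo_index :: 'a::finite wo \<Rightarrow> nat)"
  unfolding wo_index_def
proof (rule someI_ex[of inj])
  show "\<exists>f :: 'a wo \<Rightarrow> nat. inj f"
    using finite_imp_inj_to_nat_seg[of "UNIV::'a wo set"] by auto
qed

instantiation wo :: (finite) wellorder
begin

definition less_eq_wo :: "'a wo \<Rightarrow> 'a wo \<Rightarrow> bool" where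
  "less_eq_wo x y \<longleftrightarrow> wo_index x \<le> wo_index y"

definition less_wo :: "'a wo \<Rightarrow> 'a wo \<Rightarrow> bool" where
  "less_wo x y \<longleftrightarrow> wo_index x < wo_index y"

instance
proof
  fix x y :: "'a wo" assume "x \<le> y" "y \<le> x"
  then have "wo_index x = wo_index y" by (simp add: less_eq_wo_def)
  then show "x = y" by (rule injD[OF inj_wo_index])
next
  fix P :: "'a wo \<Rightarrow> bool" and a :: "'a wo"
  assume *: "\<And>x. (\<And>y. y < x \<Longrightarrow> P y) \<Longrightarrow> P x"
  show "P a" by (induction a rule: measure_induct_rule[of wo_index], rule *) (simp add: less_wo_def)
qed (auto simp: less_eq_wo_def less_wo_def)

end

definition to_wo :: "real^'n::finite \<Rightarrow> real^('n wo)" where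
  "to_wo x = (\<chi> j. x $ unwo j)"

definition of_wo :: "real^('n wo) \<Rightarrow> real^'n::finite" where
  "of_wo y = (\<chi> i. y $ mkwo i)"

lemma to_wo_of_wo [simp]: "to_wo (of_wo y) = y" "of_wo (to_wo x) = x"
  by (simp_all add: to_wo_def of_wo_def vec_eq_iff)

lemma linear_to_wo: "linear to_wo" and linear_of_wo: "linear of_wo"
  by (auto intro!: linearI simp: to_wo_def of_wo_def vec_eq_iff)

lemma bounded_linear_to_wo: "bounded_linear to_wo" and bounded_linear_of_wo: "bounded_linear of_wo"
  using linear_to_wo linear_of_wo by (auto simp: linear_conv_bounded_linear)

lemma inner_of_wo [simp]: "of_wo x \<bullet> of_wo y = x \<bullet> y"
  unfolding inner_vec_def of_wo_def
  by (rule sum.reindex_bij_witness[of _ unwo mkwo]) auto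

lemma inner_to_wo [simp]: "to_wo x \<bullet> y = x \<bullet> of_wo y" "y \<bullet> to_wo x = of_wo y \<bullet> x"
  by (metis inner_of_wo to_wo_of_wo(2))+

lemma borel_to_wo [measurable]: "to_wo \<in> borel_measurable borel"
  and borel_of_wo [measurable]: "of_wo \<in> borel_measurable borel"
  using bounded_linear_to_wo bounded_linear_of_wo
  by (auto intro!: borel_measurable_continuous_onI linear_continuous_on)

text \<open>Relabelling coordinates maps boxes to boxes with the same side lengths, and boxes
  determine Lebesgue measure.\<close>

lemma distr_of_wo: "distr lborel borel (of_wo :: _ \<Rightarrow> real^'n::finite) = lborel"
proof (rule lborel_eqI[symmetric])
  fix l u :: "real^'n"
  assume lu: "\<And>b. b \<in> Basis \<Longrightarrow> l \<bullet> b \<le> u \<bullet> b"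
  then have lu': "l $ i \<le> u $ i" for i using lu[of "axis i 1"] by (simp add: inner_axis axis_in_Basis_iff)
  have pre: "of_wo -` box l u = box (to_wo l) (to_wo u)"
    by (auto simp: mem_box_cart to_wo_def of_wo_def) (metis mkwo_unwo(1), metis mkwo_unwo(1), metis mkwo_unwo(2), metis mkwo_unwo(2))
  have prodB: "(\<Prod>b\<in>Basis. (b' - a') \<bullet> b) = (\<Prod>i\<in>UNIV. b' $ i - a' $ i)" for a' b' :: "real^'k::finite"
  proof -
    have *: "(Basis :: (real^'k) set) = range (\<lambda>i. axis i 1)" by (auto simp: Basis_vec_def)
    show ?thesis unfolding * by (subst prod.reindex) (auto simp: inj_on_def axis_eq_axis inner_axis)
  qed
  have "emeasure (distr lborel borel of_wo) (box l u) = emeasure lborel (box (to_wo l) (to_wo u))"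
    by (simp add: emeasure_distr pre)
  also have "\<dots> = (\<Prod>b\<in>Basis. (to_wo u - to_wo l) \<bullet> b)"
  proof (rule emeasure_lborel_box)
    fix b :: "real^'n wo" assume "b \<in> Basis"
    then obtain j where "b = axis j 1" by (auto simp: Basis_vec_def)
    then show "to_wo l \<bullet> b \<le> to_wo u \<bullet> b" using lu' by (simp add: inner_axis to_wo_def)
  qed
  also have "\<dots> = (\<Prod>b\<in>Basis. (u - l) \<bullet> b)"
    unfolding prodB ennreal_inj
    by (rule arg_cong[where f=ennreal], rule prod.reindex_bij_witness[of _ mkwo unwo]) (auto simp: to_wo_def)
  finally show "emeasure (distr lborel borel of_wo) (box l u) = (\<Prod>b\<in>Basis. (u - l) \<bullet> b)" .
qed simp

lemma trace_conj_wo: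
  "trace (matrix (\<lambda>y. to_wo (g (of_wo y)))) = trace (matrix g)" for g :: "real^'n::finite \<Rightarrow> real^'n"
proof -
  have "of_wo (axis j 1) = axis (unwo j) 1" for j :: "'n wo"
    by (auto simp: of_wo_def axis_def vec_eq_iff)
  then show ?thesis
    unfolding trace_def matrix_def
    by (intro sum.reindex_bij_witness[of _ mkwo unwo]) (auto simp: to_wo_def)
qed

text \<open>The hypotheses speak of inner products and traces instead of determinants: these are
  unchanged when the coordinates are relabelled, so the estimate transfers from the well-ordered
  copy to an arbitrary index type.\<close>

lemma emeasure_subset_image_le:
  fixes f :: "real^'n::finite \<Rightarrow> real^'n"
  assumes E: "E \<in> sets borel"
    and der: "\<And>x. x \<in> E \<Longrightarrow> (f has_derivative f' x) (at x within E)"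
    and J: "J \<in> borel_measurable borel"
    and n: "\<And>x. x \<in> E \<Longrightarrow> norm (n x) = 1"
    and f'U: "\<And>x h. x \<in> E \<Longrightarrow> n x \<bullet> h = 0 \<Longrightarrow> n x \<bullet> f' x h = 0"
    and sym: "\<And>x h k. x \<in> E \<Longrightarrow> n x \<bullet> h = 0 \<Longrightarrow> n x \<bullet> k = 0 \<Longrightarrow> f' x h \<bullet> k = h \<bullet> f' x k"
    and psd: "\<And>x h. x \<in> E \<Longrightarrow> n x \<bullet> h = 0 \<Longrightarrow> 0 \<le> f' x h \<bullet> h"
    and bd: "\<And>x. x \<in> E \<Longrightarrow> \<bar>n x \<bullet> f' x (n x)\<bar> *
     ((trace (matrix (f' x)) - n x \<bullet> f' x (n x)) / real (CARD('n) - 1)) ^ (CARD('n) - 1) \<le> J x"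
    and B: "B \<in> sets borel" "B \<subseteq> f ` E"
  shows "emeasure lborel B \<le> (\<integral>\<^sup>+x. ennreal (J x) * indicator E x \<partial>lborel)"
proof -
  define F where "F = (\<lambda>y. to_wo (f (of_wo y)))"
  define F' where "F' = (\<lambda>y h. to_wo (f' (of_wo y) (of_wo h)))"
  define E' where "E' = of_wo -` E"
  have [measurable]: "E \<in> sets borel" "B \<in> sets borel" "J \<in> borel_measurable borel" by fact+
  have E': "E' \<in> sets borel" using measurable_sets[OF borel_of_wo E] by (simp add: E'_def)
  have derF: "(F has_derivative F' y) (at y within E')" if "y \<in> E'" for y
  proof -
    have "(f has_derivative f' (of_wo y)) (at (of_wo y) within (of_wo ` E'))"
      using der[of "of_wo y"] that by (auto simp: E'_def intro: has_derivative_subset)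
    moreover have "(of_wo has_derivative of_wo) (at y within E')"
      by (rule bounded_linear.has_derivative[OF bounded_linear_of_wo has_derivative_ident])
    ultimately have "((\<lambda>y. f (of_wo y)) has_derivative (\<lambda>h. f' (of_wo y) (of_wo h))) (at y within E')"
      by (rule has_derivative_in_compose[rotated])
    then show ?thesis unfolding F_def F'_def
      by (rule bounded_linear.has_derivative[OF bounded_linear_to_wo])
  qed
  have "emeasure lborel (of_wo -` B) \<le> (\<integral>\<^sup>+y. ennreal (J (of_wo y)) * indicator E' y \<partial>lborel)"
  proof (rule emeasure_subset_image_le_wellorder[OF E' derF])
    fix y assume "y \<in> E'"
    then have y: "of_wo y \<in> E" by (simp add: E'_def)
    have lin: "linear (F' y)" using derF[OF \<open>y \<in> E'\<close>] by (rule has_derivative_linear)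
    have tr: "trace (matrix (F' y)) = trace (matrix (f' (of_wo y)))"
      unfolding F'_def by (rule trace_conj_wo)
    have "\<bar>det (matrix (F' y))\<bar> \<le> \<bar>to_wo (n (of_wo y)) \<bullet> F' y (to_wo (n (of_wo y)))\<bar> *
     ((trace (matrix (F' y)) - to_wo (n (of_wo y)) \<bullet> F' y (to_wo (n (of_wo y)))) / real (CARD('n wo) - 1)) ^ (CARD('n wo) - 1)"
    proof (rule det_le_mean_orthogonal_complement[OF lin])
      show "norm (to_wo (n (of_wo y))) = 1" using n[OF y] by (simp add: norm_eq_1)
    next
      fix h assume "to_wo (n (of_wo y)) \<bullet> h = 0"
      then show "to_wo (n (of_wo y)) \<bullet> F' y h = 0" "0 \<le> F' y h \<bullet> h"
        using f'U[OF y, of "of_wo h"] psd[OF y, of "of_wo h"] by (simp_all add: F'_def)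
    next
      fix h k assume "to_wo (n (of_wo y)) \<bullet> h = 0" "to_wo (n (of_wo y)) \<bullet> k = 0"
      then show "F' y h \<bullet> k = h \<bullet> F' y k"
        using sym[OF y, of "of_wo h" "of_wo k"] by (simp add: F'_def)
    qed
    also have "\<dots> \<le> J (of_wo y)" using bd[OF y] unfolding tr card_wo by (simp add: F'_def)
    finally show "\<bar>det (matrix (F' y))\<bar> \<le> J (of_wo y)" .
  next
    show "of_wo -` B \<in> sets borel" using measurable_sets[OF borel_of_wo B(1)] by simp
    show "of_wo -` B \<subseteq> F ` E'"
    proof
      fix y assume "y \<in> of_wo -` B"
      then obtain x where "x \<in> E" "of_wo y = f x" using B(2) by auto
      then have "y = F (to_wo x)" "to_wo x \<in> E'" by (simp_all add: F_def E'_def) (metis to_wo_of_wo(1))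
      then show "y \<in> F ` E'" by blast
    qed
  qed measurable
  moreover have "emeasure lborel (of_wo -` B) = emeasure lborel B"
    using emeasure_distr[of of_wo lborel borel B] B(1) by (simp add: distr_of_wo)
  moreover have "(\<integral>\<^sup>+x. ennreal (J x) * indicator E x \<partial>lborel) = (\<integral>\<^sup>+y. ennreal (J (of_wo y)) * indicator E' y \<partial>lborel)"
  proof -
    have *: "(\<lambda>x. ennreal (J x) * indicator E x) \<in> borel_measurable borel" by measurable
    show ?thesis
      using nn_integral_distr[of of_wo lborel borel "\<lambda>x. ennreal (J x) * indicator E x"] *
      by (simp add: distr_of_wo E'_def indicator_vimage)
  qed
  ultimately show ?thesis by simp
qed

section \<open>Twice continuously differentiable functions\<close>

lemma linear_functional_eq_sum: "(\<Sum>i\<in>UNIV. (f (axis i 1)) * (a::real^'n) $ i) = f a" if "linear f" for f :: "real^'n \<Rightarrow> real"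
proof -
  have "f a = f (\<Sum>i\<in>UNIV. a $ i *\<^sub>R axis i 1)"
    using basis_expansion[of a] by (simp add: scalar_mult_eq_scaleR)
  also have "\<dots> = (\<Sum>i\<in>UNIV. (f (axis i 1)) * a $ i)"
    using that by (simp add: linear_sum linear_scale mult.commute)
  finally show ?thesis by simp
qed

locale C2_function =
  fixes u :: "real^'n::finite \<Rightarrow> real" and g :: "real^'n \<Rightarrow> real^'n" and H :: "real^'n \<Rightarrow> real^'n \<Rightarrow> real^'n"
  assumes du: "\<And>x. (u has_derivative (\<lambda>h. g x \<bullet> h)) (at x)"
    and dg: "\<And>x. (g has_derivative H x) (at x)"
    and cH: "\<And>v. continuous_on UNIV (\<lambda>x. H x v)"
begin

lemma linear_H: "linear (H x)"
  using dg has_derivative_linear by blast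

lemma continuous_u: "continuous_on UNIV u" and continuous_g: "continuous_on UNIV g"
  by (rule has_derivative_continuous_on, rule has_derivative_at_withinI, rule du dg)+

lemma grad_eq: "grad u x = g x"
proof -
  have "frechet_derivative u (at x) = (\<lambda>h. g x \<bullet> h)"
    using frechet_derivative_at[OF du[of x]] by simp
  then show ?thesis by (simp add: grad_def vec_eq_iff inner_axis)
qed

text \<open>The mean value theorem in direction \<open>h\<close> turns the second difference of
  \<open>u\<close> into a first difference of \<open>g\<close>, which differentiability of
  \<open>g\<close> at \<open>x\<close> controls. The second difference is symmetric in
  \<open>h\<close> and \<open>k\<close>, which is the purpose of the estimate.\<close>

lemma second_difference_bound:
  assumes t: "t > 0" and e: "e \<ge> 0"
    and d: "\<And>y. norm (y - x) \<le> t * (norm h + norm k) \<Longrightarrow> norm (g y - g x - H x (y - x)) \<le> e * norm (y - x)"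
  shows "\<bar>u (x + t *\<^sub>R h + t *\<^sub>R k) - u (x + t *\<^sub>R h) - u (x + t *\<^sub>R k) + u x - t\<^sup>2 * (H x k \<bullet> h)\<bar>
    \<le> 2 * e * t\<^sup>2 * (norm h + norm k) * norm h"
proof -
  define \<phi> where "\<phi> s = u (x + s *\<^sub>R h + t *\<^sub>R k) - u (x + s *\<^sub>R h)" for s
  have d1: "(\<phi> has_real_derivative (g (x + s *\<^sub>R h + t *\<^sub>R k) - g (x + s *\<^sub>R h)) \<bullet> h) (at s)" for s
    unfolding \<phi>_def has_field_derivative_def
    by (rule has_derivative_eq_rhs, (rule derivative_eq_intros has_derivative_compose[OF _ du] refl)+)
       (auto simp: inner_diff_left algebra_simps)
  obtain \<xi> where \<xi>: "0 < \<xi>" "\<xi> < t" "\<phi> t - \<phi> 0 = (t - 0) * ((g (x + \<xi> *\<^sub>R h + t *\<^sub>R k) - g (x + \<xi> *\<^sub>R h)) \<bullet> h)"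
    using MVT2[OF t, of \<phi> "\<lambda>s. (g (x + s *\<^sub>R h + t *\<^sub>R k) - g (x + s *\<^sub>R h)) \<bullet> h"] d1 by blast
  define a where "a = \<xi> *\<^sub>R h + t *\<^sub>R k"
  define b where "b = \<xi> *\<^sub>R h"
  have "norm (\<xi> *\<^sub>R h) \<le> t * norm h" using \<xi> by (simp add: mult_right_mono)
  moreover have "norm (t *\<^sub>R k) = t * norm k" using t by simp
  moreover have "0 \<le> t * norm k" using t by simp
  ultimately have na: "norm a \<le> t * (norm h + norm k)" and nb: "norm b \<le> t * (norm h + norm k)"
    unfolding a_def b_def distrib_left
    using norm_triangle_ineq[of "\<xi> *\<^sub>R h" "t *\<^sub>R k"] by linarith+
  have ea: "norm (g (x + a) - g x - H x a) \<le> e * (t * (norm h + norm k))"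
    using d[of "x + a"] na e by (simp add: order_trans[OF _ mult_left_mono])
  have eb: "norm (g (x + b) - g x - H x b) \<le> e * (t * (norm h + norm k))"
    using d[of "x + b"] nb e by (simp add: order_trans[OF _ mult_left_mono])
  have "H x a - H x b = t *\<^sub>R H x k"
    using linear_H by (simp add: a_def b_def linear_add linear_scale)
  then have eq: "g (x + a) - g (x + b) - t *\<^sub>R H x k = (g (x + a) - g x - H x a) - (g (x + b) - g x - H x b)"
    by (simp add: algebra_simps)
  have "norm (g (x + a) - g (x + b) - t *\<^sub>R H x k) \<le> 2 * e * t * (norm h + norm k)"
    unfolding eq using norm_triangle_ineq4[of "g (x + a) - g x - H x a" "g (x + b) - g x - H x b"] ea eb by simp
  then have *: "\<bar>(g (x + a) - g (x + b) - t *\<^sub>R H x k) \<bullet> h\<bar> \<le> 2 * e * t * (norm h + norm k) * norm h"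
    by (meson Cauchy_Schwarz_ineq2 mult_right_mono norm_ge_zero order_trans)
  have "u (x + t *\<^sub>R h + t *\<^sub>R k) - u (x + t *\<^sub>R h) - u (x + t *\<^sub>R k) + u x - t\<^sup>2 * (H x k \<bullet> h)
    = t * ((g (x + a) - g (x + b) - t *\<^sub>R H x k) \<bullet> h)"
    using \<xi>(3) by (simp add: \<phi>_def a_def b_def add.assoc inner_diff_left power2_eq_square algebra_simps)
  then have "\<bar>u (x + t *\<^sub>R h + t *\<^sub>R k) - u (x + t *\<^sub>R h) - u (x + t *\<^sub>R k) + u x - t\<^sup>2 * (H x k \<bullet> h)\<bar>
    = t * \<bar>(g (x + a) - g (x + b) - t *\<^sub>R H x k) \<bullet> h\<bar>"
    using t by (simp only: abs_mult abs_of_pos)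
  also have "\<dots> \<le> t * (2 * e * t * (norm h + norm k) * norm h)"
    using * t by (intro mult_left_mono) auto
  finally show ?thesis by (simp only: power2_eq_square ac_simps)
qed

text \<open>Both Hessian pairings approximate the same second difference, divided by t^2, with an
  error proportional to an arbitrary \<open>e\<close>.\<close>

lemma H_symmetric: "H x h \<bullet> k = H x k \<bullet> h"
proof -
  have main: "\<bar>H x h \<bullet> k - H x k \<bullet> h\<bar> \<le> 2 * e * (norm h + norm k)\<^sup>2" if e: "e > 0" for e
  proof -
    obtain d where d: "d > 0" "\<And>y. norm (y - x) < d \<Longrightarrow> norm (g y - g x - H x (y - x)) \<le> e * norm (y - x)"
      using dg[of x] e unfolding has_derivative_at_alt by blast
    \<comment> \<open>Small enough that all increments stay within distance \<open>d\<close>; the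
      summand 1 covers h = k = 0.\<close>
    define t where "t = d / (2 * (norm h + norm k + 1))"
    have t: "t > 0" using d by (simp add: t_def add_nonneg_pos)
    have pos: "norm h + norm k + 1 > 0" by (simp add: add_nonneg_pos)
    have "t * (norm h + norm k + 1) = d / 2"
    proof -
      have "d / (2 * c) * c = d / 2" if "c > 0" for c :: real using that by simp
      from this[OF pos] show ?thesis unfolding t_def .
    qed
    then have "t * (norm h + norm k) < d"
      using t d(1) by (simp add: distrib_left)
    then have near: "\<And>y. norm (y - x) \<le> t * (norm h + norm k) \<Longrightarrow> norm (g y - g x - H x (y - x)) \<le> e * norm (y - x)"
      using d(2) by (meson le_less_trans)
    have 1: "\<bar>u (x + t *\<^sub>R h + t *\<^sub>R k) - u (x + t *\<^sub>R h) - u (x + t *\<^sub>R k) + u x - t\<^sup>2 * (H x k \<bullet> h)\<bar>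
      \<le> 2 * e * t\<^sup>2 * (norm h + norm k) * norm h"
      using e by (intro second_difference_bound[OF t _ near]) auto
    have 2: "\<bar>u (x + t *\<^sub>R k + t *\<^sub>R h) - u (x + t *\<^sub>R k) - u (x + t *\<^sub>R h) + u x - t\<^sup>2 * (H x h \<bullet> k)\<bar>
      \<le> 2 * e * t\<^sup>2 * (norm k + norm h) * norm k"
      using e by (intro second_difference_bound[OF t _ near]) (auto simp: add.commute)
    have c: "x + t *\<^sub>R k + t *\<^sub>R h = x + t *\<^sub>R h + t *\<^sub>R k" by (simp add: algebra_simps)
    have "\<bar>t\<^sup>2 * (H x h \<bullet> k) - t\<^sup>2 * (H x k \<bullet> h)\<bar> \<le> 2 * e * t\<^sup>2 * (norm h + norm k) * norm h + 2 * e * t\<^sup>2 * (norm h + norm k) * norm k"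
      using 1 2 unfolding c add.commute[of "norm k"] by linarith
    also have "\<dots> = t\<^sup>2 * (2 * e * (norm h + norm k)\<^sup>2)"
      by (simp add: power2_eq_square algebra_simps)
    also have "\<bar>t\<^sup>2 * (H x h \<bullet> k) - t\<^sup>2 * (H x k \<bullet> h)\<bar> = t\<^sup>2 * \<bar>H x h \<bullet> k - H x k \<bullet> h\<bar>"
      by (simp add: abs_mult flip: right_diff_distrib)
    finally show ?thesis using t by simp
  qed
  have "\<bar>H x h \<bullet> k - H x k \<bullet> h\<bar> \<le> 0"
  proof (rule field_le_epsilon)
    fix e :: real assume e: "e > 0"
    define c where "c = 2 * (norm h + norm k)\<^sup>2 + 1"
    have c: "c > 0" by (simp add: c_def add_nonneg_pos)
    have "2 * (e / c) * (norm h + norm k)\<^sup>2 \<le> e"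
    proof -
      have "2 * (e / c) * (norm h + norm k)\<^sup>2 \<le> e / c * c"
        using c e by (simp only: mult.commute[of 2] mult.assoc) (intro mult_left_mono, auto simp: c_def)
      then show ?thesis using c by simp
    qed
    then show "\<bar>H x h \<bullet> k - H x k \<bullet> h\<bar> \<le> 0 + e"
      using main[of "e / c"] c e by simp
  qed
  then show ?thesis by simp
qed

definition nu :: "real^'n \<Rightarrow> real^'n" where "nu x = g x /\<^sub>R norm (g x)"

text \<open>The differential of the unit normal. On the tangent hyperplane it is, up to sign, the
  shape operator of the level set, so its trace is the divergence occurring in
  \<open>Wdens\<close>.\<close>

definition Dnu :: "real^'n \<Rightarrow> real^'n \<Rightarrow> real^'n" where
  "Dnu x h = (H x h - (nu x \<bullet> H x h) *\<^sub>R nu x) /\<^sub>R norm (g x)"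

lemma norm_nu: "g x \<noteq> 0 \<Longrightarrow> norm (nu x) = 1"
  by (simp add: nu_def)

lemma g_eq_nu: "g x = norm (g x) *\<^sub>R nu x"
  by (cases "g x = 0") (simp_all add: nu_def)

lemma has_derivative_nu:
  assumes "g x \<noteq> 0"
  shows "(nu has_derivative Dnu x) (at x)"
proof -
  have n: "((\<lambda>y. norm (g y)) has_derivative (\<lambda>h. H x h \<bullet> sgn (g x))) (at x)"
    using has_derivative_compose[OF dg[of x] has_derivative_norm[OF assms]] by simp
  have "((\<lambda>y. inverse (norm (g y))) has_derivative (\<lambda>h. - (inverse (norm (g x)) * (H x h \<bullet> sgn (g x)) * inverse (norm (g x))))) (at x)"
    using Deriv.has_derivative_inverse[OF _ n] assms by simp
  from has_derivative_scaleR[OF this dg[of x]]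
  have "(nu has_derivative (\<lambda>h. inverse (norm (g x)) *\<^sub>R H x h + (- (inverse (norm (g x)) * (H x h \<bullet> sgn (g x)) * inverse (norm (g x)))) *\<^sub>R g x)) (at x)"
    unfolding nu_def[abs_def] .
  moreover have "(\<lambda>h. inverse (norm (g x)) *\<^sub>R H x h + (- (inverse (norm (g x)) * (H x h \<bullet> sgn (g x)) * inverse (norm (g x)))) *\<^sub>R g x) = Dnu x"
    by (rule ext) (simp add: Dnu_def nu_def sgn_div_norm inner_commute algebra_simps)
  ultimately show ?thesis by simp
qed

lemma trace_Dnu: "trace (matrix (Dnu x)) = ((\<Sum>i\<in>UNIV. H x (axis i 1) $ i) - nu x \<bullet> H x (nu x)) / norm (g x)"
proof -
  have "linear (\<lambda>h. nu x \<bullet> H x h)"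
    using linear_H[of x] by (intro linearI) (auto simp: linear_add linear_scale inner_add_right)
  from linear_functional_eq_sum[OF this, of "nu x"] show ?thesis
    by (simp add: trace_def matrix_def Dnu_def sum_subtractf divide_inverse algebra_simps flip: sum_distrib_left)
qed

lemma divg_nu:
  assumes "g x \<noteq> 0"
  shows "divg (\<lambda>y. grad u y /\<^sub>R norm (grad u y)) x = trace (matrix (Dnu x))"
  using frechet_derivative_at[OF has_derivative_nu[OF assms]]
  unfolding divg_def grad_eq trace_def matrix_def nu_def[abs_def] by simp

lemma Wdens_eq: "Wdens u x = (if g x = 0 then 0 else norm (g x) * \<bar>trace (matrix (Dnu x))\<bar> ^ (CARD('n) - 1))"
  by (cases "g x = 0") (simp_all add: Wdens_def divg_nu[unfolded grad_eq] grad_eq)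

lemma measurable_H: "(\<lambda>x. H x (f x)) \<in> borel_measurable borel" if "f \<in> borel_measurable borel" for f
proof -
  have "H x (f x) = (\<Sum>i\<in>UNIV. f x $ i *\<^sub>R H x (axis i 1))" for x
  proof -
    have "H x (f x) = H x (\<Sum>i\<in>UNIV. f x $ i *\<^sub>R axis i 1)"
      using basis_expansion[of "f x"] by (simp add: scalar_mult_eq_scaleR)
    then show ?thesis using linear_H by (simp add: linear_sum linear_scale)
  qed
  moreover have "(\<lambda>x. \<Sum>i\<in>UNIV. f x $ i *\<^sub>R H x (axis i 1)) \<in> borel_measurable borel"
  proof (intro borel_measurable_sum borel_measurable_scaleR)
    show "(\<lambda>x. f x $ i) \<in> borel_measurable borel" for i
      unfolding cart_eq_inner_axis using that by measurable
    show "(\<lambda>x. H x (axis i 1)) \<in> borel_measurable borel" for i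
      using cH by (intro borel_measurable_continuous_onI)
  qed
  ultimately show ?thesis by simp
qed

lemma Wdens_measurable: "Wdens u \<in> borel_measurable borel"
proof -
  have [measurable]: "g \<in> borel_measurable borel"
    using continuous_g by (rule borel_measurable_continuous_onI)
  have [measurable]: "nu \<in> borel_measurable borel" unfolding nu_def by measurable
  have [measurable]: "(\<lambda>x. H x (nu x)) \<in> borel_measurable borel" by (rule measurable_H) measurable
  have [measurable]: "(\<lambda>x. H x (axis i 1) $ i) \<in> borel_measurable borel" for i
    unfolding cart_eq_inner_axis using measurable_H[of "\<lambda>_. axis i 1"] by measurable
  show ?thesis unfolding Wdens_eq[abs_def] trace_Dnu by measurable
qed

lemma Wdens_nonneg: "0 \<le> Wdens u x"
  by (simp add: Wdens_eq)

end

section \<open>Contact points of superlevel sets\<close>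

text \<open>Cut the range of \<open>s\<close> into cells of length 1/m. Points of \<open>S\<close>
  with index in the same cell lie within C/m^2 of each other, and there are O(m) cells, so
  \<open>S\<close> is covered by intervals of total length O(1/m).\<close>

lemma negligible_if_quadratic_index:
  fixes S :: "real set" and s :: "real \<Rightarrow> real"
  assumes C: "C \<ge> 0" and bd: "\<And>a. a \<in> S \<Longrightarrow> \<bar>s a\<bar> \<le> R"
    and q: "\<And>a b. a \<in> S \<Longrightarrow> b \<in> S \<Longrightarrow> \<bar>a - b\<bar> \<le> C * (s a - s b)\<^sup>2"
  shows "negligible S"
unfolding negligible_outer_le
proof (intro allI impI)
  fix e :: real assume e: "e > 0"
  \<comment> \<open>The extra unit over \<open>R\<close> absorbs the rounding of
    \<open>floor\<close>, which costs at most 1 \<le> m.\<close>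
  obtain N :: nat where N: "R + 1 \<le> real N" using real_arch_simple[of "R + 1"] by blast
  obtain m :: nat where m: "2 * C * (2 * real N + 1) / e + 1 \<le> real m"
    using real_arch_simple by blast
  have m0: "real m \<ge> 1" 
  proof -
    have "0 \<le> 2 * C * (2 * real N + 1) / e" using C e by simp
    then show ?thesis using m by linarith
  qed
  define cell where "cell k = {a \<in> S. \<lfloor>s a * real m\<rfloor> = k}" for k :: int
  \<comment> \<open>For an empty cell the centre is arbitrary; its ball is harmless, since only an
    upper bound for the total length is needed.\<close>
  define p where "p k = (SOME a. a \<in> cell k)" for k
  define I where "I = {- int (N * m)..int (N * m)}"
  define T where "T = (\<Union>k\<in>I. cball (p k) (C / (real m)\<^sup>2))"
  have "S \<subseteq> T"
  proof
    fix a assume a: "a \<in> S"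
    define k where "k = \<lfloor>s a * real m\<rfloor>"
    have "a \<in> cell k" using a by (simp add: cell_def k_def)
    then have p: "p k \<in> cell k" unfolding p_def by (rule someI)
    have "\<bar>s a * real m\<bar> \<le> R * real m" using bd[OF a] by (simp add: abs_mult mult_right_mono)
    moreover have "R * real m + real m \<le> real (N * m)" using mult_right_mono[OF N, of "real m"] by (simp add: distrib_right)
    ultimately have "- real (N * m) \<le> real_of_int k" "real_of_int k \<le> real (N * m)"
      using m0 of_int_floor_le[of "s a * real m"] real_of_int_floor_add_one_gt[of "s a * real m"]
      unfolding k_def by linarith+
    then have kI: "k \<in> I" unfolding I_def atLeastAtMost_iff
      by (metis of_int_le_iff of_int_minus of_int_of_nat_eq)
    have "\<lfloor>s a * real m\<rfloor> = \<lfloor>s (p k) * real m\<rfloor>" using p by (simp add: cell_def k_def)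
    then have "\<bar>s (p k) * real m - s a * real m\<bar> \<le> 1"
      using of_int_floor_le[of "s a * real m"] real_of_int_floor_add_one_gt[of "s a * real m"]
        of_int_floor_le[of "s (p k) * real m"] real_of_int_floor_add_one_gt[of "s (p k) * real m"] by linarith
    then have "\<bar>s (p k) - s a\<bar> \<le> 1 / real m" using m0
      by (simp add: abs_mult pos_le_divide_eq flip: left_diff_distrib)
    then have "(s (p k) - s a)\<^sup>2 \<le> (1 / real m)\<^sup>2" by (metis abs_ge_zero power2_abs power_mono)
    then have "\<bar>p k - a\<bar> \<le> C * (1 / real m)\<^sup>2"
      using q[of "p k" a] p a mult_left_mono[OF _ C, of "(s (p k) - s a)\<^sup>2" "(1 / real m)\<^sup>2"]
      by (simp add: cell_def)
    then have "a \<in> cball (p k) (C / (real m)\<^sup>2)" by (simp add: dist_real_def power_divide)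
    then show "a \<in> T" using kI by (auto simp: T_def)
  qed
  moreover have "T \<in> lmeasurable"
    unfolding T_def by (intro fmeasurable.finite_UN) (auto simp: I_def)
  moreover have "measure lebesgue T \<le> e"
  proof -
    have "measure lebesgue T \<le> (\<Sum>k\<in>I. measure lebesgue (cball (p k) (C / (real m)\<^sup>2)))"
      unfolding T_def by (intro measure_UNION_le) (auto simp: I_def)
    also have "\<dots> = (\<Sum>k\<in>I. 2 * (C / (real m)\<^sup>2))"
      using C by (intro sum.cong) (simp_all add: cball_eq_atLeastAtMost)
    also have "\<dots> = (2 * real N * real m + 1) * (2 * (C / (real m)\<^sup>2))"
      by (simp add: I_def)
    also have "\<dots> \<le> ((2 * real N + 1) * real m) * (2 * (C / (real m)\<^sup>2))"
      using m0 C by (intro mult_right_mono) (auto simp: algebra_simps)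
    also have "\<dots> = 2 * C * (2 * real N + 1) / real m"
      using m0 by (simp add: power2_eq_square)
    also have "\<dots> \<le> e"
    proof -
      have "2 * C * (2 * real N + 1) / e \<le> real m" using m by simp
      then show ?thesis using e m0 by (simp add: pos_divide_le_eq mult.commute)
    qed
    finally show ?thesis .
  qed
  ultimately show "\<exists>T. S \<subseteq> T \<and> T \<in> lmeasurable \<and> measure lebesgue T \<le> e" by blast
qed

text \<open>Fubini on pairs (r, x) with r in [1, 2] takes the place of polar coordinates: for some
  such r the set of x with r x in \<open>N\<close> is null, and \<open>N\<close> is a dilate of that
  set. Closedness of \<open>N\<close> makes the set of pairs measurable.\<close>

lemma negligible_if_null_on_rays:
  fixes N :: "'a::euclidean_space set"
  assumes N: "closed N" and ray: "\<And>x. x \<noteq> 0 \<Longrightarrow> negligible {r \<in> {1..2}. r *\<^sub>R x \<in> N}"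
  shows "negligible N"
proof -
  have [measurable]: "N \<in> sets borel" using N by simp

  have "AE x in lborel. AE r in lborel. r \<in> {1..2} \<longrightarrow> r *\<^sub>R x \<notin> N"
  proof -
    have "AE r in lborel. r \<in> {1..2} \<longrightarrow> r *\<^sub>R x \<notin> N" if "x \<noteq> 0" for x
    proof -
      have "{r \<in> {1..2}. r *\<^sub>R x \<in> N} \<in> sets borel" by measurable
      then have "{r \<in> {1..2}. r *\<^sub>R x \<in> N} \<in> null_sets lborel"
        using ray[OF that] by (simp add: negligible_iff_null_sets null_sets_completion_iff)
      from AE_not_in[OF this] show ?thesis by eventually_elim auto
    qed
    moreover have "AE x::'a in lborel. x \<noteq> 0" by (rule AE_lborel_singleton)
    ultimately show ?thesis by (auto elim!: eventually_mono)
  qed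
  then have "AE r in lborel. AE x in lborel. r \<in> {1..2} \<longrightarrow> r *\<^sub>R x \<notin> N"
    by (subst lborel_pair.AE_commute[symmetric]) measurable
  moreover have "\<not> (AE r in lborel. r \<notin> {1..2::real})"
  proof
    assume "AE r in lborel. r \<notin> {1..2::real}"
    then have "emeasure lborel {1..2::real} = 0"
      by (subst (asm) AE_iff_measurable[of "{1..2}"]) auto
    then show False by simp
  qed
  moreover have "AE r in lborel. r \<notin> {1..2::real}"
    if "\<And>r. r \<in> {1..2} \<Longrightarrow> \<not> (AE x in lborel. r *\<^sub>R x \<notin> N)"
    using calculation(1) by eventually_elim (use that in auto)
  ultimately obtain r where r: "r \<in> {1..2}" "AE x in lborel. r *\<^sub>R x \<notin> N"
    by blast
  then have "{x. r *\<^sub>R x \<in> N} \<in> null_sets lborel"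
    using AE_iff_null[of lborel "\<lambda>x. r *\<^sub>R x \<notin> N"] by simp
  then have "negligible {x. r *\<^sub>R x \<in> N}"
    by (simp add: negligible_iff_null_sets null_sets_completionI)
  then have "negligible ((\<lambda>x. r *\<^sub>R x) ` {x. r *\<^sub>R x \<in> N})"
    by (intro negligible_differentiable_image_negligible) auto
  moreover have "N \<subseteq> (\<lambda>x. r *\<^sub>R x) ` {x. r *\<^sub>R x \<in> N}"
  proof
    fix x assume "x \<in> N"
    then show "x \<in> (\<lambda>x. r *\<^sub>R x) ` {x. r *\<^sub>R x \<in> N}"
      using r(1) by (intro image_eqI[of _ _ "x /\<^sub>R r"]) auto
  qed
  ultimately show ?thesis by (rule negligible_subset)
qed

text \<open>The radius of the ball of volume \<open>omega_d\<close> times s, inverse to rho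
  \<mapsto> rho^d / d.\<close>

definition shell_radius :: "'n::finite itself \<Rightarrow> real \<Rightarrow> real" where
  "shell_radius T s = root CARD('n) (real CARD('n) * s)"

context C2_function
begin

text \<open>The points at which the superlevel set through them is supported by the tangent hyperplane.\<close>
definition contact :: "(real^'n) set" where
  "contact = {x. 0 < u x \<and> g x \<noteq> 0 \<and> (\<forall>y. u x < u y \<longrightarrow> 0 \<le> (y - x) \<bullet> g x)}"

text \<open>The gradient points into the superlevel set, so \<open>- nu x\<close> is the outer
  normal; the radius encodes the level, and different positive levels go to different concentric
  spheres.\<close>

definition gauss :: "real^'n \<Rightarrow> real^'n" where
  "gauss x = - (shell_radius TYPE('n) (u x) *\<^sub>R nu x)"

definition Dgauss :: "real^'n \<Rightarrow> real^'n \<Rightarrow> real^'n" where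
  "Dgauss x h = - (shell_radius TYPE('n) (u x) *\<^sub>R Dnu x h
      + ((g x \<bullet> h) / shell_radius TYPE('n) (u x) ^ (CARD('n) - 1)) *\<^sub>R nu x)"

lemma contact_borel: "contact \<in> sets borel"
proof -
  have "closed {x. \<forall>y. u x < u y \<longrightarrow> 0 \<le> (y - x) \<bullet> g x}"
    unfolding not_less[symmetric] imp_conv_disj
    using continuous_u continuous_g
    by (intro closed_Collect_all closed_Collect_disj)
       (auto simp: not_less intro!: closed_Collect_le continuous_intros)
  moreover have "open {x. 0 < u x}" "open {x. g x \<noteq> 0}"
    using continuous_u continuous_g by (auto intro!: open_Collect_less open_Collect_neq continuous_intros)
  moreover have "contact = {x. 0 < u x} \<inter> {x. g x \<noteq> 0} \<inter> {x. \<forall>y. u x < u y \<longrightarrow> 0 \<le> (y - x) \<bullet> g x}"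
    by (auto simp: contact_def)
  ultimately show ?thesis by (auto intro!: sets.Int)
qed

text \<open>If the Hessian were positive in a tangential direction \<open>h\<close>, one could
  follow a parabola tangent to \<open>h\<close> that bends out of the supporting half-space while
  \<open>u\<close> still increases, against the definition of \<open>contact\<close>.\<close>

lemma contact_hessian:
  assumes x: "x \<in> contact" and h: "g x \<bullet> h = 0"
  shows "H x h \<bullet> h \<le> 0"
proof (rule ccontr)
  assume "\<not> H x h \<bullet> h \<le> 0"
  then have pos: "H x h \<bullet> h > 0" by simp
  have g0: "g x \<bullet> g x > 0" using x by (simp add: contact_def)
  \<comment> \<open>With this curvature the second derivative of \<open>u\<close> along the
    parabola, H x h \<bullet> h - 2 c |g x|^2, is still half of the original.\<close>
  define c where "c = H x h \<bullet> h / (4 * (g x \<bullet> g x))"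
  have c: "c > 0" using pos g0 by (simp add: c_def)
  define y where "y s = x + s *\<^sub>R h - (c * s\<^sup>2) *\<^sub>R g x" for s :: real
  define y' where "y' s = h - (2 * c * s) *\<^sub>R g x" for s :: real
  have dy: "(y has_vector_derivative y' s) (at s)" for s
    unfolding y_def y'_def by (auto intro!: derivative_eq_intros)
  define \<phi>' where "\<phi>' s = g (y s) \<bullet> y' s" for s
  have d\<phi>: "((\<lambda>s. u (y s)) has_real_derivative \<phi>' s) (at s)" for s
    unfolding has_field_derivative_def
    by (rule has_derivative_eq_rhs[OF has_derivative_compose[OF dy[of s, unfolded has_vector_derivative_def] du[of "y s"]]])
       (simp add: fun_eq_iff \<phi>'_def)
  have dy': "(y' has_vector_derivative - (2 * c) *\<^sub>R g x) (at 0)"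
    unfolding y'_def by (auto intro!: derivative_eq_intros)
  have dgy: "((\<lambda>s. g (y s)) has_vector_derivative H x h) (at 0)"
  proof -
    have "((\<lambda>s. g (y s)) has_derivative (\<lambda>s. H (y 0) (s *\<^sub>R y' 0))) (at 0)"
      by (rule has_derivative_compose[OF dy[of 0, unfolded has_vector_derivative_def] dg[of "y 0"]])
    then show ?thesis
      using linear_H[of x] by (simp add: has_vector_derivative_def y_def y'_def linear_scale)
  qed
  have "(\<phi>' has_vector_derivative (g (y 0) \<bullet> (- (2 * c) *\<^sub>R g x) + H x h \<bullet> y' 0)) (at 0)"
    unfolding \<phi>'_def by (rule bounded_bilinear.has_vector_derivative[OF bounded_bilinear_inner dgy dy'])
  moreover have "g (y 0) \<bullet> (- (2 * c) *\<^sub>R g x) + H x h \<bullet> y' 0 = H x h \<bullet> h / 2"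
    using g0 by (simp add: y_def y'_def c_def)
  ultimately have d2: "(\<phi>' has_real_derivative (H x h \<bullet> h / 2)) (at 0)"
    unfolding has_real_derivative_iff_has_vector_derivative by (simp only:)
  have \<phi>0: "\<phi>' 0 = 0" using h by (simp add: \<phi>'_def y_def y'_def)
  obtain d where d: "d > 0" "\<And>s. 0 < s \<Longrightarrow> s < d \<Longrightarrow> \<phi>' 0 < \<phi>' s"
    using DERIV_pos_inc_right[OF d2] pos by auto
  obtain \<xi> where \<xi>: "0 < \<xi>" "\<xi> < d / 2" "u (y (d/2)) - u (y 0) = (d / 2 - 0) * \<phi>' \<xi>"
    using MVT2[of 0 "d/2" "\<lambda>s. u (y s)" \<phi>'] d d\<phi> by (auto simp: field_simps)
  have "\<phi>' \<xi> > 0" using d(2)[of \<xi>] \<xi> d(1) \<phi>0 by simp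
  then have "0 < (d / 2 - 0) * \<phi>' \<xi>" using d(1) by simp
  then have "u (y 0) < u (y (d/2))" using \<xi>(3) by linarith
  then have "u x < u (y (d/2))" by (simp add: y_def)
  then have "0 \<le> (y (d/2) - x) \<bullet> g x" using x by (simp add: contact_def)
  also have "(y (d/2) - x) \<bullet> g x = - (c * (d/2)\<^sup>2) * (g x \<bullet> g x)"
    using h by (simp add: y_def inner_diff_left inner_add_left inner_commute[of h])
  also have "\<dots> < 0" using c d(1) g0 by simp
  finally show False by simp
qed

lemma has_derivative_gauss:
  assumes "0 < u x" "g x \<noteq> 0"
  shows "(gauss has_derivative Dgauss x) (at x)"
proof -
  let ?d = "CARD('n)" let ?r = "shell_radius TYPE('n)"
  have "((\<lambda>s. root ?d s) has_real_derivative inverse (real ?d * root ?d (real ?d * u x) ^ (?d - Suc 0))) (at (real ?d * u x))"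
    using assms by (intro DERIV_real_root) auto
  moreover have "((\<lambda>s. real ?d * s) has_real_derivative real ?d) (at (u x))"
    by (auto intro!: derivative_eq_intros)
  ultimately have "(?r has_real_derivative inverse (real ?d * root ?d (real ?d * u x) ^ (?d - Suc 0)) * real ?d) (at (u x))"
    unfolding shell_radius_def[abs_def] by (rule DERIV_chain2)
  then have "(?r has_real_derivative 1 / ?r (u x) ^ (?d - 1)) (at (u x))"
    by (simp add: shell_radius_def field_simps)
  then have "((\<lambda>y. ?r (u y)) has_derivative (\<lambda>h. 1 / ?r (u x) ^ (?d - 1) * (g x \<bullet> h))) (at x)"
    unfolding has_field_derivative_def by (rule has_derivative_compose[OF du[of x]])
  from has_derivative_minus[OF has_derivative_scaleR[OF this has_derivative_nu[OF assms(2)]]]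
  have "(gauss has_derivative (\<lambda>h. - (?r (u x) *\<^sub>R Dnu x h + (1 / ?r (u x) ^ (?d - 1) * (g x \<bullet> h)) *\<^sub>R nu x))) (at x)"
    unfolding gauss_def[abs_def] .
  then show ?thesis unfolding Dgauss_def[abs_def] by simp
qed

text \<open>The powers of the radius rho = \<open>shell_radius\<close> cancel: the normal entry of
  \<open>Dgauss\<close> is - |g| / rho^(d-1), and the remaining trace is - rho times the trace of
  \<open>Dnu\<close>, which has no component along \<open>nu\<close>. By
  \<open>contact_hessian\<close> the tangential part is positive semidefinite.\<close>

lemma measure_subset_gauss_image:
  assumes B: "B \<in> sets borel" "B \<subseteq> gauss ` contact"
  shows "emeasure lborel B \<le> (\<integral>\<^sup>+x. ennreal (Wdens u x / real (CARD('n) - 1) ^ (CARD('n) - 1)) \<partial>lborel)"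
proof -
  let ?d = "CARD('n)" let ?r = "\<lambda>x. shell_radius TYPE('n) (u x)"
  have [measurable]: "Wdens u \<in> borel_measurable borel" by (rule Wdens_measurable)
  have nn: "nu x \<bullet> nu x = 1" "norm (nu x) = 1" "norm (g x) > 0" "?r x > 0" if "x \<in> contact" for x
    using norm_nu[of x] that by (auto simp: contact_def norm_eq_1 shell_radius_def)
  have perp: "g x \<bullet> h = 0" if "x \<in> contact" "nu x \<bullet> h = 0" for x h
    using that(2) by (subst g_eq_nu) simp
  have Dg: "Dgauss x h = - ((?r x / norm (g x)) *\<^sub>R (H x h - (nu x \<bullet> H x h) *\<^sub>R nu x))" if "x \<in> contact" "nu x \<bullet> h = 0" for x h
    using perp[OF that] by (simp add: Dgauss_def Dnu_def divide_inverse)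
  have "emeasure lborel B \<le> (\<integral>\<^sup>+x. ennreal (Wdens u x / real (?d - 1) ^ (?d - 1)) * indicator contact x \<partial>lborel)"
  proof (rule emeasure_subset_image_le[OF contact_borel _ _ _ _ _ _ _ B, where n = nu and f' = Dgauss and J = "\<lambda>x. Wdens u x / real (?d - 1) ^ (?d - 1)"])
    fix x assume x: "x \<in> contact"
    then show "(gauss has_derivative Dgauss x) (at x within contact)"
      using has_derivative_at_withinI[OF has_derivative_gauss[of x]] by (simp add: contact_def)
    show "norm (nu x) = 1" using nn[OF x] by simp
    show "nu x \<bullet> Dgauss x h = 0" if "nu x \<bullet> h = 0" for h
      using Dg[OF x that] nn[OF x] by (simp add: inner_diff_right)
    show "Dgauss x h \<bullet> k = h \<bullet> Dgauss x k" if "nu x \<bullet> h = 0" "nu x \<bullet> k = 0" for h k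
      using Dg[OF x that(1)] Dg[OF x that(2)] that H_symmetric[of x h k]
      by (simp add: inner_diff_left inner_diff_right inner_commute)
    show "0 \<le> Dgauss x h \<bullet> h" if "nu x \<bullet> h = 0" for h
      using Dg[OF x that] contact_hessian[OF x perp[OF x that]] that nn[OF x]
      by (simp add: inner_diff_left mult_nonneg_nonpos divide_nonpos_pos)
    define \<rho> where "\<rho> = ?r x"
    define t where "t = trace (matrix (Dnu x))"
    have \<rho>: "\<rho> > 0" using nn[OF x] by (simp add: \<rho>_def)
    have nDn: "nu x \<bullet> Dnu x h = 0" for h
      using nn[OF x] by (simp add: Dnu_def inner_diff_right)
    have gn: "g x \<bullet> nu x = norm (g x)"
      using nn(3)[OF x] by (simp add: nu_def power2_norm_eq_inner[symmetric] power2_eq_square)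
    have nG: "nu x \<bullet> Dgauss x (nu x) = - (norm (g x) / \<rho> ^ (?d - 1))"
      using nn[OF x] nDn[of "nu x"] gn by (simp add: Dgauss_def inner_add_right inner_diff_right \<rho>_def)
    have "trace (matrix (Dgauss x)) = - (\<rho> * t + (\<Sum>i\<in>UNIV. g x $ i * nu x $ i) / \<rho> ^ (?d - 1))"
      by (simp add: trace_def matrix_def Dgauss_def t_def \<rho>_def sum_negf sum.distrib sum_subtractf sum_distrib_left sum_divide_distrib inner_axis algebra_simps)
    also have "(\<Sum>i\<in>UNIV. g x $ i * nu x $ i) = g x \<bullet> nu x" by (simp add: inner_vec_def)
    also note gn
    finally have tG: "trace (matrix (Dgauss x)) - nu x \<bullet> Dgauss x (nu x) = - (\<rho> * t)"
      by (simp add: nG)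
    have "\<bar>nu x \<bullet> Dgauss x (nu x)\<bar> * ((trace (matrix (Dgauss x)) - nu x \<bullet> Dgauss x (nu x)) / real (?d - 1)) ^ (?d - 1)
      = norm (g x) / \<rho> ^ (?d - 1) * (\<rho> * - t / real (?d - 1)) ^ (?d - 1)"
      using \<rho> by (subst tG, subst nG) simp
    also have "\<dots> = norm (g x) * (- t) ^ (?d - 1) / real (?d - 1) ^ (?d - 1)"
      using \<rho> by (simp only: power_divide power_mult_distrib) simp
    also have "\<dots> \<le> norm (g x) * \<bar>t\<bar> ^ (?d - 1) / real (?d - 1) ^ (?d - 1)"
      by (intro divide_right_mono mult_left_mono) (auto simp: power_abs[symmetric] intro: order_trans[OF abs_ge_self])
    also have "\<dots> = Wdens u x / real (?d - 1) ^ (?d - 1)"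
      using x by (simp add: Wdens_eq contact_def t_def)
    finally show "\<bar>nu x \<bullet> Dgauss x (nu x)\<bar> * ((trace (matrix (Dgauss x)) - nu x \<bullet> Dgauss x (nu x)) / real (?d - 1)) ^ (?d - 1) \<le> Wdens u x / real (?d - 1) ^ (?d - 1)" .
  qed measurable
  also have "\<dots> \<le> (\<integral>\<^sup>+x. ennreal (Wdens u x / real (?d - 1) ^ (?d - 1)) \<partial>lborel)"
    by (intro nn_integral_mono) (auto simp: indicator_def)
  finally show ?thesis .
qed

end

lemma alpha_d_pos: "0 < alpha_d TYPE('n::finite)"
  by (simp add: alpha_d_def content_ball_gt_0_iff)

lemma emeasure_ball_alpha_d:
  assumes "0 \<le> r"
  shows "emeasure lborel (ball (c::real^'n::finite) r) = ennreal (alpha_d TYPE('n) * r ^ CARD('n))"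
proof -
  have "alpha_d TYPE('n) = unit_ball_vol (real CARD('n))"
    by (simp add: alpha_d_def content_ball)
  then show ?thesis using assms by (simp add: emeasure_ball)
qed

section \<open>Critical support points and the covering of the ball\<close>

context C2_function
begin

text \<open>Second-order Taylor bound with one constant for all critical points in a ball; this
  uniformity is what the covering of rays needs. The Hessian is bounded one basis direction at a
  time, because its continuity is given for each fixed direction.\<close>

lemma quadratic_near_critical:
  obtains K where "0 \<le> K"
    "\<And>x y. norm x \<le> R \<Longrightarrow> norm y \<le> R \<Longrightarrow> g x = 0 \<Longrightarrow> \<bar>u y - u x\<bar> \<le> K * (norm (y - x))\<^sup>2"
proof -
  have "\<exists>L. \<forall>x\<in>cball 0 R. norm (H x v) \<le> L" for v
  proof -
    have "bounded ((\<lambda>x. H x v) ` cball 0 R)"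
      by (intro compact_imp_bounded compact_continuous_image continuous_on_subset[OF cH]) auto
    then show ?thesis by (auto simp: bounded_iff)
  qed
  then obtain L where L: "\<And>v x. x \<in> cball 0 R \<Longrightarrow> norm (H x v) \<le> L v" by metis
  define K where "K = (\<Sum>i\<in>UNIV. \<bar>L (axis i 1)\<bar>)"
  have K0: "K \<ge> 0" by (simp add: K_def sum_nonneg)
  have nH: "norm (H x h) \<le> K * norm h" if "x \<in> cball 0 R" for x h
  proof -
    have "H x h = H x (\<Sum>i\<in>UNIV. h $ i *\<^sub>R axis i 1)"
      using basis_expansion[of h] by (simp add: scalar_mult_eq_scaleR)
    also have "\<dots> = (\<Sum>i\<in>UNIV. h $ i *\<^sub>R H x (axis i 1))"
      using linear_H[of x] by (simp add: linear_sum linear_scale)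
    finally have "norm (H x h) \<le> (\<Sum>i\<in>UNIV. norm (h $ i *\<^sub>R H x (axis i 1)))"
      by (simp only: norm_sum)
    also have "\<dots> \<le> (\<Sum>i\<in>UNIV. \<bar>L (axis i 1)\<bar> * norm h)"
    proof (rule sum_mono)
      fix i
      have "\<bar>h $ i\<bar> * norm (H x (axis i 1)) \<le> norm h * \<bar>L (axis i 1)\<bar>"
        using component_le_norm_cart[of h i] L[OF that, of "axis i 1"] by (intro mult_mono) auto
      then show "norm (h $ i *\<^sub>R H x (axis i 1)) \<le> \<bar>L (axis i 1)\<bar> * norm h"
        by (simp add: mult.commute)
    qed
    finally show ?thesis by (simp add: K_def sum_distrib_right)
  qed
  have lip: "norm (g y - g x) \<le> K * norm (y - x)" if "x \<in> cball 0 R" "y \<in> cball 0 R" for x y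
  proof (rule differentiable_bound[OF convex_cball _ _ that(2,1)])
    show "(g has_derivative H x) (at x within cball 0 R)" for x by (rule has_derivative_at_withinI[OF dg])
    show "onorm (H x) \<le> K" if "x \<in> cball 0 R" for x
      using nH[OF that] K0 by (intro onorm_bound) auto
  qed
  have "\<bar>u y - u x\<bar> \<le> K * (norm (y - x))\<^sup>2" if x: "norm x \<le> R" "g x = 0" and y: "norm y \<le> R" for x y
  proof -
    have "norm (u y - u x) \<le> (K * norm (y - x)) * norm (y - x)"
    proof (rule differentiable_bound[OF convex_closed_segment])
      show "(u has_derivative (\<lambda>h. g z \<bullet> h)) (at z within closed_segment x y)" for z
        by (rule has_derivative_at_withinI[OF du])
      fix z assume z: "z \<in> closed_segment x y"
      have "closed_segment x y \<subseteq> cball 0 R"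
        using x y by (intro closed_segment_subset convex_cball) auto
      then have "norm (g z) \<le> K * norm (z - x)" using lip[of x z] x z by auto
      also have "\<dots> \<le> K * norm (y - x)"
        using segment_bound(1)[OF z] K0 by (intro mult_left_mono)
      finally have "norm (g z) \<le> K * norm (y - x)" .
      moreover have "onorm (\<lambda>h. g z \<bullet> h) \<le> norm (g z)"
        by (intro onorm_bound) (auto simp: Cauchy_Schwarz_ineq2)
      ultimately show "onorm (\<lambda>h. g z \<bullet> h) \<le> K * norm (y - x)" by linarith
    qed auto
    then show ?thesis by (simp add: power2_eq_square mult.assoc)
  qed
  with K0 show ?thesis using that by blast
qed

text \<open>The exceptional targets: \<theta> encodes the level by its norm, and a support point of
  that level in direction \<theta> is critical. The strict inequality in front of \<open>u y\<close>
  makes the condition closed in the pair (x, \<theta>).\<close>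

definition critical_contact :: "(real^'n) set \<Rightarrow> (real^'n) set" where
  "critical_contact K = {\<theta>. \<exists>x\<in>K. g x = 0 \<and> norm \<theta> ^ CARD('n) / real CARD('n) \<le> u x \<and>
     (\<forall>y. norm \<theta> ^ CARD('n) / real CARD('n) < u y \<longrightarrow> y \<bullet> \<theta> \<le> x \<bullet> \<theta>)}"

text \<open>Projection of a closed set of pairs along a compact factor. Closedness is what
  \<open>negligible_if_null_on_rays\<close> asks for.\<close>

lemma closed_critical_contact:
  assumes "compact K"
  shows "closed (critical_contact K)"
proof -
  let ?t = "\<lambda>z::(real^'n) \<times> (real^'n). norm (snd z) ^ CARD('n) / real CARD('n)"
  have cu: "continuous_on UNIV (\<lambda>z::(real^'n) \<times> (real^'n). u (fst z))"
    by (rule continuous_on_compose2[OF continuous_u]) (auto intro: continuous_intros)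
  have cg: "continuous_on UNIV (\<lambda>z::(real^'n) \<times> (real^'n). g (fst z))"
    by (rule continuous_on_compose2[OF continuous_g]) (auto intro: continuous_intros)
  have ct: "continuous_on UNIV ?t" by (intro continuous_intros) auto
  have "closed {z::(real^'n) \<times> (real^'n). g (fst z) = 0}" by (rule closed_Collect_eq[OF cg continuous_on_const])
  moreover have "closed {z. ?t z \<le> u (fst z)}" by (rule closed_Collect_le[OF ct cu])
  moreover have "closed {z::(real^'n) \<times> (real^'n). \<forall>y. u y \<le> ?t z \<or> y \<bullet> snd z \<le> fst z \<bullet> snd z}"
  proof (intro closed_Collect_all closed_Collect_disj)
    show "closed {z. u y \<le> ?t z}" for y by (rule closed_Collect_le[OF continuous_on_const ct])
    show "closed {z::(real^'n) \<times> (real^'n). y \<bullet> snd z \<le> fst z \<bullet> snd z}" for y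
      by (rule closed_Collect_le) (intro continuous_intros)+
  qed
  ultimately have "closed ({z. g (fst z) = 0} \<inter> {z. ?t z \<le> u (fst z)} \<inter>
     {z. \<forall>y. u y \<le> ?t z \<or> y \<bullet> snd z \<le> fst z \<bullet> snd z})" (is "closed ?T")
    by (intro closed_Int)
  from closed_compact_projection[OF assms this]
  have "closed {\<theta>. \<exists>x. x \<in> K \<and> (x, \<theta>) \<in> ?T}" .
  also have "{\<theta>. \<exists>x. x \<in> K \<and> (x, \<theta>) \<in> ?T} = critical_contact K"
    unfolding critical_contact_def by (rule Collect_cong) (simp add: not_less imp_conv_disj Bex_def)
  finally show ?thesis .
qed

text \<open>Index the parameter r by the support value of its critical support point
  \<open>X r\<close>. For a < b, shifting \<open>X b\<close> along \<theta> to the supporting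
  hyperplane of level \<open>t a\<close> reaches a point where \<open>u\<close> is at most
  \<open>t a\<close>, while \<open>u\<close> is at least \<open>t b\<close> at \<open>X b\<close>.
  Since \<open>X b\<close> is critical, this drop is quadratic in the shift, that is, in the
  difference of the support values.\<close>

lemma critical_contact_null_on_rays:
  assumes K: "compact K" and \<theta>: "\<theta> \<noteq> 0"
  shows "negligible {r \<in> {1..2}. r *\<^sub>R \<theta> \<in> critical_contact K}" (is "negligible ?S")
proof -
  let ?d = "CARD('n)"
  have d1: "?d \<ge> 1" by (simp add: Suc_leI)
  obtain R where R: "R > 0" "\<And>x. x \<in> K \<Longrightarrow> norm x \<le> R"
    using compact_imp_bounded[OF K] by (auto simp: bounded_pos)
  \<comment> \<open>The shifted point lies within 3 R of the origin: R for \<open>X b\<close>, and 2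
    R for a shift bounded by the distance of two points of \<open>K\<close>.\<close>
  obtain A where A: "0 \<le> A" "\<And>x y. norm x \<le> 3 * R \<Longrightarrow> norm y \<le> 3 * R \<Longrightarrow> g x = 0 \<Longrightarrow> \<bar>u y - u x\<bar> \<le> A * (norm (y - x))\<^sup>2"
    using quadratic_near_critical[of "3 * R"] by blast
  define t where "t r = norm (r *\<^sub>R \<theta>) ^ ?d / real ?d" for r
  define c where "c = norm \<theta> ^ ?d / real ?d"
  have c: "c > 0" using \<theta> by (simp add: c_def)
  have tc: "t r = c * r ^ ?d" if "r \<ge> 0" for r
    using that by (simp add: t_def c_def power_mult_distrib)
  have "\<forall>r\<in>?S. \<exists>x. x \<in> K \<and> g x = 0 \<and> t r \<le> u x \<and> (\<forall>y. t r < u y \<longrightarrow> y \<bullet> \<theta> \<le> x \<bullet> \<theta>)"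
    by (auto simp: critical_contact_def t_def)
  from bchoice[OF this] obtain X where "\<forall>r\<in>?S. X r \<in> K \<and> g (X r) = 0 \<and> t r \<le> u (X r) \<and>
      (\<forall>y. t r < u y \<longrightarrow> y \<bullet> \<theta> \<le> X r \<bullet> \<theta>)" ..
  then have X: "\<And>r. r \<in> ?S \<Longrightarrow> X r \<in> K" "\<And>r. r \<in> ?S \<Longrightarrow> g (X r) = 0" "\<And>r. r \<in> ?S \<Longrightarrow> t r \<le> u (X r)"
     "\<And>r y. r \<in> ?S \<Longrightarrow> t r < u y \<Longrightarrow> y \<bullet> \<theta> \<le> X r \<bullet> \<theta>"
    by blast+
  define C where "C = A / (norm \<theta>)\<^sup>2 / c"
  have C: "C \<ge> 0" using A c by (simp add: C_def)
  have ordered: "b - a \<le> C * (X a \<bullet> \<theta> - X b \<bullet> \<theta>)\<^sup>2" if a: "a \<in> ?S" and b: "b \<in> ?S" and ab: "a < b" for a b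
  proof -
    have "t a < t b" using a ab c d1 by (simp add: tc power_strict_mono)
    then have le: "X b \<bullet> \<theta> \<le> X a \<bullet> \<theta>" using X(4)[OF a] X(3)[OF b] by fastforce
    define q where "q = (X a \<bullet> \<theta> - X b \<bullet> \<theta>) / (norm \<theta>)\<^sup>2"
    have q: "q \<ge> 0" using le by (simp add: q_def)
    define y where "y e = X b + (q + e) *\<^sub>R \<theta>" for e :: real
    \<comment> \<open>For e > 0 the point lies strictly beyond the supporting hyperplane of level
      \<open>t a\<close>; the bound on the hyperplane itself follows by continuity.\<close>
    have ye: "u (y e) \<le> t a" if "e > 0" for e
    proof (rule ccontr)
      assume "\<not> u (y e) \<le> t a"
      then have "y e \<bullet> \<theta> \<le> X a \<bullet> \<theta>" using X(4)[OF a] by simp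
      moreover have "y e \<bullet> \<theta> = X a \<bullet> \<theta> + e * (norm \<theta>)\<^sup>2"
        using \<theta> by (simp add: y_def q_def inner_add_left distrib_right power2_norm_eq_inner)
      ultimately show False using that \<theta> by (simp add: mult_le_0_iff)
    qed
    have "continuous_on UNIV (\<lambda>e. u (y e))"
      unfolding y_def by (rule continuous_on_compose2[OF continuous_u]) (auto intro!: continuous_intros)
    then have "((\<lambda>e. u (y e)) \<longlongrightarrow> u (y 0)) (at_right 0)"
      by (simp add: continuous_on_def filterlim_at_split at_within_def[of _ UNIV, symmetric])
    then have y0: "u (y 0) \<le> t a"
      by (rule tendsto_upperbound) (auto intro: eventually_at_right_less[THEN eventually_mono] ye)
    have "\<bar>X a \<bullet> \<theta> - X b \<bullet> \<theta>\<bar> \<le> norm (X a - X b) * norm \<theta>"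
      unfolding inner_diff_left[symmetric] by (rule Cauchy_Schwarz_ineq2)
    also have "\<dots> \<le> (2 * R) * norm \<theta>"
      using norm_triangle_ineq4[of "X a" "X b"] R(2)[OF X(1)[OF a]] R(2)[OF X(1)[OF b]] by (intro mult_right_mono) auto
    finally have "q * norm \<theta> \<le> 2 * R"
      using \<theta> by (simp add: q_def power2_eq_square divide_le_eq)
    then have "norm (y 0) \<le> 3 * R"
      using norm_triangle_ineq[of "X b" "q *\<^sub>R \<theta>"] R(2)[OF X(1)[OF b]] q by (simp add: y_def)
    then have "\<bar>u (y 0) - u (X b)\<bar> \<le> A * (norm (y 0 - X b))\<^sup>2"
      using X(1,2)[OF b] R by (intro A(2)) (auto intro: order_trans[of _ R])
    also have "norm (y 0 - X b) = q * norm \<theta>" using q by (simp add: y_def)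
    also have "A * (q * norm \<theta>)\<^sup>2 = c * (C * (X a \<bullet> \<theta> - X b \<bullet> \<theta>)\<^sup>2)"
      using \<theta> c by (simp add: q_def C_def power_mult_distrib power_divide field_simps power2_eq_square)
    finally have "t b - t a \<le> c * (C * (X a \<bullet> \<theta> - X b \<bullet> \<theta>)\<^sup>2)"
      using y0 X(3)[OF b] by linarith
    moreover have "t b - t a \<ge> c * (b - a)"
    proof -
      \<comment> \<open>The restriction of r to [1, 2] enters here: powers are expanding on [1,
        \<infinity>), so b^d - a^d \<ge> b - a.\<close>
      have "a ^ (?d - 1) \<le> b ^ (?d - 1)" using a ab by (intro power_mono) auto
      moreover have "1 \<le> a ^ (?d - 1)" using a by (intro one_le_power) auto
      ultimately have "(b - a) * 1 \<le> (b - a) * a ^ (?d - 1)" "b * a ^ (?d - 1) \<le> b * b ^ (?d - 1)"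
        using a ab by (intro mult_left_mono; simp)+
      then have "b - a \<le> b * b ^ (?d - 1) - a * a ^ (?d - 1)"
        unfolding left_diff_distrib by linarith
      then have "b - a \<le> b ^ ?d - a ^ ?d"
        using d1 by (simp add: power_eq_if)
      then have "c * (b - a) \<le> c * (b ^ ?d - a ^ ?d)" using c by (intro mult_left_mono) auto
      then show ?thesis using a b by (simp add: tc right_diff_distrib)
    qed
    ultimately have "c * (b - a) \<le> c * (C * (X a \<bullet> \<theta> - X b \<bullet> \<theta>)\<^sup>2)" by linarith
    then show ?thesis using c by simp
  qed
  show ?thesis
  proof (rule negligible_if_quadratic_index[OF C])
    show "\<bar>X a \<bullet> \<theta>\<bar> \<le> R * norm \<theta>" if "a \<in> ?S" for a
      using Cauchy_Schwarz_ineq2[of "X a" \<theta>] mult_right_mono[OF R(2)[OF X(1)[OF that]] norm_ge_zero[of \<theta>]] by linarith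
    show "\<bar>a - b\<bar> \<le> C * (X a \<bullet> \<theta> - X b \<bullet> \<theta>)\<^sup>2" if "a \<in> ?S" "b \<in> ?S" for a b
      using ordered[OF that] ordered[OF that(2,1)] C
      by (cases a b rule: linorder_cases) (auto simp: power2_commute)
  qed
qed

text \<open>Maximise the functional of direction \<open>\<theta>\<close> over the superlevel set at the level \<open>|\<theta>|\<^bsup>d\<^esup> / d\<close>.\<close>
lemma ball_subset_gauss_image:
  assumes supp: "compact (closure {x. u x \<noteq> 0})" and x0: "0 < u x0"
  shows "ball 0 (shell_radius TYPE('n) (u x0)) \<subseteq>
    gauss ` contact \<union> critical_contact (closure {x. u x \<noteq> 0}) \<union> {0}"
proof
  let ?d = "CARD('n)" let ?K = "closure {x. u x \<noteq> 0}"
  fix \<theta> :: "real^'n" assume \<theta>b: "\<theta> \<in> ball 0 (shell_radius TYPE('n) (u x0))"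
  show "\<theta> \<in> gauss ` contact \<union> critical_contact ?K \<union> {0}"
  proof (cases "\<theta> = 0")
    case False
    define t where "t = norm \<theta> ^ ?d / real ?d"
    have t0: "t > 0" using False by (simp add: t_def)
    have st: "shell_radius TYPE('n) t = norm \<theta>" by (simp add: t_def shell_radius_def real_root_power_cancel)
    have "norm \<theta> ^ ?d < shell_radius TYPE('n) (u x0) ^ ?d"
      using \<theta>b by (intro power_strict_mono) auto
    also have "\<dots> = real ?d * u x0" using x0 by (simp add: shell_radius_def)
    finally have tx0: "t < u x0" by (simp add: t_def divide_less_eq mult.commute)
    let ?T = "{x. t \<le> u x}"
    have "closed ?T" using continuous_u by (intro closed_Collect_le continuous_on_const)
    moreover have TK: "?T \<subseteq> ?K" using t0 closure_subset[of "{x. u x \<noteq> 0}"] by auto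
    ultimately have "compact ?T" using supp by (metis compact_Int_closed inf.absorb2)
    moreover have "?T \<noteq> {}" using tx0 by (auto intro: less_imp_le)
    moreover have "continuous_on ?T (\<lambda>x. x \<bullet> \<theta>)" by (intro continuous_intros)
    ultimately obtain x where x: "t \<le> u x" "\<And>y. t \<le> u y \<Longrightarrow> y \<bullet> \<theta> \<le> x \<bullet> \<theta>"
      using continuous_attains_sup[of ?T "\<lambda>x. x \<bullet> \<theta>"] by auto
    show ?thesis
    proof (cases "g x = 0")
      case True
      then have "\<theta> \<in> critical_contact ?K"
        using x TK by (auto simp: critical_contact_def t_def[symmetric] intro!: bexI[of _ x])
      then show ?thesis by blast
    next
      case gx: False
      have dir: "((\<lambda>s. u (x + s *\<^sub>R v)) has_real_derivative g x \<bullet> v) (at 0)" for v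
      proof -
        have "((\<lambda>s. x + s *\<^sub>R v) has_derivative (\<lambda>s. s *\<^sub>R v)) (at 0)"
          by (auto intro!: derivative_eq_intros)
        from has_derivative_compose[OF this, of u "\<lambda>h. g x \<bullet> h"] du[of x]
        show ?thesis by (simp add: has_field_derivative_def mult.commute[of "g x \<bullet> v"] fun_eq_iff has_derivative_eq_rhs)
      qed
      have dir_le: "v \<bullet> \<theta> \<le> 0" if v: "g x \<bullet> v > 0" for v
      proof -
        obtain e where e: "e > 0" "\<And>s. 0 < s \<Longrightarrow> s < e \<Longrightarrow> u x < u (x + s *\<^sub>R v)"
          using DERIV_pos_inc_right[OF dir v] by auto
        have "(x + (e/2) *\<^sub>R v) \<bullet> \<theta> \<le> x \<bullet> \<theta>" using e(2)[of "e/2"] e(1) x by fastforce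
        then show ?thesis using e(1) by (simp add: inner_add_left mult_le_0_iff)
      qed
      \<comment> \<open>Otherwise \<open>x\<close> could be moved along \<theta> inside the
        superlevel set, raising the functional.\<close>
      have ux: "u x = t"
      proof (rule ccontr)
        assume "u x \<noteq> t"
        then have "t < u x" using x by simp
        moreover have "isCont (\<lambda>s. u (x + s *\<^sub>R \<theta>)) 0" using dir by (rule DERIV_isCont)
        ultimately have "\<forall>\<^sub>F s in at 0. t < u (x + s *\<^sub>R \<theta>)"
          unfolding isCont_def by (intro order_tendstoD(1)) auto
        then obtain e where e: "e > 0" "\<And>s. s \<noteq> 0 \<Longrightarrow> \<bar>s\<bar> < e \<Longrightarrow> t < u (x + s *\<^sub>R \<theta>)"
          by (auto simp: eventually_at dist_real_def)
        have "(x + (e/2) *\<^sub>R \<theta>) \<bullet> \<theta> \<le> x \<bullet> \<theta>" using e(2)[of "e/2"] e(1) x by fastforce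
        then have "\<theta> \<bullet> \<theta> \<le> 0" using e(1) by (simp add: inner_add_left mult_le_0_iff)
        then show False using False by (metis inner_gt_zero_iff not_less)
      qed
      \<comment> \<open>Lagrange multipliers by testing \<open>dir_le\<close>: the direction nu +
        \<theta> / |\<theta>| has nonnegative pairing with the gradient by Cauchy-Schwarz, and a
        small multiple of nu makes it positive. This yields nu \<bullet> \<theta> \<le> -
        |\<theta>|, the equality case of Cauchy-Schwarz.\<close>
      have "norm \<theta> *\<^sub>R nu x + \<theta> = 0"
      proof -
        let ?m = "norm \<theta>"
        have lim: "(nu x + e *\<^sub>R nu x + \<theta> /\<^sub>R ?m) \<bullet> \<theta> \<le> 0" if e: "e > 0" for e
        proof (rule dir_le)
          have "\<bar>g x \<bullet> (\<theta> /\<^sub>R ?m)\<bar> \<le> norm (g x) * norm (\<theta> /\<^sub>R ?m)" by (rule Cauchy_Schwarz_ineq2)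
          then have "\<bar>g x \<bullet> (\<theta> /\<^sub>R ?m)\<bar> \<le> norm (g x)" using False by simp
          moreover have gn: "g x \<bullet> nu x = norm (g x)"
            using gx by (simp add: nu_def power2_norm_eq_inner[symmetric] power2_eq_square)
          moreover have "e * (g x \<bullet> nu x) > 0" using e gx gn by simp
          ultimately show "g x \<bullet> (nu x + e *\<^sub>R nu x + \<theta> /\<^sub>R ?m) > 0"
            unfolding inner_add_right inner_scaleR_right[of _ e] by linarith
        qed
        have le0: "(nu x + \<theta> /\<^sub>R ?m) \<bullet> \<theta> \<le> 0"
        proof (rule field_le_epsilon)
          fix e :: real assume e: "e > 0"
          have "\<bar>nu x \<bullet> \<theta>\<bar> \<le> ?m" using Cauchy_Schwarz_ineq2[of "nu x" \<theta>] norm_nu[OF gx] by simp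
          then have "e / ?m * \<bar>nu x \<bullet> \<theta>\<bar> \<le> e / ?m * ?m" using e by (intro mult_left_mono) auto
          then have *: "e / ?m * \<bar>nu x \<bullet> \<theta>\<bar> \<le> e" using False by simp
          have "(nu x + \<theta> /\<^sub>R ?m) \<bullet> \<theta> + e / ?m * (nu x \<bullet> \<theta>) \<le> 0"
            using lim[of "e / ?m"] e False by (simp add: inner_add_left algebra_simps)
          then have "(nu x + \<theta> /\<^sub>R ?m) \<bullet> \<theta> \<le> - (e / ?m * (nu x \<bullet> \<theta>))"
            by (simp only: add_le_imp_le_diff diff_0[symmetric] le_diff_eq)
          also have "\<dots> \<le> e / ?m * \<bar>nu x \<bullet> \<theta>\<bar>"
            using e mult_left_mono[of "- (nu x \<bullet> \<theta>)" "\<bar>nu x \<bullet> \<theta>\<bar>" "e / ?m"] by simp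
          also note *
          finally show "(nu x + \<theta> /\<^sub>R ?m) \<bullet> \<theta> \<le> 0 + e" by simp
        qed
        have "(\<theta> /\<^sub>R ?m) \<bullet> \<theta> = ?m" using False by (simp add: power2_norm_eq_inner[symmetric] power2_eq_square)
        then have le: "nu x \<bullet> \<theta> + ?m \<le> 0" using le0 by (simp add: inner_add_left)
        have "(norm (?m *\<^sub>R nu x + \<theta>))\<^sup>2 = ?m\<^sup>2 * (nu x \<bullet> nu x) + 2 * ?m * (nu x \<bullet> \<theta>) + ?m\<^sup>2"
          using power2_norm_eq_inner[of \<theta>]
          by (subst power2_norm_eq_inner) (simp add: inner_add inner_commute power2_eq_square algebra_simps)
        also have "\<dots> = 2 * ?m * (nu x \<bullet> \<theta> + ?m)"
          using norm_nu[OF gx] by (simp add: norm_eq_1 power2_eq_square algebra_simps)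
        also have "\<dots> \<le> 0" using le by (simp add: mult_nonneg_nonpos)
        finally show ?thesis by simp
      qed
      then have th: "\<theta> = - (norm \<theta> *\<^sub>R nu x)" by (simp add: eq_neg_iff_add_eq_0 add.commute)
      have "gauss x = \<theta>" unfolding gauss_def ux st using th by simp
      moreover have "x \<in> contact"
      proof -
        have "0 \<le> (y - x) \<bullet> g x" if "u x < u y" for y
        proof -
          have "(y - x) \<bullet> \<theta> \<le> 0" using x(2)[of y] that ux by (simp add: inner_diff_left)
          then have "0 \<le> norm \<theta> * ((y - x) \<bullet> nu x)" by (subst (asm) th) simp
          then have "0 \<le> (y - x) \<bullet> nu x" using False by (simp add: zero_le_mult_iff)
          then show ?thesis by (subst g_eq_nu) simp
        qed
        then show ?thesis using ux t0 gx by (simp add: contact_def)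
      qed
      ultimately show ?thesis by blast
    qed
  qed simp
qed

text \<open>The ball minus the exceptional set is Borel, keeps its full measure, and lies in the
  image of the contact points. The origin is removed as well, since it singles out no
  direction.\<close>

lemma omega_le_integral_Wdens:
  assumes supp: "compact (closure {x. u x \<noteq> 0})" and x0: "0 < u x0"
  shows "ennreal (omega_d TYPE('n) * u x0) \<le> (\<integral>\<^sup>+x. ennreal (Wdens u x / real (CARD('n) - 1) ^ (CARD('n) - 1)) \<partial>lborel)"
proof -
  let ?K = "closure {x. u x \<noteq> 0}" let ?B = "ball (0::real^'n) (shell_radius TYPE('n) (u x0))"
  let ?N = "critical_contact ?K \<union> {0}"
  have cN: "closed (critical_contact ?K)" by (rule closed_critical_contact[OF supp])
  have "negligible (critical_contact ?K)"
    by (rule negligible_if_null_on_rays[OF cN critical_contact_null_on_rays[OF supp]])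
  then have "critical_contact ?K \<in> null_sets lborel"
    using cN by (simp add: negligible_iff_null_sets null_sets_completion_iff)
  then have "?N \<in> null_sets lborel" by (rule null_sets.Un) (simp add: null_sets_def)
  then have "emeasure lborel (?B - ?N) = emeasure lborel ?B"
    by (intro emeasure_Diff_null_set) auto
  moreover have "emeasure lborel (?B - ?N) \<le> (\<integral>\<^sup>+x. ennreal (Wdens u x / real (CARD('n) - 1) ^ (CARD('n) - 1)) \<partial>lborel)"
    using ball_subset_gauss_image[OF assms] cN by (intro measure_subset_gauss_image) auto
  moreover have "emeasure lborel ?B = ennreal (omega_d TYPE('n) * u x0)"
    using x0 by (simp add: emeasure_ball_alpha_d shell_radius_def omega_d_def ac_simps)
  ultimately show ?thesis by simp
qed

end

section \<open>The energy dominates the maximum\<close>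

lemma C2c_imp_C2_function:
  assumes "C2c \<Omega> u"
  obtains g H where "C2_function u g H"
  using assms unfolding C2c_def C2_function_def by blast

lemma omega_le_W:
  fixes u :: "real^'n::finite \<Rightarrow> real"
  assumes "0 < u x0"
  shows "ennreal (omega_d TYPE('n) * u x0) \<le> W \<Omega> u"
proof (cases "C2c \<Omega> u")
  case True
  then obtain g H where "C2_function u g H" by (rule C2c_imp_C2_function)
  then interpret C2_function u g H .
  have [measurable]: "Wdens u \<in> borel_measurable borel" by (rule Wdens_measurable)
  have "compact (closure {x. u x \<noteq> 0})" using True by (simp add: C2c_def)
  note omega_le_integral_Wdens[OF this assms]
  also have "(\<integral>\<^sup>+x. ennreal (Wdens u x / real (CARD('n) - 1) ^ (CARD('n) - 1)) \<partial>lborel)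
    = (\<integral>\<^sup>+x. ennreal (1 / real (CARD('n) - 1) ^ (CARD('n) - 1)) * ennreal (Wdens u x) \<partial>lborel)"
    by (intro nn_integral_cong, subst ennreal_mult[symmetric]) (auto simp: Wdens_nonneg)
  also have "\<dots> = W \<Omega> u"
    using True by (simp add: W_def nn_integral_cmult)
  finally show ?thesis .
qed (simp add: W_def)

section \<open>Radial functions\<close>

lemma omega_d_pos: "0 < omega_d TYPE('n::finite)"
  by (simp add: omega_d_def alpha_d_pos)

text \<open>For smooth functions the lower bound concerns the actual maximum, so an approximant with
  energy below \<open>omega_d\<close> times m is at most m everywhere. Its L1 distance to
  \<open>y\<close> is then at least the integral of the positive part of y - m over \<Omega>, which
  must therefore vanish.\<close>

lemma AE_le_if_Wbar_less:
  fixes y :: "real^'n::finite \<Rightarrow> real"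
  assumes [measurable]: "y \<in> borel_measurable borel" "\<Omega> \<in> sets borel"
    and m: "0 \<le> m" and less: "Wbar \<Omega> y < ennreal (omega_d TYPE('n) * m)"
  shows "AE x in lborel. x \<in> \<Omega> \<longrightarrow> y x \<le> m"
proof -
  obtain s where s: "(\<lambda>n. L1dist_on \<Omega> (s n) y) \<longlonglongrightarrow> 0" "liminf (\<lambda>n. W \<Omega> (s n)) < ennreal (omega_d TYPE('n) * m)"
    using less unfolding Wbar_def INF_less_iff by auto
  define \<delta> where "\<delta> = (\<integral>\<^sup>+x. ennreal (max 0 (y x - m)) * indicator \<Omega> x \<partial>lborel)"
  have le: "\<delta> \<le> L1dist_on \<Omega> (s n) y" if n: "W \<Omega> (s n) < ennreal (omega_d TYPE('n) * m)" for n
  proof -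
    have sm: "s n x \<le> m" for x
    proof (rule ccontr)
      assume "\<not> s n x \<le> m"
      then have x: "m < s n x" by simp
      then have "ennreal (omega_d TYPE('n) * s n x) \<le> W \<Omega> (s n)" using m by (intro omega_le_W) simp
      also note n
      finally have "omega_d TYPE('n) * s n x < omega_d TYPE('n) * m"
        using m omega_d_pos[where 'n='n] x by (subst (asm) ennreal_less_iff) auto
      then show False using x omega_d_pos[where 'n='n] by simp
    qed
    have "max 0 (y x - m) \<le> \<bar>s n x - y x\<bar>" for x using sm[of x] by simp
    then show ?thesis
      unfolding \<delta>_def L1dist_on_def by (intro nn_integral_mono mult_right_mono ennreal_leI) auto
  qed
  have "\<delta> = 0"
  proof (rule ccontr)
    assume "\<delta> \<noteq> 0"
    then have "0 < \<delta>" by (simp add: zero_less_iff_neq_zero)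
    then have "\<forall>\<^sub>F n in sequentially. L1dist_on \<Omega> (s n) y < \<delta>" by (rule order_tendstoD(2)[OF s(1)])
    then have "\<forall>\<^sub>F n in sequentially. ennreal (omega_d TYPE('n) * m) \<le> W \<Omega> (s n)"
      by eventually_elim (use le in \<open>force simp: not_less[symmetric]\<close>)
    then have "ennreal (omega_d TYPE('n) * m) \<le> liminf (\<lambda>n. W \<Omega> (s n))" by (rule Liminf_bounded)
    then show False using s(2) by simp
  qed
  then have "AE x in lborel. ennreal (max 0 (y x - m)) * indicator \<Omega> x = 0"
    unfolding \<delta>_def by (subst (asm) nn_integral_0_iff_AE) auto
  then show ?thesis by eventually_elim (auto simp: indicator_def split: if_splits)
qed

lemma emeasure_cball_alpha_d:
  assumes "0 \<le> r"
  shows "emeasure lborel (cball (c::real^'n::finite) r) = ennreal (alpha_d TYPE('n) * r ^ CARD('n))"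
proof -
  have "alpha_d TYPE('n) = unit_ball_vol (real CARD('n))"
    by (simp add: alpha_d_def content_ball)
  then show ?thesis using assms by (simp add: emeasure_cball)
qed

text \<open>Polar coordinates for radial integrands: the volume alpha_d a^d of the ball of radius a
  has derivative omega_d a^(d-1).\<close>

lemma distr_norm:
  "distr lborel borel (norm :: real^'n::finite \<Rightarrow> real) =
   density lborel (\<lambda>r. ennreal (omega_d TYPE('n) * r ^ (CARD('n) - 1)) * indicator {0..} r)" (is "?M = ?N")
proof (rule measure_eqI_generator_eq[where E="range atMost" and \<Omega>=UNIV and A="\<lambda>i. {..real i}"])
  show "Int_stable (range (atMost :: real \<Rightarrow> _))"
    by (auto simp: Int_stable_def intro!: image_eqI)
  show "emeasure ?M X = emeasure ?N X" if XE: "X \<in> range atMost" for X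
  proof -
    obtain a where X: "X = {..a}" using XE by auto
    show ?thesis
    proof (cases "0 \<le> a")
      case True
      have "norm -` {..a} = cball (0::real^'n) a" by (auto simp: cball_def)
      then have eM: "emeasure ?M X = ennreal (alpha_d TYPE('n) * a ^ CARD('n))"
        using True by (simp add: X emeasure_distr emeasure_cball_alpha_d)
      have "emeasure ?N X = (\<integral>\<^sup>+r. ennreal (omega_d TYPE('n) * r ^ (CARD('n) - 1)) * indicator {0..a} r \<partial>lborel)"
        unfolding X by (subst emeasure_density) (auto intro!: nn_integral_cong simp: indicator_def)
      also have "\<dots> = ennreal (alpha_d TYPE('n) * a ^ CARD('n) - alpha_d TYPE('n) * 0 ^ CARD('n))"
      proof (rule nn_integral_FTC_Icc)
        fix r :: real assume r: "r \<in> {0..a}"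
        show "((\<lambda>r. alpha_d TYPE('n) * r ^ CARD('n)) has_real_derivative omega_d TYPE('n) * r ^ (CARD('n) - 1)) (at r)"
          by (auto intro!: derivative_eq_intros simp: omega_d_def)
        show "0 \<le> omega_d TYPE('n) * r ^ (CARD('n) - 1)"
          using omega_d_pos[where 'n='n] r by simp
      qed (use True in auto)
      finally show ?thesis by (simp add: eM zero_power)
    next
      case False
      have "norm -` {..a} = ({} :: (real^'n) set)" using False by (auto dest: order_trans[OF norm_ge_zero])
      then have "emeasure ?M X = 0" by (simp add: X emeasure_distr)
      moreover have "emeasure ?N X = 0"
        unfolding X using False
        by (subst emeasure_density) (auto simp: nn_integral_0_iff_AE indicator_def intro!: AE_I2)
      ultimately show ?thesis by simp
    qed
  qed
  show "sets ?M = sigma_sets UNIV (range atMost)" "sets ?N = sigma_sets UNIV (range atMost)"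
    by (simp_all add: borel_eq_atMost)
  show "emeasure ?M {..real i} \<noteq> \<infinity>" for i
  proof -
    have "norm -` {..real i} = cball (0::real^'n) (real i)" by (auto simp: cball_def)
    then show ?thesis by (simp add: emeasure_distr emeasure_cball_alpha_d)
  qed
  show "(\<Union>i. {..real i}) = UNIV" using real_arch_simple by auto
qed auto

lemma nn_integral_norm:
  fixes h :: "real \<Rightarrow> ennreal"
  assumes [measurable]: "h \<in> borel_measurable borel"
  shows "(\<integral>\<^sup>+x. h (norm (x::real^'n::finite)) \<partial>lborel) =
    (\<integral>\<^sup>+r. h r * (ennreal (omega_d TYPE('n) * r ^ (CARD('n) - 1)) * indicator {0..} r) \<partial>lborel)"
proof -
  have "(\<integral>\<^sup>+x. h (norm (x::real^'n)) \<partial>lborel) = (\<integral>\<^sup>+r. h r \<partial>distr lborel borel (norm :: real^'n \<Rightarrow> real))"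
    by (simp add: nn_integral_distr)
  then show ?thesis by (simp add: distr_norm nn_integral_density mult.commute)
qed

text \<open>The profile is a function of x \<bullet> x and not of the norm, so that twice continuous
  differentiability at the origin is automatic.\<close>

locale radial_C2 =
  fixes f f' f'' :: "real \<Rightarrow> real" and u :: "real^'n::finite \<Rightarrow> real"
  assumes f: "\<And>q. (f has_real_derivative f' q) (at q)"
    and f': "\<And>q. (f' has_real_derivative f'' q) (at q)"
    and f'': "continuous_on UNIV f''"
    and f'_le: "\<And>q. f' q \<le> 0"
    and u: "\<And>x. u x = f (x \<bullet> x)"
    and dim: "2 \<le> CARD('n)"
begin

sublocale C2_function u "\<lambda>x. (2 * f' (x \<bullet> x)) *\<^sub>R x"
  "\<lambda>x h. (2 * f' (x \<bullet> x)) *\<^sub>R h + (4 * f'' (x \<bullet> x) * (x \<bullet> h)) *\<^sub>R x"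
proof
  have dq: "((\<lambda>x. x \<bullet> x) has_derivative (\<lambda>h. 2 * (x \<bullet> h))) (at x)" for x :: "real^'n"
    by (auto intro!: derivative_eq_intros simp: inner_commute)
  fix x :: "real^'n"
  show "(u has_derivative (\<lambda>h. (2 * f' (x \<bullet> x)) *\<^sub>R x \<bullet> h)) (at x)"
    unfolding u[abs_def]
    by (rule has_derivative_eq_rhs[OF has_derivative_compose[OF dq f[unfolded has_field_derivative_def]]]) (simp add: fun_eq_iff)
  have "((\<lambda>x. f' (x \<bullet> x)) has_derivative (\<lambda>h. f'' (x \<bullet> x) * (2 * (x \<bullet> h)))) (at x)"
    by (rule has_derivative_compose[OF dq f'[unfolded has_field_derivative_def]])
  then have "((\<lambda>x. 2 * f' (x \<bullet> x)) has_derivative (\<lambda>h. 2 * (f'' (x \<bullet> x) * (2 * (x \<bullet> h))))) (at x)"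
    by (rule has_derivative_mult_right)
  from has_derivative_scaleR[OF this has_derivative_ident]
  show "((\<lambda>x. (2 * f' (x \<bullet> x)) *\<^sub>R x) has_derivative (\<lambda>h. (2 * f' (x \<bullet> x)) *\<^sub>R h + (4 * f'' (x \<bullet> x) * (x \<bullet> h)) *\<^sub>R x)) (at x)"
    by (rule has_derivative_eq_rhs) (simp add: fun_eq_iff ac_simps)
next
  fix v :: "real^'n"
  have "continuous_on UNIV f'" using f' by (meson DERIV_isCont continuous_at_imp_continuous_on)
  then have "continuous_on UNIV (\<lambda>x::real^'n. f' (x \<bullet> x))"
    by (rule continuous_on_compose2) (auto intro!: continuous_intros)
  moreover have "continuous_on UNIV (\<lambda>x::real^'n. f'' (x \<bullet> x))"
    by (rule continuous_on_compose2[OF f'']) (auto intro!: continuous_intros)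
  ultimately show "continuous_on UNIV (\<lambda>x. (2 * f' (x \<bullet> x)) *\<^sub>R v + (4 * f'' (x \<bullet> x) * (x \<bullet> v)) *\<^sub>R x)"
    by (intro continuous_intros)
qed

text \<open>Level sets are spheres, whose unit normal has divergence of modulus (d-1) / |x|; the
  second derivative of the profile is purely normal and cancels from the trace. At the origin both
  sides are 0.\<close>

lemma Wdens_radial:
  "Wdens u x / real (CARD('n) - 1) ^ (CARD('n) - 1) = 2 * \<bar>f' ((norm x)\<^sup>2)\<bar> * norm x / norm x ^ (CARD('n) - 1)"
proof (cases "f' (x \<bullet> x) = 0 \<or> x = 0")
  case True
  then show ?thesis by (auto simp: Wdens_eq power2_norm_eq_inner)
next
  case False
  let ?d = "CARD('n)" let ?q = "x \<bullet> x"
  have neg: "f' ?q < 0" using False f'_le[of ?q] by simp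
  have nx: "norm x > 0" using False by simp
  have ng: "norm ((2 * f' ?q) *\<^sub>R x) = - 2 * f' ?q * norm x" using neg by simp
  have nu: "nu x = - (x /\<^sub>R norm x)"
    using neg nx unfolding nu_def ng by (simp add: field_simps)
  have q: "?q = norm x * norm x" by (simp add: power2_norm_eq_inner[symmetric] power2_eq_square)
  have 1: "nu x \<bullet> ((2 * f' ?q) *\<^sub>R nu x + (4 * f'' ?q * (x \<bullet> nu x)) *\<^sub>R x) = 2 * f' ?q + 4 * f'' ?q * ?q"
  proof -
    have "nu x \<bullet> nu x = 1" using norm_nu[of x] False by (simp add: norm_eq_1)
    moreover have "x \<bullet> nu x = - norm x" using nx by (simp add: nu q)
    ultimately show ?thesis
      by (simp only: inner_add_right inner_scaleR_right inner_commute[of "nu x" x]) (simp add: q)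
  qed
  have 2: "(\<Sum>i\<in>UNIV. ((2 * f' ?q) *\<^sub>R axis i 1 + (4 * f'' ?q * (x \<bullet> axis i 1)) *\<^sub>R x) $ i)
     = 2 * f' ?q * real ?d + 4 * f'' ?q * ?q"
  proof -
    have "(\<Sum>i\<in>UNIV. x $ i * x $ i) = ?q" by (simp add: inner_vec_def)
    then show ?thesis by (simp add: sum.distrib inner_axis sum_distrib_left[symmetric] mult.assoc)
  qed
  have "trace (matrix (Dnu x)) = 2 * f' ?q * (real ?d - 1) / (- 2 * f' ?q * norm x)"
    unfolding trace_Dnu 1 2 ng by (simp add: algebra_simps)
  also have "\<dots> = - (real (?d - 1) / norm x)" 
  proof -
    have "2 * p * m / (- 2 * p * n) = - (m / n)" if "p \<noteq> 0" for p m n :: real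
      using that by simp
    then show ?thesis using neg by (simp add: of_nat_diff)
  qed
  finally have "Wdens u x = - 2 * f' ?q * norm x * (real (?d - 1) / norm x) ^ (?d - 1)"
    using False by (simp add: Wdens_eq ng[simplified])
  then show ?thesis
    using dim neg by (simp add: power_divide power2_norm_eq_inner)
qed

lemma C2c_radial:
  assumes R1: "0 \<le> R1" "R1 < R0" and supp: "\<And>q. R1\<^sup>2 \<le> q \<Longrightarrow> f q = 0"
  shows "C2c (ball 0 R0) u"
proof -
  have "x \<in> cball 0 R1" if "u x \<noteq> 0" for x
  proof (rule ccontr)
    assume "x \<notin> cball 0 R1"
    then have "R1\<^sup>2 \<le> (norm x)\<^sup>2" using R1 by (intro power_mono) auto
    then show False using that supp[of "x \<bullet> x"] by (simp add: u power2_norm_eq_inner)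
  qed
  then have "closure {x. u x \<noteq> 0} \<subseteq> cball 0 R1" by (intro closure_minimal) auto
  moreover from this have "compact (closure {x. u x \<noteq> 0})"
    by (meson bounded_cball bounded_subset closed_closure compact_eq_bounded_closed)
  moreover have "cball (0::real^'n) R1 \<subseteq> ball 0 R0" using R1 by auto
  ultimately show ?thesis unfolding C2c_def
    by (intro conjI exI[of _ "\<lambda>x. (2 * f' (x \<bullet> x)) *\<^sub>R x"]
        exI[of _ "\<lambda>x h. (2 * f' (x \<bullet> x)) *\<^sub>R h + (4 * f'' (x \<bullet> x) * (x \<bullet> h)) *\<^sub>R x"] allI du dg cH) auto
qed

text \<open>The curvature factor 1 / r^(d-1) cancels the weight r^(d-1) of the spheres, and what
  remains is \<open>omega_d\<close> times the total decrease of the profile, whatever its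
  shape.\<close>

lemma W_radial_le:
  assumes R1: "0 \<le> R1" "R1 < R0" and supp: "\<And>q. R1\<^sup>2 \<le> q \<Longrightarrow> f q = 0"
  shows "W (ball 0 R0) u \<le> ennreal (omega_d TYPE('n) * f 0)"
proof -
  let ?d = "CARD('n)" let ?w = "omega_d TYPE('n)"
  have cf': "continuous_on UNIV f'" using f' by (meson DERIV_isCont continuous_at_imp_continuous_on)
  have [measurable]: "f' \<in> borel_measurable borel" using cf' by (rule borel_measurable_continuous_onI)
  have [measurable]: "Wdens u \<in> borel_measurable borel" by (rule Wdens_measurable)
  have f'0: "f' q = 0" if "R1\<^sup>2 < q" for q
  proof -
    have "((\<lambda>_. 0) has_real_derivative f' q) (at q)"
      using that supp by (intro has_field_derivative_transform_within_open[OF f, of "{R1\<^sup>2<..}"]) auto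
    then show ?thesis by (metis DERIV_const DERIV_unique)
  qed
  have "W (ball 0 R0) u = (\<integral>\<^sup>+x. ennreal (1 / real (?d - 1) ^ (?d - 1)) * ennreal (Wdens u x) \<partial>lborel)"
    using C2c_radial[OF assms] by (simp add: W_def nn_integral_cmult)
  also have "\<dots> = (\<integral>\<^sup>+x. ennreal (Wdens u x / real (?d - 1) ^ (?d - 1)) \<partial>lborel)"
    by (intro nn_integral_cong, subst ennreal_mult[symmetric]) (auto simp: Wdens_nonneg)
  also have "\<dots> = (\<integral>\<^sup>+x. ennreal (2 * \<bar>f' ((norm (x::real^'n))\<^sup>2)\<bar> * norm x / norm x ^ (?d - 1)) \<partial>lborel)"
    unfolding Wdens_radial ..
  also have "\<dots> = (\<integral>\<^sup>+r. ennreal (2 * \<bar>f' (r\<^sup>2)\<bar> * r / r ^ (?d - 1)) * (ennreal (?w * r ^ (?d - 1)) * indicator {0..} r) \<partial>lborel)"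
    by (rule nn_integral_norm) measurable
  also have "\<dots> \<le> (\<integral>\<^sup>+r. ennreal (?w * (- (2 * r * f' (r\<^sup>2)))) * indicator {0..R1} r \<partial>lborel)"
  proof (rule nn_integral_mono_AE)
    have "AE r::real in lborel. r \<noteq> R1" by (rule AE_lborel_singleton)
    moreover have "AE r::real in lborel. r \<noteq> 0" by (rule AE_lborel_singleton)
    ultimately show "AE r in lborel. ennreal (2 * \<bar>f' (r\<^sup>2)\<bar> * r / r ^ (?d - 1)) * (ennreal (?w * r ^ (?d - 1)) * indicator {0..} r)
       \<le> ennreal (?w * (- (2 * r * f' (r\<^sup>2)))) * indicator {0..R1} r"
    proof eventually_elim
      fix r :: real assume r: "r \<noteq> R1" "r \<noteq> 0"
      show "ennreal (2 * \<bar>f' (r\<^sup>2)\<bar> * r / r ^ (?d - 1)) * (ennreal (?w * r ^ (?d - 1)) * indicator {0..} r)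
       \<le> ennreal (?w * (- (2 * r * f' (r\<^sup>2)))) * indicator {0..R1} r"
      proof (cases "0 \<le> r")
        case False then show ?thesis by simp
      next
        case True
        show ?thesis
        proof (cases "r < R1")
          case False
          then have "R1\<^sup>2 < r\<^sup>2" using r R1 by (intro power_strict_mono) auto
          then show ?thesis by (simp add: f'0)
        next
          case inner: True
          have "ennreal (2 * \<bar>f' (r\<^sup>2)\<bar> * r / r ^ (?d - 1)) * ennreal (?w * r ^ (?d - 1))
             = ennreal (2 * \<bar>f' (r\<^sup>2)\<bar> * r / r ^ (?d - 1) * (?w * r ^ (?d - 1)))"
            using True omega_d_pos[where 'n='n] by (intro ennreal_mult[symmetric]) auto
          also have "2 * \<bar>f' (r\<^sup>2)\<bar> * r / r ^ (?d - 1) * (?w * r ^ (?d - 1)) = ?w * (- (2 * r * f' (r\<^sup>2)))"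
            using r f'_le[of "r\<^sup>2"] by (simp add: abs_of_nonpos)
          finally show ?thesis using True inner by simp
        qed
      qed
    qed
  qed
  also have "\<dots> = ennreal (?w * (- f (R1\<^sup>2)) - ?w * (- f (0\<^sup>2)))"
  proof (rule nn_integral_FTC_Icc[where F="\<lambda>r. ?w * (- f (r\<^sup>2))"])
    fix r :: real assume r: "r \<in> {0..R1}"
    have "((\<lambda>r. r\<^sup>2) has_real_derivative 2 * r) (at r)" by (auto intro!: derivative_eq_intros)
    from DERIV_chain2[OF f this]
    have "((\<lambda>r. f (r\<^sup>2)) has_real_derivative f' (r\<^sup>2) * (2 * r)) (at r)" .
    then show "((\<lambda>r. ?w * (- f (r\<^sup>2))) has_real_derivative ?w * (- (2 * r * f' (r\<^sup>2)))) (at r)"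
      by (auto intro!: derivative_eq_intros)
    show "0 \<le> ?w * (- (2 * r * f' (r\<^sup>2)))"
      using r f'_le omega_d_pos[where 'n='n] by (simp add: mult_nonneg_nonpos)
  qed (use R1 in auto)
  also have "\<dots> = ennreal (?w * f 0)" using supp[of "R1\<^sup>2"] by simp
  finally show ?thesis .
qed

end

section \<open>Twice continuously differentiable cutoffs\<close>

lemma DERIV_max0_power:
  assumes "1 \<le> n"
  shows "((\<lambda>x::real. max 0 x ^ Suc n) has_real_derivative real (Suc n) * max 0 x ^ n) (at x)"
proof (cases x "0::real" rule: linorder_cases)
  case less
  then have "real (Suc n) * max 0 x ^ n = 0" using assms by simp
  moreover have "((\<lambda>x::real. max 0 x ^ Suc n) has_real_derivative 0) (at x)"
    by (rule has_field_derivative_transform_within_open[OF DERIV_const[of 0], of "{..<0}"]) (use less in auto)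
  ultimately show ?thesis by (simp only:)
next
  case greater
  have "((\<lambda>x::real. x ^ Suc n) has_real_derivative real (Suc n) * x ^ n) (at x)"
    using DERIV_pow[of "Suc n" x UNIV] by (simp only: diff_Suc_Suc diff_zero)
  then have "((\<lambda>x::real. max 0 x ^ Suc n) has_real_derivative real (Suc n) * x ^ n) (at x)"
    by (rule has_field_derivative_transform_within_open[of _ _ _ "{0<..}"]) (use greater in auto)
  moreover have "max 0 x = x" using greater by simp
  ultimately show ?thesis by (simp only:)
next
  case equal
  have n: "(0::real) ^ n = 0" using assms by simp
  have "((\<lambda>h::real. max 0 h ^ n) \<longlongrightarrow> max 0 0 ^ n) (at 0)" by (intro tendsto_intros)
  then have "((\<lambda>h::real. max 0 h ^ n) \<longlongrightarrow> 0) (at 0)" by (simp add: n)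
  moreover have "max 0 h ^ n = (max 0 (0 + h) ^ Suc n - max 0 0 ^ Suc n) / h" if "h \<noteq> 0" for h :: real
    using that n by (cases "0 < h") simp_all
  then have "\<forall>\<^sub>F h::real in at 0. max 0 h ^ n = (max 0 (0 + h) ^ Suc n - max 0 0 ^ Suc n) / h"
    by (simp add: eventually_at_filter)
  ultimately have "((\<lambda>h::real. (max 0 (0 + h) ^ Suc n - max 0 0 ^ Suc n) / h) \<longlongrightarrow> 0) (at 0)"
    by (rule Lim_transform_eventually)
  moreover have "real (Suc n) * max 0 x ^ n = 0" using equal n by simp
  ultimately show ?thesis using equal unfolding DERIV_def by (simp only:)
qed

text \<open>The cube is the smallest integer power of the positive part that has a continuous second
  derivative.\<close>

definition cub :: "real \<Rightarrow> real" where "cub x = max 0 x ^ 3"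
definition cub' :: "real \<Rightarrow> real" where "cub' x = 3 * max 0 x ^ 2"
definition cub'' :: "real \<Rightarrow> real" where "cub'' x = 6 * max 0 x"

lemma DERIV_cub: "(cub has_real_derivative cub' x) (at x)"
  using DERIV_max0_power[of 2 x] unfolding cub_def[abs_def] cub'_def by simp

lemma DERIV_cub': "(cub' has_real_derivative cub'' x) (at x)"
  using DERIV_cmult[OF DERIV_max0_power[of 1 x], of 3]
  unfolding cub'_def[abs_def] cub''_def Suc_1 power_one_right by simp

text \<open>A twice continuously differentiable cutoff, equal to 1 up to a and to 0 from a + e on.\<close>
definition cutoff :: "real \<Rightarrow> real \<Rightarrow> real \<Rightarrow> real" where
  "cutoff a e q = cub (1 - cub ((q - a) / e))"
definition cutoff' :: "real \<Rightarrow> real \<Rightarrow> real \<Rightarrow> real" where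
  "cutoff' a e q = - (cub' (1 - cub ((q - a) / e)) * (cub' ((q - a) / e) / e))"
definition cutoff'' :: "real \<Rightarrow> real \<Rightarrow> real \<Rightarrow> real" where
  "cutoff'' a e q = cub'' (1 - cub ((q - a) / e)) * (cub' ((q - a) / e) / e)\<^sup>2
     - cub' (1 - cub ((q - a) / e)) * (cub'' ((q - a) / e) / e\<^sup>2)"

lemma DERIV_cutoff:
  assumes "e > 0"
  shows "(cutoff a e has_real_derivative cutoff' a e q) (at q)"
    and "(cutoff' a e has_real_derivative cutoff'' a e q) (at q)"
proof -
  have d: "((\<lambda>q. (q - a) / e) has_real_derivative 1 / e) (at q)"
    using assms by (auto intro!: derivative_eq_intros)
  note d1 = DERIV_chain2[OF DERIV_cub d] and d2 = DERIV_chain2[OF DERIV_cub' d]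
  have d3: "((\<lambda>q. 1 - cub ((q - a) / e)) has_real_derivative - (cub' ((q - a) / e) / e)) (at q)"
    using d1 by (auto intro!: derivative_eq_intros)
  from DERIV_chain2[OF DERIV_cub d3]
  show "(cutoff a e has_real_derivative cutoff' a e q) (at q)"
    by (simp add: cutoff_def[abs_def] cutoff'_def)
  have d4: "((\<lambda>q. cub' ((q - a) / e) / e) has_real_derivative cub'' ((q - a) / e) / e\<^sup>2) (at q)"
    using DERIV_cdivide[OF d2, of e] by (simp add: power2_eq_square)
  from DERIV_minus[OF DERIV_mult[OF DERIV_chain2[OF DERIV_cub' d3] d4]]
  show "(cutoff' a e has_real_derivative cutoff'' a e q) (at q)"
    unfolding cutoff'_def[abs_def]
    by (rule DERIV_cong) (simp add: cutoff''_def power2_eq_square algebra_simps)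
qed

lemma continuous_cutoff'': "continuous_on UNIV (cutoff'' a e)"
  unfolding cutoff''_def[abs_def] cub_def cub'_def cub''_def
  by (cases "e = 0") (auto intro!: continuous_intros)

lemma cutoff'_nonpos: "0 < e \<Longrightarrow> cutoff' a e q \<le> 0"
  by (simp add: cutoff'_def cub'_def)

lemma cutoff_bounds: "0 \<le> cutoff a e q" "cutoff a e q \<le> 1"
proof -
  show "0 \<le> cutoff a e q" by (simp add: cutoff_def cub_def)
  have "max 0 (1 - cub ((q - a) / e)) \<le> 1" by (simp add: cub_def)
  then show "cutoff a e q \<le> 1" unfolding cutoff_def by (subst cub_def) (intro power_le_one, auto)
qed

lemma cutoff_eq_1:
  assumes "0 < e" "q \<le> a"
  shows "cutoff a e q = 1"
proof -
  have "max 0 ((q - a) / e) = 0" using divide_nonpos_pos[of "q - a" e] assms by simp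
  then show ?thesis by (simp add: cutoff_def cub_def)
qed

lemma cutoff_eq_0:
  assumes "0 < e" "a + e \<le> q"
  shows "cutoff a e q = 0"
proof -
  have "1 \<le> (q - a) / e" using assms by (simp add: le_divide_eq)
  then have "1 \<le> max 0 ((q - a) / e)" by simp
  then have "1 \<le> cub ((q - a) / e)" unfolding cub_def by (rule one_le_power)
  then have "max 0 (1 - cub ((q - a) / e)) = 0" by simp
  then show ?thesis unfolding cutoff_def by (subst cub_def) simp
qed

text \<open>A nonnegative combination of radial cutoffs is again a non-increasing radial profile, so
  the energy depends only on the value at the centre, and that is at most k c.\<close>

lemma W_sum_cutoff_le:
  fixes a :: "nat \<Rightarrow> real"
  assumes dim: "2 \<le> CARD('n::finite)" and c: "0 \<le> c" and e: "0 < e" and R1: "0 \<le> R1" "R1 < R0"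
    and a: "\<And>i. i < k \<Longrightarrow> a i + e \<le> R1\<^sup>2"
  shows "W (ball 0 R0) (\<lambda>x::real^'n. \<Sum>i<k. c * cutoff (a i) e (x \<bullet> x)) \<le> ennreal (omega_d TYPE('n) * (real k * c))"
proof -
  define f where "f q = (\<Sum>i<k. c * cutoff (a i) e q)" for q
  define f' where "f' q = (\<Sum>i<k. c * cutoff' (a i) e q)" for q
  define f'' where "f'' q = (\<Sum>i<k. c * cutoff'' (a i) e q)" for q
  interpret radial_C2 f f' f'' "\<lambda>x::real^'n. f (x \<bullet> x)"
  proof
    show "(f has_real_derivative f' q) (at q)" for q
      unfolding f_def[abs_def] f'_def by (intro DERIV_sum DERIV_cmult DERIV_cutoff[OF e])
    show "(f' has_real_derivative f'' q) (at q)" for q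
      unfolding f''_def f'_def[abs_def] by (intro DERIV_sum DERIV_cmult DERIV_cutoff[OF e])
    show "continuous_on UNIV f''"
      unfolding f''_def[abs_def] by (intro continuous_intros continuous_cutoff'')
    show "f' q \<le> 0" for q
      unfolding f'_def using c cutoff'_nonpos[OF e] by (intro sum_nonpos) (simp add: mult_nonneg_nonpos)
  qed (use dim in auto)
  have "W (ball 0 R0) (\<lambda>x::real^'n. f (x \<bullet> x)) \<le> ennreal (omega_d TYPE('n) * f 0)"
  proof (rule W_radial_le[OF R1])
    show "f q = 0" if "R1\<^sup>2 \<le> q" for q
      unfolding f_def using a that by (intro sum.neutral) (force intro: cutoff_eq_0[OF e])
  qed
  also have "\<dots> \<le> ennreal (omega_d TYPE('n) * (real k * c))"
  proof (intro ennreal_leI mult_left_mono)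
    have "f 0 \<le> (\<Sum>i<k. c)"
      unfolding f_def using c cutoff_bounds by (intro sum_mono) (simp add: mult_left_le)
    then show "f 0 \<le> real k * c" by simp
  qed (use omega_d_pos[where 'n='n] in simp)
  finally show ?thesis by (simp add: f_def)
qed

section \<open>Truncations of radial functions as limits of smoothed staircases\<close>

lemma Wbar_le_if_approx:
  assumes "\<And>e. 0 < e \<Longrightarrow> \<exists>u. W \<Omega> u \<le> c \<and> L1dist_on \<Omega> u v \<le> ennreal e"
  shows "Wbar \<Omega> v \<le> c"
proof -
  have "\<exists>u. W \<Omega> u \<le> c \<and> L1dist_on \<Omega> u v \<le> ennreal (1 / real (Suc n))" for n
    by (rule assms) simp
  then obtain s where s: "\<And>n. W \<Omega> (s n) \<le> c" "\<And>n. L1dist_on \<Omega> (s n) v \<le> ennreal (1 / real (Suc n))"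
    by metis
  have "(\<lambda>n. ennreal (1 / real (Suc n))) \<longlonglongrightarrow> ennreal 0"
    by (intro tendsto_ennrealI LIMSEQ_Suc lim_1_over_n)
  then have "(\<lambda>n. L1dist_on \<Omega> (s n) v) \<longlonglongrightarrow> 0"
    by (intro tendsto_sandwich[of "\<lambda>_. 0" "\<lambda>n. L1dist_on \<Omega> (s n) v" sequentially "\<lambda>n. ennreal (1 / real (Suc n))" 0])
       (use s(2) in auto)
  then have "Wbar \<Omega> v \<le> liminf (\<lambda>n. W \<Omega> (s n))"
    unfolding Wbar_def by (intro INF_lower) simp
  also have "\<dots> \<le> c"
    using s(1) by (intro Liminf_le) auto
  finally show ?thesis .
qed

text \<open>Layer-cake decomposition with layers of height s/k: the layers reached by w form an
  initial segment. Counting from \<open>Suc i\<close> keeps every level positive, where superlevel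
  sets are balls.\<close>

lemma staircase_bounds:
  fixes w s :: real
  assumes w: "0 \<le> w" and s: "0 < s" and k: "0 < k"
  shows "\<bar>min w s - (\<Sum>i<k. s / real k * (if real (Suc i) * s / real k \<le> w then 1 else 0))\<bar> \<le> s / real k"
proof -
  define z where "z = w * real k / s"
  define m where "m = min k (nat \<lfloor>z\<rfloor>)"
  have z0: "z \<ge> 0" using w s by (simp add: z_def)
  have "{i \<in> {..<k}. real (Suc i) * s / real k \<le> w} = {..<m}"
  proof -
    have "real (Suc i) * s / real k \<le> w \<longleftrightarrow> real (Suc i) \<le> z" for i
      using s k by (simp add: z_def field_simps)
    moreover have "real (Suc i) \<le> z \<longleftrightarrow> i < nat \<lfloor>z\<rfloor>" for i
      by (simp add: zless_nat_eq_int_zless less_floor_iff add.commute)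
    ultimately have iff: "real (Suc i) * s / real k \<le> w \<longleftrightarrow> i < nat \<lfloor>z\<rfloor>" for i by (simp only:)
    show ?thesis unfolding iff m_def by auto
  qed
  note set_eq = this
  have "(\<Sum>i<k. s / real k * (if real (Suc i) * s / real k \<le> w then 1 else 0))
     = (\<Sum>i\<in>{i \<in> {..<k}. real (Suc i) * s / real k \<le> w}. s / real k)"
    by (subst sum.inter_filter) (auto intro!: sum.cong)
  also have "\<dots> = s / real k * real m"
    unfolding set_eq by simp
  finally have "(\<Sum>i<k. s / real k * (if real (Suc i) * s / real k \<le> w then 1 else 0)) = s / real k * real m" .
  moreover have "\<bar>min w s - s / real k * real m\<bar> \<le> s / real k"
  proof -
    have sk: "s / real k > 0" using s k by simp
    have "real m \<le> min z (real k)" using z0 of_nat_floor[OF z0] by (auto simp: m_def min_def)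
    moreover have "min z (real k) \<le> real m + 1"
    proof -
      have "z \<le> real (nat \<lfloor>z\<rfloor>) + 1" using z0 real_of_int_floor_add_one_ge[of z] by simp
      then show ?thesis unfolding m_def of_nat_min by linarith
    qed
    ultimately have "s / real k * real m \<le> s / real k * min z (real k)" "s / real k * min z (real k) \<le> s / real k * (real m + 1)"
      using sk by (simp_all del: times_divide_eq_left)
    moreover have "s / real k * min z (real k) = min w s"
      using s k by (auto simp: z_def min_def field_simps)
    ultimately show ?thesis by (simp add: distrib_left abs_le_iff)
  qed
  ultimately show ?thesis by simp
qed

definition superlevel_radius :: "(real^'n::finite \<Rightarrow> real) \<Rightarrow> real \<Rightarrow> real \<Rightarrow> bool" where
  "superlevel_radius u t r \<longleftrightarrow> 0 \<le> r \<and> (AE x in lborel. t \<le> u x \<longleftrightarrow> norm x \<le> r)"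

text \<open>A larger radius would put a nonempty open annulus, hence a set of positive measure,
  outside the support.\<close>

lemma superlevel_radius_le:
  fixes u :: "real^'n::finite \<Rightarrow> real"
  assumes r: "superlevel_radius u t r" and t: "0 < t" and R1: "0 \<le> R1"
    and supp: "AE x in lborel. R1 < norm x \<longrightarrow> u x = 0"
  shows "r \<le> R1"
proof (rule ccontr)
  assume "\<not> r \<le> R1"
  then have lt: "R1 < r" by simp
  have "AE x::real^'n in lborel. t \<le> u x \<longleftrightarrow> norm x \<le> r"
    using r by (simp add: superlevel_radius_def)
  then have "AE x::real^'n in lborel. x \<notin> {x. R1 < norm x} \<inter> {x. norm x < r}"
    using supp by eventually_elim (use t in auto)
  moreover have op: "open ({x::real^'n. R1 < norm x} \<inter> {x. norm x < r})"
    by (intro open_Int open_Collect_less continuous_intros)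
  ultimately have "{x::real^'n. R1 < norm x} \<inter> {x. norm x < r} \<in> null_sets lborel"
    by (subst AE_iff_null_sets) (auto intro: borel_open)
  then have "negligible ({x::real^'n. R1 < norm x} \<inter> {x. norm x < r})"
    by (simp add: negligible_iff_null_sets null_sets_completionI)
  then have "{x::real^'n. R1 < norm x} \<inter> {x. norm x < r} = {}"
    using open_not_negligible[OF op] by blast
  moreover obtain x :: "real^'n" where "norm x = (R1 + r) / 2"
    using R1 lt vector_choose_size[of "(R1 + r) / 2"] by auto
  moreover have "x \<in> {x. R1 < norm x} \<inter> {x. norm x < r}"
    using lt \<open>norm x = (R1 + r) / 2\<close> by simp
  ultimately show False by blast
qed

text \<open>Replace the truncation by a staircase of k indicators of balls with steps s/k, and each
  indicator by a cutoff of shrinking width. The energy stays below \<open>omega_d\<close> times k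
  (s/k) = s throughout, while the L1 error splits into a staircase part and a smoothing
  part.\<close>

lemma Wbar_min_le:
  fixes u0 :: "real^'n::finite \<Rightarrow> real"
  assumes dim: "2 \<le> CARD('n)" and s: "0 \<le> s"
    and [measurable]: "u0 \<in> borel_measurable borel" and nonneg: "AE x in lborel. 0 \<le> u0 x"
    and R1: "0 \<le> R1" "R1 < R0" and supp: "AE x in lborel. R1 < norm x \<longrightarrow> u0 x = 0"
    and rad: "\<And>t. 0 < t \<Longrightarrow> \<exists>r. superlevel_radius u0 t r"
  shows "Wbar (ball 0 R0) (\<lambda>x. min (u0 x) s) \<le> ennreal (omega_d TYPE('n) * s)"
proof (rule Wbar_le_if_approx)
  fix e :: real assume e: "0 < e"
  let ?\<Omega> = "ball (0::real^'n) R0"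
  define V where "V = alpha_d TYPE('n) * R0 ^ CARD('n)"
  have V: "V > 0" using R1 alpha_d_pos[where 'n='n] by (simp add: V_def)
  have eV: "emeasure lborel ?\<Omega> = ennreal V" using R1 by (simp add: V_def emeasure_ball_alpha_d)
  show "\<exists>u. W ?\<Omega> u \<le> ennreal (omega_d TYPE('n) * s) \<and> L1dist_on ?\<Omega> u (\<lambda>x. min (u0 x) s) \<le> ennreal e"
  proof (cases "s = 0")
    case True
    have "W ?\<Omega> (\<lambda>x. 0) \<le> 0"
      using R1 W_sum_cutoff_le[OF dim order_refl zero_less_one R1, of 0] by simp
    moreover have "L1dist_on ?\<Omega> (\<lambda>x. 0) (\<lambda>x. min (u0 x) s) = 0"
    proof -
      have "AE x in lborel. ennreal \<bar>0 - min (u0 x) s\<bar> * indicator ?\<Omega> x = 0"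
        using nonneg by eventually_elim (simp add: True)
      then have "L1dist_on ?\<Omega> (\<lambda>x. 0) (\<lambda>x. min (u0 x) s) = (\<integral>\<^sup>+(x::real^'n). 0 \<partial>lborel)"
        unfolding L1dist_on_def by (rule nn_integral_cong_AE)
      then show ?thesis by simp
    qed
    ultimately show ?thesis using True e by (intro exI[of _ "\<lambda>_. 0"]) auto
  next
    case False
    then have s0: "s > 0" using s by simp
    \<comment> \<open>With V the volume of the domain, the staircase error is at most V s / k \<le>
      e / 2.\<close>
    obtain k :: nat where k: "2 * s * V / e < real k"
      using reals_Archimedean2[of "2 * s * V / e"] by blast
    have k0: "k > 0" 
    proof -
      have "0 < 2 * s * V / e" using s0 V e by simp
      then have "0 < real k" using k by linarith
      then show ?thesis by simp
    qed
    have kV: "s / real k * V \<le> e / 2" using k k0 e by (simp add: field_simps)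
    have "\<exists>r. superlevel_radius u0 (real (Suc i) * s / real k) r" for i
      using s0 k0 by (intro rad) simp
    then obtain r where r: "\<And>i. superlevel_radius u0 (real (Suc i) * s / real k) (r i)" by metis
    have r0: "0 \<le> r i" for i using r by (simp add: superlevel_radius_def)
    have rR: "r i \<le> R1" for i
      using s0 k0 by (intro superlevel_radius_le[OF r _ R1(1) supp]) simp
    \<comment> \<open>Leaves room between the support radius \<open>R1\<close> and the boundary for
      the cutoffs to reach 0 inside the open ball; \<open>\<delta>0\<close> is that room measured in
      squared radii.\<close>
    define R2 where "R2 = (R1 + R0) / 2"
    have R2: "0 \<le> R2" "R2 < R0" "R1 < R2" using R1 by (auto simp: R2_def)
    define \<delta>0 where "\<delta>0 = R2\<^sup>2 - R1\<^sup>2"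
    have \<delta>0: "\<delta>0 > 0" using R1 R2 by (simp add: \<delta>0_def power_strict_mono)
    define c where "c = s / real k"
    have c: "c > 0" using s0 k0 by (simp add: c_def)
    define \<delta> where "\<delta> j = \<delta>0 / real (Suc j)" for j
    have \<delta>: "\<delta> j > 0" "\<delta> j \<le> \<delta>0" for j using \<delta>0 by (simp_all add: \<delta>_def divide_le_eq)
    define F where "F j x = (\<Sum>i<k. c * cutoff ((r i)\<^sup>2) (\<delta> j) (x \<bullet> x))" for j and x :: "real^'n"
    define G where "G x = (\<Sum>i<k. c * indicator (cball 0 (r i)) x)" for x :: "real^'n"
    have WF: "W ?\<Omega> (F j) \<le> ennreal (omega_d TYPE('n) * s)" for j
    proof -
      have "(r i)\<^sup>2 + \<delta> j \<le> R2\<^sup>2" for i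
        using power_mono[OF rR[of i] r0[of i], of 2] \<delta>(2)[of j] by (simp add: \<delta>0_def)
      then have "W ?\<Omega> (F j) \<le> ennreal (omega_d TYPE('n) * (real k * c))"
        unfolding F_def[abs_def] using c \<delta> R2 dim by (intro W_sum_cutoff_le[where ?R1.0=R2]) auto
      then show ?thesis using k0 by (simp add: c_def)
    qed
    have contF: "continuous_on UNIV (F j)" for j
    proof -
      have "continuous_on UNIV (cutoff a (\<delta> j))" for a
        using DERIV_cutoff(1)[OF \<delta>(1)] by (meson DERIV_isCont continuous_at_imp_continuous_on)
      then have "continuous_on UNIV (\<lambda>x::real^'n. cutoff a (\<delta> j) (x \<bullet> x))" for a
        by (rule continuous_on_compose2) (auto intro!: continuous_intros)
      then show ?thesis unfolding F_def[abs_def] by (intro continuous_intros)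
    qed
    have [measurable]: "F j \<in> borel_measurable borel" for j
      using contF by (rule borel_measurable_continuous_onI)
    have [measurable]: "G \<in> borel_measurable borel" unfolding G_def[abs_def]
      by (intro borel_measurable_sum borel_measurable_times borel_measurable_const borel_measurable_indicator) auto
    have lim: "(\<lambda>j. F j x) \<longlonglongrightarrow> G x" for x
    proof -
      have "(\<lambda>j. cutoff ((r i)\<^sup>2) (\<delta> j) (x \<bullet> x)) \<longlonglongrightarrow> indicator (cball 0 (r i)) x" for i
      proof (cases "norm x \<le> r i")
        case True
        then have "x \<bullet> x \<le> (r i)\<^sup>2" by (simp add: power2_norm_eq_inner[symmetric] power_mono)
        then show ?thesis using True by (simp add: cutoff_eq_1[OF \<delta>(1)])
      next
        case False
        then have pos: "0 < x \<bullet> x - (r i)\<^sup>2"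
          using r0[of i] by (simp add: power2_norm_eq_inner[symmetric] power_strict_mono)
        have "\<delta> \<longlonglongrightarrow> 0"
          unfolding \<delta>_def[abs_def] using LIMSEQ_Suc[OF lim_const_over_n[of \<delta>0]] by simp
        then have "\<forall>\<^sub>F j in sequentially. \<delta> j < x \<bullet> x - (r i)\<^sup>2"
          using pos by (rule order_tendstoD(2))
        then have "\<forall>\<^sub>F j in sequentially. cutoff ((r i)\<^sup>2) (\<delta> j) (x \<bullet> x) = 0"
          by eventually_elim (rule cutoff_eq_0[OF \<delta>(1)], simp)
        then show ?thesis using False by (simp add: tendsto_eventually)
      qed
      then show ?thesis unfolding F_def G_def by (intro tendsto_intros)
    qed
    have FG: "\<bar>F j x - G x\<bar> \<le> s" for j x
    proof -
      have "\<bar>F j x - G x\<bar> \<le> (\<Sum>i<k. \<bar>c * cutoff ((r i)\<^sup>2) (\<delta> j) (x \<bullet> x) - c * indicator (cball 0 (r i)) x\<bar>)"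
        unfolding F_def G_def sum_subtractf[symmetric] by (rule sum_abs)
      also have "\<dots> \<le> (\<Sum>i<k. c)"
      proof (rule sum_mono)
        fix i
        have "\<bar>cutoff ((r i)\<^sup>2) (\<delta> j) (x \<bullet> x) - indicator (cball 0 (r i)) x\<bar> \<le> 1"
          using cutoff_bounds[of "(r i)\<^sup>2" "\<delta> j" "x \<bullet> x"] by (auto simp: indicator_def)
        then have "c * \<bar>cutoff ((r i)\<^sup>2) (\<delta> j) (x \<bullet> x) - indicator (cball 0 (r i)) x\<bar> \<le> c * 1"
          using c by (intro mult_left_mono) auto
        then show "\<bar>c * cutoff ((r i)\<^sup>2) (\<delta> j) (x \<bullet> x) - c * indicator (cball 0 (r i)) x\<bar> \<le> c"
          using c by (simp add: abs_mult flip: right_diff_distrib)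
      qed
      also have "\<dots> = s" using k0 by (simp add: c_def)
      finally show ?thesis .
    qed
    have mF: "(\<lambda>x. ennreal \<bar>F j x - G x\<bar>) \<in> borel_measurable lborel" for j by measurable
    have mI: "(\<lambda>x. indicator ?\<Omega> x :: ennreal) \<in> borel_measurable lborel"
      by (rule borel_measurable_indicator) simp
    have "(\<lambda>j. \<integral>\<^sup>+x. ennreal \<bar>F j x - G x\<bar> * indicator ?\<Omega> x \<partial>lborel) \<longlonglongrightarrow> (\<integral>\<^sup>+(x::real^'n). 0 \<partial>lborel)"
    proof (rule nn_integral_dominated_convergence[where w="\<lambda>x. ennreal s * indicator ?\<Omega> x"])
      show "AE x in lborel. ennreal \<bar>F j x - G x\<bar> * indicator ?\<Omega> x \<le> ennreal s * indicator ?\<Omega> x" for j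
        using FG by (intro AE_I2 mult_right_mono ennreal_leI) auto
      show "(\<integral>\<^sup>+x. ennreal s * indicator ?\<Omega> x \<partial>lborel) < \<infinity>"
        by (subst nn_integral_cmult) (simp_all add: eV ennreal_mult_less_top borel_measurable_indicator)
      show "AE x in lborel. (\<lambda>j. ennreal \<bar>F j x - G x\<bar> * indicator ?\<Omega> x) \<longlonglongrightarrow> 0"
      proof (rule AE_I2)
        fix x
        have "(\<lambda>j. \<bar>F j x - G x\<bar>) \<longlonglongrightarrow> \<bar>G x - G x\<bar>" by (intro tendsto_intros lim)
        then have "(\<lambda>j. ennreal \<bar>F j x - G x\<bar>) \<longlonglongrightarrow> ennreal 0" by (intro tendsto_ennrealI) simp
        then show "(\<lambda>j. ennreal \<bar>F j x - G x\<bar> * indicator ?\<Omega> x) \<longlonglongrightarrow> 0"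
          by (cases "x \<in> ?\<Omega>") auto
      qed
    qed (intro borel_measurable_times_ennreal borel_measurable_const mF mI)+
    then have "\<forall>\<^sub>F j in sequentially. (\<integral>\<^sup>+x. ennreal \<bar>F j x - G x\<bar> * indicator ?\<Omega> x \<partial>lborel) < ennreal (e / 2)"
      using e by (intro order_tendstoD(2)) auto
    then obtain j where j: "(\<integral>\<^sup>+x. ennreal \<bar>F j x - G x\<bar> * indicator ?\<Omega> x \<partial>lborel) < ennreal (e / 2)"
      by (auto simp: eventually_sequentially)
    have "AE x in lborel. \<forall>i\<in>{..<k}. real (Suc i) * s / real k \<le> u0 x \<longleftrightarrow> norm x \<le> r i"
      using r by (intro AE_finite_allI) (auto simp: superlevel_radius_def)
    with nonneg have AE: "AE x in lborel. ennreal \<bar>F j x - min (u0 x) s\<bar> * indicator ?\<Omega> x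
       \<le> ennreal \<bar>F j x - G x\<bar> * indicator ?\<Omega> x + ennreal c * indicator ?\<Omega> x"
    proof eventually_elim
      case (elim x)
      have "G x = (\<Sum>i<k. s / real k * (if real (Suc i) * s / real k \<le> u0 x then 1 else 0))"
        unfolding G_def c_def using elim(2) by (intro sum.cong) (auto simp: indicator_def)
      then have "\<bar>min (u0 x) s - G x\<bar> \<le> c"
        using staircase_bounds[OF elim(1) s0 k0] by (simp add: c_def)
      then have "ennreal \<bar>F j x - min (u0 x) s\<bar> \<le> ennreal (\<bar>F j x - G x\<bar> + c)"
        by (intro ennreal_leI) linarith
      then show ?case using c by (auto simp: indicator_def ennreal_plus)
    qed
    have "L1dist_on ?\<Omega> (F j) (\<lambda>x. min (u0 x) s) \<le> (\<integral>\<^sup>+x. ennreal \<bar>F j x - G x\<bar> * indicator ?\<Omega> x + ennreal c * indicator ?\<Omega> x \<partial>lborel)"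
      unfolding L1dist_on_def by (rule nn_integral_mono_AE[OF AE])
    also have "\<dots> = (\<integral>\<^sup>+x. ennreal \<bar>F j x - G x\<bar> * indicator ?\<Omega> x \<partial>lborel) + ennreal c * ennreal V"
      using mF mI
      by (subst nn_integral_add) (auto simp: nn_integral_cmult eV)
    also have "\<dots> \<le> ennreal (e / 2) + ennreal (e / 2)"
    proof (rule add_mono)
      show "ennreal c * ennreal V \<le> ennreal (e / 2)"
        using ennreal_leI[OF kV] c V unfolding c_def[symmetric] by (subst ennreal_mult[symmetric]) auto
    qed (use j in simp)
    also have "\<dots> = ennreal e" using e by (simp flip: ennreal_plus)
    finally show ?thesis using WF by blast
  qed
qed

section \<open>The implicit scheme\<close>

lemma add_quotient_le_iff:
  fixes a b x y \<tau> :: real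
  assumes "0 < \<tau>"
  shows "a + x / (2 * \<tau>) \<le> b + y / (2 * \<tau>) \<longleftrightarrow> x - y \<le> 2 * \<tau> * (b - a)"
proof -
  have "a + x / (2 * \<tau>) \<le> b + y / (2 * \<tau>) \<longleftrightarrow> (x - y) / (2 * \<tau>) \<le> b - a"
    unfolding diff_divide_distrib by linarith
  also have "\<dots> \<longleftrightarrow> x - y \<le> 2 * \<tau> * (b - a)" using assms by (simp add: pos_divide_le_eq mult.commute)
  finally show ?thesis .
qed

locale radial_datum =
  fixes u0 :: "real^'n::finite \<Rightarrow> real" and R0 R1 :: real
  assumes dim: "2 \<le> CARD('n)"
    and u0_int: "integrable lborel u0"
    and nonneg: "AE x in lborel. 0 \<le> u0 x"
    and R1: "0 \<le> R1" "R1 < R0"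
    and supp: "AE x in lborel. R1 < norm x \<longrightarrow> u0 x = 0"
    and rad: "\<And>t. 0 < t \<Longrightarrow> \<exists>r. superlevel_radius u0 t r"
begin

definition area :: "real \<Rightarrow> real" where
  "area t = measure lborel {x. t \<le> u0 x}"

text \<open>For a \<le> b the L1 distance of the two truncations; the sign makes it additive for
  levels in any order.\<close>

definition gap :: "real \<Rightarrow> real \<Rightarrow> real" where
  "gap a b = (\<integral>x. min (u0 x) b - min (u0 x) a \<partial>lborel)"

lemma u0_measurable [measurable]: "u0 \<in> borel_measurable borel"
  using borel_measurable_integrable[OF u0_int] by simp

lemma superlevel_sets [measurable]: "{x. t \<le> u0 x} \<in> sets borel"
  by measurable

lemma superlevel_fmeasurable:
  assumes "0 < t"
  shows "{x. t \<le> u0 x} \<in> fmeasurable lborel"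
proof (rule fmeasurableI)
  have "emeasure lborel {x. t \<le> u0 x} \<le> emeasure lborel (cball (0::real^'n) R1)"
    by (rule emeasure_mono_AE) (use supp assms in \<open>auto elim!: eventually_mono simp: not_le[symmetric]\<close>)
  also have "\<dots> < \<infinity>" using R1 by (simp add: emeasure_cball_alpha_d)
  finally show "emeasure lborel {x. t \<le> u0 x} < \<infinity>" .
qed simp

lemma area_nonneg: "0 \<le> area t"
  by (simp add: area_def)

lemma area_antimono:
  assumes "0 < s" "s \<le> t"
  shows "area t \<le> area s"
  unfolding area_def
  using superlevel_fmeasurable[OF assms(1)] assms by (intro measure_mono_fmeasurable) auto

lemma area_eq:
  assumes "superlevel_radius u0 t r"
  shows "area t = alpha_d TYPE('n) * r ^ CARD('n)"
proof -
  have "emeasure lborel {x. t \<le> u0 x} = emeasure lborel (cball (0::real^'n) r)"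
    using assms by (intro emeasure_eq_AE) (auto simp: superlevel_radius_def)
  then show ?thesis
    using assms alpha_d_pos[where 'n='n]
    by (simp add: area_def measure_def emeasure_cball_alpha_d superlevel_radius_def)
qed

lemma min_integrable:
  assumes "0 \<le> s"
  shows "integrable lborel (\<lambda>x. min (u0 x) s)"
proof (rule Bochner_Integration.integrable_bound[OF u0_int])
  show "AE x in lborel. norm (min (u0 x) s) \<le> norm (u0 x)"
    using nonneg by eventually_elim (use assms in auto)
qed measurable

lemma gap_add:
  assumes "0 \<le> a" "0 \<le> b" "0 \<le> c"
  shows "gap a c = gap a b + gap b c"
  unfolding gap_def using assms min_integrable
  by (subst Bochner_Integration.integral_add[symmetric]) (auto intro!: Bochner_Integration.integrable_diff)

text \<open>This and \<open>gap_le\<close> stand in for the formula expressing the gap as the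
  integral of \<open>area\<close> over [a, b]. Here the lower level may be 0, where
  \<open>area\<close> need not be meaningful, so only the upper level is evaluated.\<close>

lemma gap_ge:
  assumes "0 \<le> a" "a \<le> b" "0 < b"
  shows "(b - a) * area b \<le> gap a b"
proof -
  have "(b - a) * area b = (\<integral>x. (b - a) * indicator {x. b \<le> u0 x} x \<partial>lborel)"
    by (simp add: area_def)
  also have "\<dots> \<le> gap a b"
    unfolding gap_def
  proof (rule integral_mono_AE)
    show "integrable lborel (\<lambda>x. (b - a) * indicator {x. b \<le> u0 x} x)"
      using superlevel_fmeasurable[OF assms(3)]
      by (intro integrable_mult_right integrable_real_indicator) (auto simp: fmeasurable_def)
    show "integrable lborel (\<lambda>x. min (u0 x) b - min (u0 x) a)"
      using assms by (intro Bochner_Integration.integrable_diff min_integrable) auto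
    show "AE x in lborel. (b - a) * indicator {x. b \<le> u0 x} x \<le> min (u0 x) b - min (u0 x) a"
      using assms by (intro AE_I2) (auto simp: indicator_def min_def)
  qed
  finally show ?thesis .
qed

lemma gap_le:
  assumes "0 < a" "a \<le> b"
  shows "gap a b \<le> (b - a) * area a"
proof -
  have "gap a b \<le> (\<integral>x. (b - a) * indicator {x. a \<le> u0 x} x \<partial>lborel)"
    unfolding gap_def
  proof (rule integral_mono_AE)
    show "integrable lborel (\<lambda>x. (b - a) * indicator {x. a \<le> u0 x} x)"
      using superlevel_fmeasurable[OF assms(1)]
      by (intro integrable_mult_right integrable_real_indicator) (auto simp: fmeasurable_def)
    show "integrable lborel (\<lambda>x. min (u0 x) b - min (u0 x) a)"
      using assms by (intro Bochner_Integration.integrable_diff min_integrable) auto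
    show "AE x in lborel. min (u0 x) b - min (u0 x) a \<le> (b - a) * indicator {x. a \<le> u0 x} x"
      using assms by (intro AE_I2) (auto simp: indicator_def min_def)
  qed
  also have "\<dots> = (b - a) * area a" by (simp add: area_def)
  finally show ?thesis .
qed

lemma gap_nonneg:
  assumes "0 \<le> a" "a \<le> b"
  shows "0 \<le> gap a b"
  unfolding gap_def using assms by (intro integral_nonneg_AE AE_I2) auto

lemma L1dist_min:
  assumes ab: "0 \<le> a" "a \<le> b"
    and y: "AE x in lborel. y x = min (u0 x) a" and z: "AE x in lborel. z x = min (u0 x) b"
  shows "L1dist y z = ennreal (gap a b)"
proof -
  have "L1dist y z = (\<integral>\<^sup>+x. ennreal (min (u0 x) b - min (u0 x) a) \<partial>lborel)"
    unfolding L1dist_def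
  proof (rule nn_integral_cong_AE)
    show "AE x in lborel. ennreal \<bar>y x - z x\<bar> = ennreal (min (u0 x) b - min (u0 x) a)"
      using y z by eventually_elim (use ab in \<open>auto simp: abs_if\<close>)
  qed
  also have "\<dots> = ennreal (gap a b)"
    unfolding gap_def using ab
    by (intro nn_integral_eq_integral Bochner_Integration.integrable_diff min_integrable) auto
  finally show ?thesis .
qed

lemma min_L1cp:
  assumes "0 \<le> s"
  shows "(\<lambda>x. min (u0 x) s) \<in> L1cp (ball 0 R0)"
proof -
  have "AE x in lborel. 0 \<le> min (u0 x) s" using nonneg by eventually_elim (use assms in auto)
  moreover have "AE x in lborel. x \<notin> cball 0 R1 \<longrightarrow> min (u0 x) s = 0"
    using supp by eventually_elim (use assms in auto)
  moreover have "cball (0::real^'n) R1 \<subseteq> ball 0 R0" using R1 by auto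
  ultimately show ?thesis
    using min_integrable[OF assms] unfolding L1cp_def by (auto intro!: exI[of _ "cball 0 R1"])
qed

text \<open>The energy of \<open>y\<close> is \<open>omega_d\<close> times some m, so y \<le> m.
  Among functions bounded by m the truncation at m is the only one closest in L1 to the truncation
  at l, and its energy is no larger than that of \<open>y\<close>; minimality therefore identifies
  \<open>y\<close> with it.\<close>

lemma MM_step_min:
  assumes l: "0 \<le> l" and \<tau>: "0 < \<tau>" and x: "AE z in lborel. x z = min (u0 z) l"
    and step: "MM_step (ball 0 R0) \<tau> x y"
  obtains m where "0 \<le> m" "m \<le> l" "AE z in lborel. y z = min (u0 z) m"
    "\<And>s. 0 \<le> s \<Longrightarrow> s \<le> l \<Longrightarrow> omega_d TYPE('n) * m + (gap m l)\<^sup>2 / (2 * \<tau>) \<le> omega_d TYPE('n) * s + (gap s l)\<^sup>2 / (2 * \<tau>)"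
proof -
  let ?\<Omega> = "ball (0::real^'n) R0" let ?c = "ennreal (1 / (2 * \<tau>))"
  have w: "omega_d TYPE('n) > 0" by (rule omega_d_pos)
  have c: "0 < 1 / (2 * \<tau>)" using \<tau> by simp
  have sq: "?c * (ennreal a)\<^sup>2 = ennreal (a\<^sup>2 / (2 * \<tau>))" if "0 \<le> a" for a
    unfolding ennreal_power[OF that] using c by (subst ennreal_mult[symmetric]) auto
  have yL: "y \<in> L1cp ?\<Omega>"
    and ymin: "\<And>z. z \<in> L1cp ?\<Omega> \<Longrightarrow> Wbar ?\<Omega> y + ?c * (L1dist y x)\<^sup>2 \<le> Wbar ?\<Omega> z + ?c * (L1dist z x)\<^sup>2"
    using step by (auto simp: MM_step_def)
  have y_int: "integrable lborel y" using yL by (simp add: L1cp_def)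
  have y_out: "AE z in lborel. z \<notin> ?\<Omega> \<longrightarrow> y z = 0"
  proof -
    obtain K where "K \<subseteq> ?\<Omega>" "AE z in lborel. z \<notin> K \<longrightarrow> y z = 0"
      using yL by (auto simp: L1cp_def)
    then show ?thesis by (auto elim!: eventually_mono)
  qed
  have [measurable]: "y \<in> borel_measurable borel" using borel_measurable_integrable[OF y_int] by simp
  have comp: "Wbar ?\<Omega> y + ?c * (L1dist y x)\<^sup>2 \<le> ennreal (omega_d TYPE('n) * s + (gap s l)\<^sup>2 / (2 * \<tau>))"
    if s: "0 \<le> s" "s \<le> l" for s
  proof -
    have "Wbar ?\<Omega> y + ?c * (L1dist y x)\<^sup>2 \<le> Wbar ?\<Omega> (\<lambda>z. min (u0 z) s) + ?c * (L1dist (\<lambda>z. min (u0 z) s) x)\<^sup>2"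
      by (rule ymin[OF min_L1cp[OF s(1)]])
    also have "L1dist (\<lambda>z. min (u0 z) s) x = ennreal (gap s l)"
      using s x by (intro L1dist_min) auto
    also have "Wbar ?\<Omega> (\<lambda>z. min (u0 z) s) + ?c * (ennreal (gap s l))\<^sup>2 \<le> ennreal (omega_d TYPE('n) * s) + ?c * (ennreal (gap s l))\<^sup>2"
      by (intro add_right_mono Wbar_min_le[OF dim s(1) u0_measurable nonneg R1 supp rad])
    also have "\<dots> = ennreal (omega_d TYPE('n) * s + (gap s l)\<^sup>2 / (2 * \<tau>))"
      unfolding sq[OF gap_nonneg[OF s]] using w s \<tau> by (simp add: ennreal_plus)
    finally show ?thesis .
  qed
  \<comment> \<open>The candidate level is read off from the energy and not from the supremum of
    \<open>y\<close>; both finiteness claims follow from comparison with the truncation at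
    0.\<close>
  define m where "m = enn2real (Wbar ?\<Omega> y) / omega_d TYPE('n)"
  define D where "D = enn2real (L1dist y x)"
  have fin: "Wbar ?\<Omega> y + ?c * (L1dist y x)\<^sup>2 < \<infinity>"
    by (rule le_less_trans[OF comp[OF order_refl l]]) simp
  have Wm: "Wbar ?\<Omega> y = ennreal (omega_d TYPE('n) * m)"
    using fin w by (simp add: m_def ennreal_enn2real_if less_top)
  have m0: "0 \<le> m" using w by (simp add: m_def)
  have "L1dist y x \<noteq> \<infinity>"
  proof
    assume "L1dist y x = \<infinity>"
    then have "?c * (L1dist y x)\<^sup>2 = \<infinity>" using c by (simp add: power2_eq_square ennreal_mult_top)
    then show False using fin by simp
  qed
  then have DD: "L1dist y x = ennreal D" by (simp add: D_def ennreal_enn2real_if less_top)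
  have D0: "0 \<le> D" by (simp add: D_def)
  have comp': "omega_d TYPE('n) * m + D\<^sup>2 / (2 * \<tau>) \<le> omega_d TYPE('n) * s + (gap s l)\<^sup>2 / (2 * \<tau>)" if s: "0 \<le> s" "s \<le> l" for s
  proof -
    have "ennreal (omega_d TYPE('n) * m + D\<^sup>2 / (2 * \<tau>)) \<le> ennreal (omega_d TYPE('n) * s + (gap s l)\<^sup>2 / (2 * \<tau>))"
      using comp[OF s] w m0 \<tau> by (simp add: Wm DD sq[OF D0] ennreal_plus)
    moreover have "0 \<le> omega_d TYPE('n) * s + (gap s l)\<^sup>2 / (2 * \<tau>)" using w s \<tau> by simp
    ultimately show ?thesis by (rule ennreal_le_iff[THEN iffD1, rotated])
  qed
  have "gap l l = 0" by (simp add: gap_def)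
  then have "omega_d TYPE('n) * m + D\<^sup>2 / (2 * \<tau>) \<le> omega_d TYPE('n) * l" using comp'[OF l order_refl] by simp
  moreover have "0 \<le> D\<^sup>2 / (2 * \<tau>)" using \<tau> by simp
  ultimately have "omega_d TYPE('n) * m \<le> omega_d TYPE('n) * l" by linarith
  then have ml: "m \<le> l" using w by simp
  \<comment> \<open>The energy bound on the supremum needs a strict inequality; the slack is removed
    by intersecting countably many almost-everywhere statements.\<close>
  have yk: "AE z in lborel. z \<in> ?\<Omega> \<longrightarrow> y z \<le> m + 1 / real (Suc k)" for k
  proof (rule AE_le_if_Wbar_less)
    show "Wbar ?\<Omega> y < ennreal (omega_d TYPE('n) * (m + 1 / real (Suc k)))"
      unfolding Wm using w m0 by (intro ennreal_lessI mult_strict_left_mono) (auto simp: add_nonneg_pos)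
  qed (use m0 in auto)
  have "AE z in lborel. \<forall>k. z \<in> ?\<Omega> \<longrightarrow> y z \<le> m + 1 / real (Suc k)"
    unfolding AE_all_countable using yk by blast
  then have ym: "AE z in lborel. y z \<le> m"
    using y_out
  proof eventually_elim
    case (elim z)
    show ?case
    proof (cases "z \<in> ?\<Omega>")
      case True
      have "(\<lambda>k. m + 1 / real (Suc k)) \<longlonglongrightarrow> m + 0"
        by (intro tendsto_intros LIMSEQ_Suc lim_1_over_n)
      then show ?thesis using elim(1) True by (intro LIMSEQ_le_const[of _ "m"]) auto
    qed (use elim m0 in auto)
  qed
  have "D \<le> gap m l"
  proof -
    have "D\<^sup>2 / (2 * \<tau>) \<le> (gap m l)\<^sup>2 / (2 * \<tau>)" using comp'[OF m0 ml] by simp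
    then have "D\<^sup>2 \<le> (gap m l)\<^sup>2" using \<tau> by (simp add: divide_le_cancel)
    then show ?thesis using gap_nonneg[OF m0 ml] by (rule power2_le_imp_le)
  qed
  \<comment> \<open>Pointwise optimality of the truncation at m under y \<le> m. As the integrals
    are ordered the other way, equality holds almost everywhere, and together with y \<le> m it
    determines y.\<close>
  have pw: "AE z in lborel. min (u0 z) l - min (u0 z) m \<le> \<bar>y z - min (u0 z) l\<bar>"
    using ym by eventually_elim (use ml in \<open>auto simp: min_def abs_if\<close>)
  have int1: "integrable lborel (\<lambda>z. \<bar>y z - min (u0 z) l\<bar>)"
    using y_int min_integrable[OF l] by (intro integrable_abs Bochner_Integration.integrable_diff)
  have int2: "integrable lborel (\<lambda>z. min (u0 z) l - min (u0 z) m)"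
    using min_integrable l m0 by (intro Bochner_Integration.integrable_diff) auto
  have "ennreal D = (\<integral>\<^sup>+z. ennreal \<bar>y z - min (u0 z) l\<bar> \<partial>lborel)"
    unfolding DD[symmetric] L1dist_def
    by (rule nn_integral_cong_AE) (use x in \<open>auto elim!: eventually_mono\<close>)
  also have "\<dots> = ennreal (\<integral>z. \<bar>y z - min (u0 z) l\<bar> \<partial>lborel)"
    by (rule nn_integral_eq_integral[OF int1]) simp
  finally have Deq: "D = (\<integral>z. \<bar>y z - min (u0 z) l\<bar> \<partial>lborel)" using D0 by simp
  have "(\<integral>z. \<bar>y z - min (u0 z) l\<bar> - (min (u0 z) l - min (u0 z) m) \<partial>lborel) = D - gap m l"
    unfolding Deq gap_def by (rule Bochner_Integration.integral_diff[OF int1 int2])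
  also have "\<dots> \<le> 0" using \<open>D \<le> gap m l\<close> by simp
  finally have le0: "(\<integral>z. \<bar>y z - min (u0 z) l\<bar> - (min (u0 z) l - min (u0 z) m) \<partial>lborel) \<le> 0" .
  have pw': "AE z in lborel. 0 \<le> \<bar>y z - min (u0 z) l\<bar> - (min (u0 z) l - min (u0 z) m)"
    using pw by eventually_elim simp
  have "(\<integral>z. \<bar>y z - min (u0 z) l\<bar> - (min (u0 z) l - min (u0 z) m) \<partial>lborel) = 0"
    using le0 integral_nonneg_AE[OF pw'] by simp
  then have "AE z in lborel. \<bar>y z - min (u0 z) l\<bar> - (min (u0 z) l - min (u0 z) m) = 0"
    using integral_nonneg_eq_0_iff_AE[OF Bochner_Integration.integrable_diff[OF int1 int2] pw'] by simp
  then have yeq: "AE z in lborel. y z = min (u0 z) m"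
    using ym by eventually_elim (use ml in \<open>auto simp: min_def abs_if split: if_splits\<close>)
  then have "ennreal D = ennreal (gap m l)"
    unfolding DD[symmetric] using x m0 ml by (intro L1dist_min) auto
  then have "D = gap m l" using D0 gap_nonneg[OF m0 ml] by simp
  then show ?thesis using that[OF m0 ml yeq] comp' by simp
qed

text \<open>Compare with s slightly above m, factor the difference of squared gaps, divide by s - m
  and let s decrease to m. All superlevel sets involved have at least the area at l, which gives the
  bound without differentiating the gap.\<close>

lemma minimizer_upper:
  assumes m: "0 \<le> m" "m \<le> l" and \<tau>: "0 < \<tau>" and l: "0 < l"
    and opt: "\<And>s. 0 \<le> s \<Longrightarrow> s \<le> l \<Longrightarrow> omega_d TYPE('n) * m + (gap m l)\<^sup>2 / (2 * \<tau>) \<le> omega_d TYPE('n) * s + (gap s l)\<^sup>2 / (2 * \<tau>)"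
  shows "(area l)\<^sup>2 * (l - m) \<le> \<tau> * omega_d TYPE('n)"
proof (cases "m = l")
  case True then show ?thesis using \<tau> omega_d_pos[where 'n='n] by simp
next
  case False
  then have ml: "m < l" using m by simp
  have *: "(area l)\<^sup>2 * (2 * l - m - s) \<le> 2 * \<tau> * omega_d TYPE('n)" if s: "m < s" "s \<le> l" for s
  proof -
    have "(gap m l)\<^sup>2 - (gap s l)\<^sup>2 \<le> 2 * \<tau> * (omega_d TYPE('n) * (s - m))"
      using opt[of s] s m unfolding add_quotient_le_iff[OF \<tau>] right_diff_distrib[of "omega_d TYPE('n)"] by simp
    also have "(gap m l)\<^sup>2 - (gap s l)\<^sup>2 = gap m s * (gap m l + gap s l)"
      using gap_add[of m s l] s m by (simp add: power2_eq_square algebra_simps)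
    finally have 1: "gap m s * (gap m l + gap s l) \<le> 2 * \<tau> * (omega_d TYPE('n) * (s - m))" .
    have "(s - m) * area l \<le> (s - m) * area s"
      using s m area_antimono[of s l] by (intro mult_left_mono) auto
    also have "\<dots> \<le> gap m s" using s m by (intro gap_ge) auto
    finally have 2: "(s - m) * area l \<le> gap m s" .
    have 3: "(l - m) * area l + (l - s) * area l \<le> gap m l + gap s l"
      using s m l by (intro add_mono gap_ge) auto
    have "((s - m) * area l) * ((l - m) * area l + (l - s) * area l) \<le> gap m s * (gap m l + gap s l)"
      using 2 3 s m area_nonneg[of l] by (intro mult_mono) (auto intro!: add_nonneg_nonneg order_trans[OF _ 2])
    with 1 have "(s - m) * ((area l)\<^sup>2 * (2 * l - m - s)) \<le> (s - m) * (2 * \<tau> * omega_d TYPE('n))"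
      by (simp add: power2_eq_square algebra_simps)
    then show ?thesis using s by simp
  qed
  have "((\<lambda>s. (area l)\<^sup>2 * (2 * l - m - s)) \<longlongrightarrow> (area l)\<^sup>2 * (2 * l - m - m)) (at_right m)"
    by (intro tendsto_intros)
  moreover have "\<forall>\<^sub>F s in at_right m. (area l)\<^sup>2 * (2 * l - m - s) \<le> 2 * \<tau> * omega_d TYPE('n)"
    using eventually_at_right_less[of m] eventually_at_right_real[OF ml]
    by eventually_elim (use * in auto)
  ultimately have "(area l)\<^sup>2 * (2 * l - m - m) \<le> 2 * \<tau> * omega_d TYPE('n)"
    by (rule tendsto_upperbound) simp
  then show ?thesis by (simp add: algebra_simps)
qed

text \<open>The same comparison with s increasing to m. It needs room below m, hence 0 < a < m: once
  the minimiser has reached 0, it cannot be lowered any further.\<close>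

lemma minimizer_lower:
  assumes m: "m \<le> l" and \<tau>: "0 < \<tau>" and a: "0 < a" "a < m"
    and opt: "\<And>s. 0 \<le> s \<Longrightarrow> s \<le> l \<Longrightarrow> omega_d TYPE('n) * m + (gap m l)\<^sup>2 / (2 * \<tau>) \<le> omega_d TYPE('n) * s + (gap s l)\<^sup>2 / (2 * \<tau>)"
  shows "\<tau> * omega_d TYPE('n) \<le> (area a)\<^sup>2 * (l - m)"
proof -
  have *: "2 * \<tau> * omega_d TYPE('n) \<le> (area a)\<^sup>2 * (2 * l - m - s)" if s: "a < s" "s < m" for s
  proof -
    have "2 * \<tau> * (omega_d TYPE('n) * (m - s)) \<le> (gap s l)\<^sup>2 - (gap m l)\<^sup>2"
    proof -
      have "(gap m l)\<^sup>2 - (gap s l)\<^sup>2 \<le> 2 * \<tau> * (omega_d TYPE('n) * s - omega_d TYPE('n) * m)"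
        using opt[of s] s m a unfolding add_quotient_le_iff[OF \<tau>] by simp
      also have "\<dots> = - (2 * \<tau> * (omega_d TYPE('n) * (m - s)))" by (simp add: algebra_simps)
      finally show ?thesis by linarith
    qed
    also have "(gap s l)\<^sup>2 - (gap m l)\<^sup>2 = gap s m * (gap s l + gap m l)"
      using gap_add[of s m l] s m a by (simp add: power2_eq_square algebra_simps)
    also have "\<dots> \<le> ((m - s) * area a) * ((l - s) * area a + (l - m) * area a)"
    proof -
      have up: "gap p q \<le> (q - p) * area a" if "a < p" "p \<le> q" for p q
        using gap_le[of p q] area_antimono[of a p] that a
        by (intro order_trans[OF gap_le[of p q] mult_left_mono]) auto
      show ?thesis
        using s m a area_nonneg[of a] by (intro mult_mono add_mono up) (auto intro!: add_nonneg_nonneg gap_nonneg)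
    qed
    finally have "(m - s) * (2 * \<tau> * omega_d TYPE('n)) \<le> (m - s) * ((area a)\<^sup>2 * (2 * l - m - s))"
      by (simp add: power2_eq_square algebra_simps)
    then show ?thesis using s by simp
  qed
  have "((\<lambda>s. (area a)\<^sup>2 * (2 * l - m - s)) \<longlongrightarrow> (area a)\<^sup>2 * (2 * l - m - m)) (at_left m)"
    by (intro tendsto_intros)
  moreover have "\<forall>\<^sub>F s in at_left m. 2 * \<tau> * omega_d TYPE('n) \<le> (area a)\<^sup>2 * (2 * l - m - s)"
    using eventually_at_left_real[OF a(2)] by eventually_elim (use * in auto)
  ultimately have "2 * \<tau> * omega_d TYPE('n) \<le> (area a)\<^sup>2 * (2 * l - m - m)"
    by (rule tendsto_lowerbound) simp
  then show ?thesis by (simp add: algebra_simps)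
qed

end

section \<open>Levels of the discrete scheme and their limit\<close>

lemma levels_antimono:
  fixes l :: "nat \<Rightarrow> real"
  assumes "\<And>n. l (Suc n) \<le> l n" "n \<le> k"
  shows "l k \<le> l n"
  using assms(2) by (induction rule: dec_induct) (auto intro: order_trans[OF assms(1)])

lemma step_time_tendsto:
  fixes \<tau> :: "nat \<Rightarrow> real"
  assumes \<tau>: "\<And>i. 0 < \<tau> i" "\<tau> \<longlonglongrightarrow> 0" and t: "0 \<le> t"
  shows "(\<lambda>i. real (nat \<lfloor>t / \<tau> i\<rfloor>) * \<tau> i) \<longlonglongrightarrow> t"
proof (rule tendsto_sandwich[of "\<lambda>i. t - \<tau> i" _ _ "\<lambda>_. t"])
  have bounds: "t - \<tau> i \<le> real (nat \<lfloor>t / \<tau> i\<rfloor>) * \<tau> i \<and> real (nat \<lfloor>t / \<tau> i\<rfloor>) * \<tau> i \<le> t" for i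
  proof -
    have z: "0 \<le> t / \<tau> i" using t \<tau>(1)[of i] by simp
    have zt: "t / \<tau> i * \<tau> i = t" using \<tau>(1)[of i] by simp
    have "real (nat \<lfloor>t / \<tau> i\<rfloor>) \<le> t / \<tau> i" "t / \<tau> i - 1 \<le> real (nat \<lfloor>t / \<tau> i\<rfloor>)"
      using z of_nat_floor[OF z] real_of_int_floor_add_one_ge[of "t / \<tau> i"] by simp_all
    then have "real (nat \<lfloor>t / \<tau> i\<rfloor>) * \<tau> i \<le> t / \<tau> i * \<tau> i" "(t / \<tau> i - 1) * \<tau> i \<le> real (nat \<lfloor>t / \<tau> i\<rfloor>) * \<tau> i"
      using \<tau>(1)[of i] by (intro mult_right_mono; simp)+
    then show ?thesis unfolding zt left_diff_distrib by simp
  qed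
  then show "\<forall>\<^sub>F i in sequentially. t - \<tau> i \<le> real (nat \<lfloor>t / \<tau> i\<rfloor>) * \<tau> i"
    "\<forall>\<^sub>F i in sequentially. real (nat \<lfloor>t / \<tau> i\<rfloor>) * \<tau> i \<le> t" by auto
  have "(\<lambda>i. t - \<tau> i) \<longlonglongrightarrow> t - 0" by (intro tendsto_intros \<tau>)
  then show "(\<lambda>i. t - \<tau> i) \<longlonglongrightarrow> t" by simp
qed simp

context radial_datum
begin

lemma scheme_levels:
  assumes X: "disc_scheme (ball 0 R0) \<tau> u0 X" and \<tau>: "0 < \<tau>" and M: "0 \<le> M" "AE x in lborel. u0 x \<le> M"
  obtains l where "l 0 = M" "\<And>n. 0 \<le> l n" "\<And>n. l (Suc n) \<le> l n"
    "\<And>n. AE x in lborel. X n x = min (u0 x) (l n)"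
    "\<And>n. 0 < l n \<Longrightarrow> (area (l n))\<^sup>2 * (l n - l (Suc n)) \<le> \<tau> * omega_d TYPE('n)"
    "\<And>n a. 0 < a \<Longrightarrow> a < l (Suc n) \<Longrightarrow> \<tau> * omega_d TYPE('n) \<le> (area a)\<^sup>2 * (l n - l (Suc n))"
proof -
  \<comment> \<open>The clause for n = 0 pins the initial level to \<open>M\<close>; the choice
    principle alone would return some level representing \<open>u0\<close>.\<close>
  define P where "P n m \<longleftrightarrow> 0 \<le> m \<and> (AE x in lborel. X n x = min (u0 x) m) \<and> (n = 0 \<longrightarrow> m = M)" for n m
  define Q where "Q (n::nat) l m \<longleftrightarrow> m \<le> l \<and> (0 < l \<longrightarrow> (area l)\<^sup>2 * (l - m) \<le> \<tau> * omega_d TYPE('n)) \<and>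
     (\<forall>a. 0 < a \<longrightarrow> a < m \<longrightarrow> \<tau> * omega_d TYPE('n) \<le> (area a)\<^sup>2 * (l - m))" for n l m
  have "P 0 M"
    using M X by (auto simp: P_def disc_scheme_def elim!: eventually_mono)
  moreover have "\<exists>m. P (Suc n) m \<and> Q n l m" if P: "P n l" for l n
  proof -
    have st: "MM_step (ball 0 R0) \<tau> (X n) (X (Suc n))" using X by (simp add: disc_scheme_def)
    from P have "0 \<le> l" "AE z in lborel. X n z = min (u0 z) l" by (auto simp: P_def)
    from MM_step_min[OF this(1) \<tau> this(2) st] obtain m where m: "0 \<le> m" "m \<le> l" "AE z in lborel. X (Suc n) z = min (u0 z) m"
      and opt: "\<And>s. 0 \<le> s \<Longrightarrow> s \<le> l \<Longrightarrow> omega_d TYPE('n) * m + (gap m l)\<^sup>2 / (2 * \<tau>) \<le> omega_d TYPE('n) * s + (gap s l)\<^sup>2 / (2 * \<tau>)"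
      by blast
    have "Q n l m"
      unfolding Q_def using m minimizer_upper[OF m(1,2) \<tau> _ opt] minimizer_lower[OF m(2) \<tau> _ _ opt] by blast
    then show ?thesis using m by (auto simp: P_def)
  qed
  ultimately obtain l where l: "\<And>n. P n (l n)" "\<And>n. Q n (l n) (l (Suc n))"
    using dependent_nat_choice[of P Q] by metis
  show ?thesis
    by (rule that[of l]) (use l in \<open>auto simp: P_def Q_def\<close>)
qed

text \<open>Telescoping: all levels from index n on stay below b, so their superlevel sets have at
  least the area at b. Once the level is 0 nothing moves and the step estimate is trivial.\<close>

lemma levels_upper:
  assumes l0: "\<And>n. 0 \<le> l n" and dec: "\<And>n. l (Suc n) \<le> l n"
    and up: "\<And>n. 0 < l n \<Longrightarrow> (area (l n))\<^sup>2 * (l n - l (Suc n)) \<le> \<tau> * omega_d TYPE('n)" and \<tau>: "0 < \<tau>"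
    and nk: "n \<le> k" and b: "l n \<le> b"
  shows "(area b)\<^sup>2 * (l n - l k) \<le> (real k - real n) * \<tau> * omega_d TYPE('n)"
  using nk
proof (induction rule: dec_induct)
  case (step i)
  have "(area b)\<^sup>2 * (l i - l (Suc i)) \<le> \<tau> * omega_d TYPE('n)"
  proof (cases "0 < l i")
    case True
    have "l i \<le> b" using levels_antimono[of l n i, OF dec step(1)] b by simp
    then have "(area b)\<^sup>2 \<le> (area (l i))\<^sup>2"
      using area_antimono[OF True] area_nonneg by (intro power_mono) auto
    then have "(area b)\<^sup>2 * (l i - l (Suc i)) \<le> (area (l i))\<^sup>2 * (l i - l (Suc i))"
      using dec[of i] by (intro mult_right_mono) auto
    then show ?thesis using up[OF True] by simp
  next
    case False
    then have "l i = 0" "l (Suc i) = 0" using l0[of i] l0[of "Suc i"] dec[of i] by auto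
    then show ?thesis using \<tau> omega_d_pos[where 'n='n] by simp
  qed
  then show ?case using step(3) by (simp add: algebra_simps)
qed simp

text \<open>Asking a to lie below the last level keeps it below all earlier ones, so every step
  estimate can be used with the same a.\<close>

lemma levels_lower:
  assumes dec: "\<And>n. l (Suc n) \<le> l n"
    and low: "\<And>n a. 0 < a \<Longrightarrow> a < l (Suc n) \<Longrightarrow> \<tau> * omega_d TYPE('n) \<le> (area a)\<^sup>2 * (l n - l (Suc n))"
    and nk: "n \<le> k" and a: "0 < a" "a < l k"
  shows "(real k - real n) * \<tau> * omega_d TYPE('n) \<le> (area a)\<^sup>2 * (l n - l k)"
  using nk a(2)
proof (induction rule: dec_induct)
  case (step i)
  have "a < l i" using step(4) dec[of i] by simp
  then have "(real i - real n) * \<tau> * omega_d TYPE('n) \<le> (area a)\<^sup>2 * (l n - l i)" by (rule step(3))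
  moreover have "\<tau> * omega_d TYPE('n) \<le> (area a)\<^sup>2 * (l i - l (Suc i))" by (rule low[OF a(1) step(4)])
  ultimately show ?case by (simp add: algebra_simps)
qed simp

text \<open>On the set where \<open>u0\<close> is at least M both truncations are constant, equal to
  a and b. If that set has positive measure, L1 convergence of truncations becomes convergence of
  their levels.\<close>

lemma L1dist_min_ge:
  assumes M: "0 < M" and a: "0 \<le> a" "a \<le> M" and b: "0 \<le> b" "b \<le> M"
    and y: "AE x in lborel. y x = min (u0 x) a"
  shows "ennreal (\<bar>a - b\<bar> * area M) \<le> L1dist y (\<lambda>x. min (u0 x) b)"
proof -
  have le: "(q - p) * area M \<le> gap p q" if "0 \<le> p" "p \<le> q" "q \<le> M" for p q
  proof (cases "q = 0")
    case False
    then have "(q - p) * area M \<le> (q - p) * area q"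
      using that by (intro mult_left_mono area_antimono) auto
    also have "\<dots> \<le> gap p q" using that False by (intro gap_ge) auto
    finally show ?thesis .
  next
    case True
    then have "p = 0" using that by simp
    then show ?thesis using True by (simp add: gap_def)
  qed
  show ?thesis
  proof (cases "a \<le> b")
    case True
    have "L1dist y (\<lambda>x. min (u0 x) b) = ennreal (gap a b)"
      using a True y by (intro L1dist_min) auto
    then show ?thesis using le[of a b] True a b by (simp add: ennreal_leI)
  next
    case False
    have "L1dist y (\<lambda>x. min (u0 x) b) = L1dist (\<lambda>x. min (u0 x) b) y"
      unfolding L1dist_def by (simp add: abs_minus_commute)
    also have "\<dots> = ennreal (gap b a)"
      using b False y by (intro L1dist_min) auto
    finally show ?thesis using le[of b a] False a b by (simp add: ennreal_leI)
  qed
qed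

text \<open>The levels at step [t / tau] converge to \<open>lam t\<close>, so the telescoped
  estimates pass to the limit. The strict inequalities with b and a ensure that the discrete levels
  eventually satisfy them too.\<close>

lemma min_movement_bounds:
  assumes MM: "min_movement (ball 0 R0) u0 (\<lambda>t x. min (u0 x) (lam t))"
    and M: "0 < M" "AE x in lborel. u0 x \<le> M" "0 < area M"
    and lam: "\<And>t. 0 \<le> t \<Longrightarrow> 0 \<le> lam t" "\<And>t. 0 \<le> t \<Longrightarrow> lam t \<le> M"
    and st: "0 \<le> s" "s \<le> t"
  shows "lam s < b \<Longrightarrow> (area b)\<^sup>2 * (lam s - lam t) \<le> (t - s) * omega_d TYPE('n)"
    and "0 < a \<Longrightarrow> a < lam t \<Longrightarrow> (t - s) * omega_d TYPE('n) \<le> (area a)\<^sup>2 * (lam s - lam t)"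
proof -
  obtain \<tau> X where \<tau>: "\<And>i. 0 < \<tau> i" "\<tau> \<longlonglongrightarrow> 0" and X: "\<And>i. disc_scheme (ball 0 R0) (\<tau> i) u0 (X i)"
    and conv: "(\<lambda>i. SUP t\<in>{0..}. L1dist (X i (nat \<lfloor>t / \<tau> i\<rfloor>)) (\<lambda>x. min (u0 x) (lam t))) \<longlonglongrightarrow> 0"
    using MM unfolding min_movement_def by blast
  define lev where "lev i l \<longleftrightarrow> l 0 = M \<and> (\<forall>n. 0 \<le> l n) \<and> (\<forall>n. l (Suc n) \<le> l n) \<and>
    (\<forall>n. AE x in lborel. X i n x = min (u0 x) (l n)) \<and>
    (\<forall>n. 0 < l n \<longrightarrow> (area (l n))\<^sup>2 * (l n - l (Suc n)) \<le> \<tau> i * omega_d TYPE('n)) \<and>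
    (\<forall>n a. 0 < a \<longrightarrow> a < l (Suc n) \<longrightarrow> \<tau> i * omega_d TYPE('n) \<le> (area a)\<^sup>2 * (l n - l (Suc n)))"
    for i and l :: "nat \<Rightarrow> real"
  have "\<exists>l. lev i l" for i
    unfolding lev_def by (rule scheme_levels[OF X[of i] \<tau>(1) less_imp_le[OF M(1)] M(2)]) blast
  then obtain l where lev: "\<And>i. lev i (l i)" by metis
  have l: "l i 0 = M" "0 \<le> l i n" "l i (Suc n) \<le> l i n" "AE x in lborel. X i n x = min (u0 x) (l i n)"
     "0 < l i n \<Longrightarrow> (area (l i n))\<^sup>2 * (l i n - l i (Suc n)) \<le> \<tau> i * omega_d TYPE('n)"
     "0 < a \<Longrightarrow> a < l i (Suc n) \<Longrightarrow> \<tau> i * omega_d TYPE('n) \<le> (area a)\<^sup>2 * (l i n - l i (Suc n))" for i n a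
    using lev[of i] unfolding lev_def by blast+
  define N where "N r i = nat \<lfloor>r / \<tau> i\<rfloor>" for r i
  have lM: "l i n \<le> M" for i n
    using levels_antimono[of "l i" 0 n] l(1,3) by simp
  have lim: "(\<lambda>i. l i (N r i)) \<longlonglongrightarrow> lam r" if r: "0 \<le> r" for r
  proof -
    have le: "ennreal (\<bar>l i (N r i) - lam r\<bar> * area M) \<le> (SUP t\<in>{0..}. L1dist (X i (nat \<lfloor>t / \<tau> i\<rfloor>)) (\<lambda>x. min (u0 x) (lam t)))" for i
    proof -
      have "ennreal (\<bar>l i (N r i) - lam r\<bar> * area M) \<le> L1dist (X i (N r i)) (\<lambda>x. min (u0 x) (lam r))"
        using l lM lam r by (intro L1dist_min_ge[OF M(1)]) auto
      also have "\<dots> \<le> (SUP t\<in>{0..}. L1dist (X i (nat \<lfloor>t / \<tau> i\<rfloor>)) (\<lambda>x. min (u0 x) (lam t)))"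
        unfolding N_def using r by (intro SUP_upper) simp
      finally show ?thesis .
    qed
    have "(\<lambda>i. ennreal (\<bar>l i (N r i) - lam r\<bar> * area M)) \<longlonglongrightarrow> 0"
      by (rule tendsto_sandwich[OF _ _ tendsto_const conv]) (use le in auto)
    then have "(\<lambda>i. \<bar>l i (N r i) - lam r\<bar> * area M) \<longlonglongrightarrow> 0"
      using area_nonneg by (subst (asm) ennreal_tendsto_0_iff) auto
    then have "(\<lambda>i. \<bar>l i (N r i) - lam r\<bar> * area M / area M) \<longlonglongrightarrow> 0 / area M"
      using M(3) by (intro tendsto_divide tendsto_const) auto
    then have "(\<lambda>i. \<bar>l i (N r i) - lam r\<bar>) \<longlonglongrightarrow> 0" using M(3) by simp
    then show ?thesis by (simp add: tendsto_rabs_zero_iff LIM_zero_iff)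
  qed
  have t0: "0 \<le> t" using st by simp
  have Nle: "N s i \<le> N t i" for i
    unfolding N_def using st \<tau>(1)[of i] by (intro nat_mono floor_mono divide_right_mono) auto
  have time: "(\<lambda>i. (real (N t i) - real (N s i)) * \<tau> i * omega_d TYPE('n)) \<longlonglongrightarrow> (t - s) * omega_d TYPE('n)"
    unfolding left_diff_distrib[of _ _ "\<tau> _"] N_def
    by (intro tendsto_intros step_time_tendsto \<tau> st t0)
  have diff: "(\<lambda>i. (area c)\<^sup>2 * (l i (N s i) - l i (N t i))) \<longlonglongrightarrow> (area c)\<^sup>2 * (lam s - lam t)" for c
    by (intro tendsto_intros lim st t0)
  show "(area b)\<^sup>2 * (lam s - lam t) \<le> (t - s) * omega_d TYPE('n)" if b: "lam s < b"
  proof (rule tendsto_le[OF sequentially_bot time diff])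
    have "\<forall>\<^sub>F i in sequentially. l i (N s i) < b" by (rule order_tendstoD(2)[OF lim[OF st(1)] b])
    then show "\<forall>\<^sub>F i in sequentially. (area b)\<^sup>2 * (l i (N s i) - l i (N t i)) \<le> (real (N t i) - real (N s i)) * \<tau> i * omega_d TYPE('n)"
    proof eventually_elim
      case (elim i)
      show ?case
        by (rule levels_upper[where l="l i" and \<tau>="\<tau> i"]) (use elim l(2,3,5) \<tau>(1) Nle in auto)
    qed
  qed
  show "(t - s) * omega_d TYPE('n) \<le> (area a)\<^sup>2 * (lam s - lam t)" if a: "0 < a" "a < lam t"
  proof (rule tendsto_le[OF sequentially_bot diff time])
    have "\<forall>\<^sub>F i in sequentially. a < l i (N t i)" by (rule order_tendstoD(1)[OF lim[OF t0] a(2)])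
    then show "\<forall>\<^sub>F i in sequentially. (real (N t i) - real (N s i)) * \<tau> i * omega_d TYPE('n) \<le> (area a)\<^sup>2 * (l i (N s i) - l i (N t i))"
    proof eventually_elim
      case (elim i)
      show ?case
        by (rule levels_lower[where l="l i" and \<tau>="\<tau> i"]) (use elim l(3,6) a(1) Nle in auto)
    qed
  qed
qed

end

section \<open>Radii of superlevel sets at every positive level\<close>

lemma AE_lborel_ex_between:
  fixes a b :: real
  assumes "AE t in lborel. P t" "a < b"
  shows "\<exists>t. a < t \<and> t < b \<and> P t"
proof (rule ccontr)
  assume none: "\<nexists>t. a < t \<and> t < b \<and> P t"
  have "AE t in lborel. t \<notin> {a<..<b}" using assms(1) by eventually_elim (use none in auto)
  then have "{a<..<b} \<in> null_sets lborel" by (subst AE_iff_null_sets) auto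
  then show False using assms(2) by (simp add: null_sets_def)
qed

text \<open>The hypothesis covers almost every level only. A given level t is the limit from below
  of good levels, and its superlevel set is the intersection of theirs: a ball whose radius is the
  left limit of r, which may exceed r t.\<close>

lemma radial_noninc_superlevel:
  fixes u :: "real^'n::finite \<Rightarrow> real"
  assumes rad: "radial_noninc u r" and anti: "antimono r" and t: "0 < t"
  shows "\<exists>\<rho>. superlevel_radius u t \<rho> \<and> r t \<le> \<rho> \<and> (\<forall>a<t. \<rho> \<le> r a)"
proof -
  have r0: "0 \<le> r s" for s using rad by (simp add: radial_noninc_def)
  have good: "AE s in lborel. 0 < s \<longrightarrow> (AE x in lborel. s \<le> u x \<longleftrightarrow> norm x \<le> r s)"
  proof -
    have "AE s in lborel. 0 < s \<longrightarrow> ({x. s \<le> u x} - cball 0 (r s)) \<union> (cball 0 (r s) - {x. s \<le> u x}) \<in> null_sets lborel"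
      using rad by (simp add: radial_noninc_def)
    then show ?thesis
    proof eventually_elim
      case (elim s)
      show ?case
      proof
        assume "0 < s"
        with elim have "({x. s \<le> u x} - cball 0 (r s)) \<union> (cball 0 (r s) - {x. s \<le> u x}) \<in> null_sets lborel" by blast
        from AE_not_in[OF this] show "AE x in lborel. s \<le> u x \<longleftrightarrow> norm x \<le> r s"
          by eventually_elim auto
      qed
    qed
  qed
  have "\<exists>s. max 0 (t - 1 / real (Suc j)) < s \<and> s < t \<and> (0 < s \<longrightarrow> (AE x in lborel. s \<le> u x \<longleftrightarrow> norm x \<le> r s))" for j
    using t by (intro AE_lborel_ex_between[OF good]) simp
  then obtain S where S: "\<And>j. max 0 (t - 1 / real (Suc j)) < S j" "\<And>j. S j < t"
    "\<And>j. 0 < S j \<longrightarrow> (AE x in lborel. S j \<le> u x \<longleftrightarrow> norm x \<le> r (S j))"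
    by metis
  have near: "\<exists>j. a < S j" if "a < t" for a
  proof -
    have "0 < t - a" using that by simp
    then obtain j where "1 / real (Suc j) < t - a" by (rule nat_approx_posE)
    then show ?thesis using S(1)[of j] by (intro exI[of _ j]) auto
  qed
  define \<rho> where "\<rho> = Inf (r ` {..<t})"
  have bdd: "bdd_below (r ` {..<t})" using r0 by (auto intro: bdd_belowI[of _ 0])
  have ne: "r ` {..<t} \<noteq> {}" by auto
  have low: "\<rho> \<le> r a" if "a < t" for a
    unfolding \<rho>_def using that by (intro cInf_lower[OF _ bdd]) auto
  have great: "c \<le> \<rho>" if "\<And>a. a < t \<Longrightarrow> c \<le> r a" for c
    unfolding \<rho>_def using that by (intro cInf_greatest[OF ne]) auto
  have "AE x in lborel. \<forall>j. S j \<le> u x \<longleftrightarrow> norm x \<le> r (S j)"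
    unfolding AE_all_countable using S(1,3) by (meson max_less_iff_conj)
  then have "AE x in lborel. t \<le> u x \<longleftrightarrow> norm x \<le> \<rho>"
  proof eventually_elim
    case (elim x)
    have "t \<le> u x \<longleftrightarrow> (\<forall>j. S j \<le> u x)"
    proof
      assume "\<forall>j. S j \<le> u x"
      then show "t \<le> u x" using near[of "u x"] by (meson leD leI)
    qed (use S(2) in \<open>auto intro: less_imp_le order_trans\<close>)
    also have "\<dots> \<longleftrightarrow> (\<forall>j. norm x \<le> r (S j))" using elim by simp
    also have "\<dots> \<longleftrightarrow> norm x \<le> \<rho>"
    proof
      assume *: "\<forall>j. norm x \<le> r (S j)"
      show "norm x \<le> \<rho>"
      proof (rule great)
        fix a assume "a < t"
        then obtain j where "a < S j" using near by blast
        then have "r (S j) \<le> r a" using anti by (simp add: antimonoD)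
        then show "norm x \<le> r a" using * by (meson order_trans)
      qed
    next
      assume "norm x \<le> \<rho>"
      then show "\<forall>j. norm x \<le> r (S j)" using low S(2) order_trans by blast
    qed
    finally show ?case .
  qed
  moreover have "0 \<le> \<rho>" using r0 by (intro great)
  moreover have "r t \<le> \<rho>" using anti by (intro great) (simp add: antimonoD)
  ultimately show ?thesis using low by (auto simp: superlevel_radius_def)
qed

section \<open>Difference quotients\<close>

lemma eventually_at_within_nonneg_shift:
  fixes t :: real
  assumes ev: "\<forall>\<^sub>F y in at t within {0..}. P y" and t: "0 \<le> t"
  shows "\<forall>\<^sub>F e in at_right 0. P (t + e)" and "0 < t \<Longrightarrow> \<forall>\<^sub>F e in at_left 0. P (t + e)"
proof -
  obtain d where d: "0 < d" "\<And>y. 0 \<le> y \<Longrightarrow> y \<noteq> t \<Longrightarrow> \<bar>y - t\<bar> < d \<Longrightarrow> P y"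
    using ev by (auto simp: eventually_at dist_real_def)
  have "P (t + e)" if "e \<noteq> 0" "\<bar>e\<bar> < d" "- t \<le> e" for e
    using d(2)[of "t + e"] that by simp
  note P = this
  show "\<forall>\<^sub>F e in at_right 0. P (t + e)"
    using eventually_at_right_real[OF d(1)] by eventually_elim (rule P, use t in auto)
  show "\<forall>\<^sub>F e in at_left 0. P (t + e)" if "0 < t"
  proof -
    have "- min t d < 0" using that d(1) by simp
    from eventually_at_left_real[OF this] show ?thesis by eventually_elim (rule P, auto)
  qed
qed

lemma antimono_tendsto_at_left:
  fixes r :: "real \<Rightarrow> real"
  assumes "antimono r" "\<And>s. 0 \<le> r s"
  shows "(r \<longlongrightarrow> Inf (r ` {..<x})) (at_left x)" and "r x \<le> Inf (r ` {..<x})"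
proof -
  have bdd: "bdd_below (r ` {..<x})" using assms(2) by (auto intro: bdd_belowI[of _ 0])
  show "(r \<longlongrightarrow> Inf (r ` {..<x})) (at_left x)"
  proof (rule order_tendstoI)
    fix a assume "a < Inf (r ` {..<x})"
    then have "a < r s" if "s < x" for s
      using cInf_lower[OF _ bdd, of "r s"] that by fastforce
    then show "\<forall>\<^sub>F s in at_left x. a < r s" by (auto simp: eventually_at_filter)
  next
    fix a assume "Inf (r ` {..<x}) < a"
    then obtain s0 where s0: "s0 < x" "r s0 < a" using cInf_lessD[of "r ` {..<x}"] by auto
    from eventually_at_left_real[OF s0(1)] show "\<forall>\<^sub>F s in at_left x. r s < a"
    proof eventually_elim
      case (elim s)
      then have "r s \<le> r s0" using assms(1) by (auto intro: antimonoD)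
      then show ?case using s0 by simp
    qed
  qed
  show "r x \<le> Inf (r ` {..<x})"
    using assms(1) by (intro cInf_greatest) (auto intro: antimonoD)
qed

lemma antimono_tendsto_at_right:
  fixes r :: "real \<Rightarrow> real"
  assumes "antimono r"
  shows "(r \<longlongrightarrow> Sup (r ` {x<..})) (at_right x)"
proof -
  have bdd: "bdd_above (r ` {x<..})" using assms by (auto intro!: bdd_aboveI[of _ "r x"] intro: antimonoD)
  show ?thesis
  proof (rule order_tendstoI)
    fix a assume "Sup (r ` {x<..}) < a"
    then have "r s < a" if "x < s" for s
      using cSup_upper[OF _ bdd, of "r s"] that by fastforce
    then show "\<forall>\<^sub>F s in at_right x. r s < a" by (auto simp: eventually_at_filter)
  next
    fix a assume "a < Sup (r ` {x<..})"
    then obtain s0 where s0: "x < s0" "a < r s0" using less_cSupD[of "r ` {x<..}"] by auto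
    from eventually_at_right_real[OF s0(1)] show "\<forall>\<^sub>F s in at_right x. a < r s"
    proof eventually_elim
      case (elim s)
      then have "r s0 \<le> r s" using assms by (auto intro: antimonoD)
      then show ?case using s0 by simp
    qed
  qed
qed

text \<open>For y close to t continuity keeps \<open>lam y\<close> on the right side of b or a, so
  the increment bounds apply on the interval between y and t from either side of t. The comparison
  with \<open>r0 M\<close> keeps the denominators positive.\<close>

lemma difference_quotient_bounds:
  fixes lam r0 :: "real \<Rightarrow> real"
  assumes anti: "antimono r0" and r0: "\<And>s. 0 \<le> r0 s" and M: "0 < r0 M"
    and cont: "continuous_on {0..} lam"
    and up: "\<And>s t b. 0 \<le> s \<Longrightarrow> s \<le> t \<Longrightarrow> lam s < b \<Longrightarrow> b \<le> M \<Longrightarrow> r0 b ^ k * (lam s - lam t) \<le> (t - s) * c"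
    and low: "\<And>s t a. 0 \<le> s \<Longrightarrow> s \<le> t \<Longrightarrow> 0 < a \<Longrightarrow> a < lam t \<Longrightarrow> (t - s) * c \<le> r0 a ^ k * (lam s - lam t)"
    and t: "0 \<le> t" "0 < lam t"
  shows "lam t < b \<Longrightarrow> b \<le> M \<Longrightarrow> \<forall>\<^sub>F y in at t within {0..}. - (c / r0 b ^ k) \<le> (lam y - lam t) / (y - t)"
    and "lam t \<le> M \<Longrightarrow> 0 < a \<Longrightarrow> a < lam t \<Longrightarrow> \<forall>\<^sub>F y in at t within {0..}. (lam y - lam t) / (y - t) \<le> - (c / r0 a ^ k)"
proof -
  have lim: "(lam \<longlongrightarrow> lam t) (at t within {0..})"
    using cont t by (simp add: continuous_on_def)
  have dom: "\<forall>\<^sub>F y in at t within {0..}. 0 \<le> y \<and> y \<noteq> t"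
    by (simp add: eventually_at_filter)
  show "\<forall>\<^sub>F y in at t within {0..}. - (c / r0 b ^ k) \<le> (lam y - lam t) / (y - t)" if b: "lam t < b" "b \<le> M"
  proof -
    have "r0 M \<le> r0 b" using anti b by (simp add: antimonoD)
    then have rb: "0 < r0 b ^ k" using M by simp
    from order_tendstoD(2)[OF lim b(1)] dom show ?thesis
    proof eventually_elim
      case (elim y)
      show ?case
      proof (cases "t < y")
        case True
        have "r0 b ^ k * (lam t - lam y) \<le> (y - t) * c" using up[of t y b] t True b by simp
        then have "lam t - lam y \<le> (y - t) * (c / r0 b ^ k)" using rb by (simp add: pos_le_divide_eq mult.commute)
        then have "- (c / r0 b ^ k) * (y - t) \<le> lam y - lam t" by (simp add: algebra_simps del: times_divide_eq_left times_divide_eq_right)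
        then show ?thesis using True by (subst pos_le_divide_eq) simp_all
      next
        case False
        then have yt: "y < t" using elim by simp
        have "r0 b ^ k * (lam y - lam t) \<le> (t - y) * c" using up[of y t b] yt b elim by simp
        then have "lam y - lam t \<le> (t - y) * (c / r0 b ^ k)" using rb by (simp add: pos_le_divide_eq mult.commute)
        then have "lam y - lam t \<le> - (c / r0 b ^ k) * (y - t)" by (simp add: algebra_simps del: times_divide_eq_left times_divide_eq_right)
        then show ?thesis using yt by (subst neg_le_divide_eq) simp_all
      qed
    qed
  qed
  show "\<forall>\<^sub>F y in at t within {0..}. (lam y - lam t) / (y - t) \<le> - (c / r0 a ^ k)" if LM: "lam t \<le> M" and a: "0 < a" "a < lam t"
  proof -
    have "r0 M \<le> r0 a" using anti LM a by (simp add: antimonoD)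
    then have ra: "0 < r0 a ^ k" using M by simp
    from order_tendstoD(1)[OF lim a(2)] dom show ?thesis
    proof eventually_elim
      case (elim y)
      show ?case
      proof (cases "t < y")
        case True
        have "(y - t) * c \<le> r0 a ^ k * (lam t - lam y)" using low[of t y a] t True a elim by simp
        then have "(y - t) * (c / r0 a ^ k) \<le> lam t - lam y" using ra by (simp add: pos_divide_le_eq mult.commute)
        then have "lam y - lam t \<le> - (c / r0 a ^ k) * (y - t)" by (simp add: algebra_simps del: times_divide_eq_left times_divide_eq_right)
        then show ?thesis using True by (subst pos_divide_le_eq) simp_all
      next
        case False
        then have yt: "y < t" using elim by simp
        have "(t - y) * c \<le> r0 a ^ k * (lam y - lam t)" using low[of y t a] yt a elim by simp
        then have "(t - y) * (c / r0 a ^ k) \<le> lam y - lam t" using ra by (simp add: pos_divide_le_eq mult.commute)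
        then have "- (c / r0 a ^ k) * (y - t) \<le> lam y - lam t" by (simp add: algebra_simps del: times_divide_eq_left times_divide_eq_right)
        then show ?thesis using yt by (subst neg_divide_le_eq) simp_all
      qed
    qed
  qed
qed

lemma low_bd_eq:
  "r \<noteq> 0 \<Longrightarrow> low_bd TYPE('n::finite) r = ereal (- (omega_d TYPE('n) / (alpha_d TYPE('n))\<^sup>2 / r ^ (2 * CARD('n))))"
  by (simp add: low_bd_def mult.commute)

theorem theorem4p2:
  fixes u0 :: "real^'n::finite \<Rightarrow> real" and r0 :: "real \<Rightarrow> real" and R0 :: real
    and lam :: "real \<Rightarrow> real"
  assumes d2: "CARD('n) \<ge> 2"
    and R0: "R0 > 0"
    and u0_L1: "u0 \<in> L1cp (ball 0 R0)"
    and u0_bdd: "\<exists>M. AE x in lborel. \<bar>u0 x\<bar> \<le> M"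
    and u0_rad: "radial_noninc u0 r0"
    and r0_mono: "antimono r0"
    and r0_sup: "r0 (real_of_ereal (esssup lborel (\<lambda>x. ereal (u0 x)))) > 0"
    and lam_nonneg: "\<forall>t\<ge>0. lam t \<ge> 0"
    and lam_lip: "\<exists>C. C-lipschitz_on {0..} lam"
    and lam_mono: "\<forall>s t. 0 \<le> s \<longrightarrow> s \<le> t \<longrightarrow> lam t \<le> lam s"
    and lam_0: "ereal (lam 0) = esssup lborel (\<lambda>x. ereal (u0 x))"
    and lam_vanish: "\<exists>T\<ge>0. \<forall>t\<ge>T. lam t = 0"
    and lam_MM: "min_movement (ball 0 R0) u0 (\<lambda>t x. min (u0 x) (lam t))"
  shows "\<forall>t\<ge>0. lam t > 0 \<longrightarrow>
     (if isCont r0 (lam t)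
      then (lam has_real_derivative
              (- omega_d TYPE('n) / (alpha_d TYPE('n))\<^sup>2 * (1 / r0 (lam t) ^ (2 * CARD('n)))))
             (at t within {0..})
      else
        (low_bd TYPE('n) (Lim (at_right (lam t)) r0)
           \<le> Liminf (at_right 0) (\<lambda>\<epsilon>. ereal ((lam (t + \<epsilon>) - lam t) / \<epsilon>)) \<and>
         Liminf (at_right 0) (\<lambda>\<epsilon>. ereal ((lam (t + \<epsilon>) - lam t) / \<epsilon>))
           \<le> Limsup (at_right 0) (\<lambda>\<epsilon>. ereal ((lam (t + \<epsilon>) - lam t) / \<epsilon>)) \<and>
         Limsup (at_right 0) (\<lambda>\<epsilon>. ereal ((lam (t + \<epsilon>) - lam t) / \<epsilon>))
           \<le> low_bd TYPE('n) (Lim (at_left (lam t)) r0)) \<and>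
        (t > 0 \<longrightarrow>
          low_bd TYPE('n) (Lim (at_right (lam t)) r0)
             \<le> Liminf (at_left 0) (\<lambda>\<epsilon>. ereal ((lam (t + \<epsilon>) - lam t) / \<epsilon>)) \<and>
          Liminf (at_left 0) (\<lambda>\<epsilon>. ereal ((lam (t + \<epsilon>) - lam t) / \<epsilon>))
             \<le> Limsup (at_left 0) (\<lambda>\<epsilon>. ereal ((lam (t + \<epsilon>) - lam t) / \<epsilon>)) \<and>
          Limsup (at_left 0) (\<lambda>\<epsilon>. ereal ((lam (t + \<epsilon>) - lam t) / \<epsilon>))
             \<le> low_bd TYPE('n) (Lim (at_left (lam t)) r0)))"
proof (intro allI impI)
  fix t assume t: "0 \<le> t" "0 < lam t"
  let ?w = "omega_d TYPE('n)" let ?al = "alpha_d TYPE('n)" let ?k = "2 * CARD('n)"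
  define M where "M = lam 0"
  \<comment> \<open>Squared areas are \<open>?al\<^sup>2\<close> times the radius to the power 2 d;
    this constant collects the factors that do not depend on the level.\<close>
  define c where "c = ?w / ?al\<^sup>2"
  have al: "?al > 0" by (rule alpha_d_pos)
  have w: "?w > 0" by (rule omega_d_pos)
  have M: "0 < M" using t lam_mono by (auto simp: M_def intro: less_le_trans)
  have lamM: "lam s \<le> M" if "0 \<le> s" for s using lam_mono that by (simp add: M_def)
  have rM: "0 < r0 M" using r0_sup by (simp add: lam_0[symmetric] M_def)
  have r0_nonneg: "0 \<le> r0 s" for s using u0_rad by (simp add: radial_noninc_def)
  have ess: "esssup lborel (\<lambda>x. ereal (u0 x)) = ereal M" by (simp add: lam_0[symmetric] M_def)
  have u0_le: "AE x in lborel. u0 x \<le> M"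
    using esssup_AE[of "\<lambda>x. ereal (u0 x)" lborel] by (simp add: ess)
  obtain K where K: "closed K" "K \<subseteq> ball 0 R0" "AE x in lborel. x \<notin> K \<longrightarrow> u0 x = 0"
    and u0_int: "integrable lborel u0" and u0_nonneg: "AE x in lborel. 0 \<le> u0 x"
    using u0_L1 by (auto simp: L1cp_def)
  \<comment> \<open>A closed set inside the open ball is compact, so its largest norm is smaller
    than \<open>R0\<close>.\<close>
  obtain R1 where R1: "0 \<le> R1" "R1 < R0" "K \<subseteq> cball 0 R1"
  proof (cases "K = {}")
    case True then show ?thesis using that[of 0] R0 by simp
  next
    case False
    have "compact K" using K by (meson bounded_ball bounded_subset compact_eq_bounded_closed)
    from continuous_attains_sup[OF this False continuous_on_norm_id]
    obtain z where z: "z \<in> K" "\<And>y. y \<in> K \<Longrightarrow> norm y \<le> norm z" by auto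
    show ?thesis by (rule that[of "norm z"]) (use z K(2) in auto)
  qed
  have supp: "AE x in lborel. R1 < norm x \<longrightarrow> u0 x = 0"
    using K(3) by eventually_elim (use R1(3) in auto)
  have level: "\<exists>\<rho>. superlevel_radius u0 s \<rho> \<and> r0 s \<le> \<rho> \<and> (\<forall>a<s. \<rho> \<le> r0 a)" if "0 < s" for s
    by (rule radial_noninc_superlevel[OF u0_rad r0_mono that])
  interpret radial_datum u0 R0 R1
    by standard (use d2 u0_int u0_nonneg R1 supp level in blast)+
  have area_ge: "?al * r0 s ^ CARD('n) \<le> area s" if s: "0 < s" for s
  proof -
    obtain \<rho> where \<rho>: "superlevel_radius u0 s \<rho>" "r0 s \<le> \<rho>" using level[OF s] by blast
    show ?thesis unfolding area_eq[OF \<rho>(1)] using \<rho>(2) r0_nonneg al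
      by (intro mult_left_mono power_mono) auto
  qed
  have area_le: "area s \<le> ?al * r0 a ^ CARD('n)" if s: "0 < s" "a < s" for a s
  proof -
    obtain \<rho> where \<rho>: "superlevel_radius u0 s \<rho>" "\<rho> \<le> r0 a" using level[OF s(1)] s(2) by blast
    show ?thesis unfolding area_eq[OF \<rho>(1)] using \<rho> al
      by (intro mult_left_mono power_mono) (auto simp: superlevel_radius_def)
  qed
  have areaM: "0 < area M"
    using area_ge[OF M] rM al by (meson less_le_trans mult_pos_pos zero_less_power)
  note bounds = min_movement_bounds[OF lam_MM M u0_le areaM]
  have sq: "(?al * x ^ CARD('n))\<^sup>2 = ?al\<^sup>2 * x ^ ?k" for x
    by (simp add: power_mult_distrib mult.commute[of 2] flip: power_mult)
  have up: "r0 b ^ ?k * (lam s - lam s') \<le> (s' - s) * c" if s: "0 \<le> s" "s \<le> s'" and b: "lam s < b" "b \<le> M" for s s' b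
  proof -
    have b0: "0 < b" using lam_nonneg s(1) b by (meson le_less_trans)
    have "?al\<^sup>2 * r0 b ^ ?k \<le> (area b)\<^sup>2"
      unfolding sq[symmetric] using area_ge[OF b0] al r0_nonneg by (intro power_mono) auto
    then have "?al\<^sup>2 * r0 b ^ ?k * (lam s - lam s') \<le> (area b)\<^sup>2 * (lam s - lam s')"
      using lam_mono s by (intro mult_right_mono) auto
    also have "\<dots> \<le> (s' - s) * ?w"
      using lam_nonneg lamM s b by (intro bounds(1)) auto
    finally show ?thesis using al by (simp add: c_def field_simps)
  qed
  have low: "(s' - s) * c \<le> r0 a ^ ?k * (lam s - lam s')" if s: "0 \<le> s" "s \<le> s'" and a: "0 < a" "a < lam s'" for s s' a
  proof -
    \<comment> \<open>The area at a level is bounded by \<open>r0\<close> only at strictly smaller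
      levels, so the estimate is applied at a level between a and \<open>lam s'\<close>.\<close>
    define a' where "a' = (a + lam s') / 2"
    have a': "a < a'" "a' < lam s'" "0 < a'" using a by (auto simp: a'_def)
    have "(s' - s) * ?w \<le> (area a')\<^sup>2 * (lam s - lam s')"
      using lam_nonneg lamM s a' by (intro bounds(2)) auto
    also have "\<dots> \<le> (?al * r0 a ^ CARD('n))\<^sup>2 * (lam s - lam s')"
      using lam_mono s area_le[OF a'(3,1)] area_nonneg by (intro mult_right_mono power_mono) auto
    finally show ?thesis unfolding sq using al by (simp add: c_def field_simps)
  qed
  have cont: "continuous_on {0..} lam"
    using lam_lip lipschitz_on_continuous_on by blast
  have quot1: "\<forall>\<^sub>F y in at t within {0..}. - (c / r0 b ^ ?k) \<le> (lam y - lam t) / (y - t)"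
    if "lam t < b" "b \<le> M" for b
    by (rule difference_quotient_bounds(1)[OF r0_mono r0_nonneg rM cont _ _ t that])
       ((rule up; assumption) | (rule low; assumption))+
  have quot2: "\<forall>\<^sub>F y in at t within {0..}. (lam y - lam t) / (y - t) \<le> - (c / r0 a ^ ?k)"
    if "lam t \<le> M" "0 < a" "a < lam t" for a
    by (rule difference_quotient_bounds(2)[OF r0_mono r0_nonneg rM cont _ _ t that])
       ((rule up; assumption) | (rule low; assumption))+
  have LM: "lam t \<le> M" using lamM t by simp
  define rm where "rm = Inf (r0 ` {..<lam t})"
  define rp where "rp = Sup (r0 ` {lam t<..})"
  have rm: "(r0 \<longlongrightarrow> rm) (at_left (lam t))" and rm_ge: "r0 (lam t) \<le> rm"
    unfolding rm_def using antimono_tendsto_at_left[OF r0_mono r0_nonneg] by auto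
  have rp: "(r0 \<longlongrightarrow> rp) (at_right (lam t))"
    unfolding rp_def by (rule antimono_tendsto_at_right[OF r0_mono])
  have "r0 M \<le> r0 (lam t)" using r0_mono LM by (simp add: antimonoD)
  then have rm_pos: "0 < rm" and rL_pos: "0 < r0 (lam t)" using rM rm_ge by linarith+
  \<comment> \<open>Above the essential supremum superlevel sets are null, so their radii vanish and
    dominate \<open>r0\<close>. If \<open>lam t\<close> is the maximum, the right limit is therefore
    0 and the lower bound is minus infinity.\<close>
  have beyond: "r0 s = 0" if s: "M < s" for s
  proof -
    obtain m where m: "M < m" "m < s" using dense[OF s] by blast
    have m0: "0 < m" using M m by simp
    obtain \<rho> where \<rho>: "superlevel_radius u0 m \<rho>" "r0 m \<le> \<rho>" using level[OF m0] by blast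
    have "AE x in lborel. \<not> m \<le> u0 x" using u0_le by eventually_elim (use m in auto)
    then have "{x. m \<le> u0 x} \<in> null_sets lborel"
      by (subst AE_iff_null_sets) auto
    then have "area m = 0" by (simp add: area_def measure_eq_0_null_sets)
    then have "\<rho> = 0" using al by (simp add: area_eq[OF \<rho>(1)])
    then have "r0 m = 0" using \<rho>(2) r0_nonneg[of m] by simp
    moreover have "r0 s \<le> r0 m" using r0_mono m by (simp add: antimonoD)
    ultimately show ?thesis using r0_nonneg[of s] by simp
  qed
  have top: "rp = 0" if "lam t = M"
  proof -
    have "\<forall>\<^sub>F s in at_right (lam t). r0 s = 0"
      using eventually_at_right_less[of "lam t"] by eventually_elim (use that beyond in auto)
    then have "(r0 \<longlongrightarrow> 0) (at_right (lam t))" by (rule tendsto_eventually)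
    then show ?thesis using rp tendsto_unique[of "at_right (lam t)"] by simp
  qed
  have lim_m: "((\<lambda>a. - (c / r0 a ^ ?k)) \<longlongrightarrow> - (c / rm ^ ?k)) (at_left (lam t))"
    using rm_pos by (intro tendsto_intros rm) simp
  have lim_p: "((\<lambda>b. - (c / r0 b ^ ?k)) \<longlongrightarrow> - (c / rp ^ ?k)) (at_right (lam t))" if "rp \<noteq> 0"
    using that by (intro tendsto_intros rp) simp
  have near_m: "\<forall>\<^sub>F a in at_left (lam t). 0 < a \<and> a < lam t"
    using eventually_at_left_real[OF t(2)] by eventually_elim simp
  \<comment> \<open>A nonzero right limit places \<open>lam t\<close> strictly below
    \<open>M\<close>, so there are levels b to which \<open>quot1\<close> applies.\<close>
  have near_p: "\<forall>\<^sub>F b in at_right (lam t). lam t < b \<and> b \<le> M" if "rp \<noteq> 0"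
  proof -
    have "lam t < M" using top that LM by fastforce
    from eventually_at_right_real[OF this] show ?thesis by eventually_elim simp
  qed
  define q where "q = (\<lambda>e. (lam (t + e) - lam t) / e)"
  \<comment> \<open>The filter F stays abstract so that the same argument serves increments tending
    to 0 from the right and from the left.\<close>
  have lower: "low_bd TYPE('n) rp \<le> Liminf F (\<lambda>e. ereal (q e))"
    if shift: "\<And>P. \<forall>\<^sub>F y in at t within {0..}. P y \<Longrightarrow> \<forall>\<^sub>F e in F. P (t + e)" for F
  proof (cases "rp = 0")
    case True then show ?thesis by (simp add: low_bd_def)
  next
    case False
    have "((\<lambda>b. ereal (- (c / r0 b ^ ?k))) \<longlongrightarrow> ereal (- (c / rp ^ ?k))) (at_right (lam t))"
      using lim_p[OF False] by simp
    moreover have "\<forall>\<^sub>F b in at_right (lam t). ereal (- (c / r0 b ^ ?k)) \<le> Liminf F (\<lambda>e. ereal (q e))"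
      using near_p[OF False]
    proof eventually_elim
      case (elim b)
      then show ?case using shift[OF quot1[of b]] by (intro Liminf_bounded) (auto simp: q_def)
    qed
    ultimately have "ereal (- (c / rp ^ ?k)) \<le> Liminf F (\<lambda>e. ereal (q e))"
      by (rule tendsto_upperbound) simp
    then show ?thesis using False by (simp add: low_bd_eq c_def)
  qed
  have upper: "Limsup F (\<lambda>e. ereal (q e)) \<le> low_bd TYPE('n) rm"
    if shift: "\<And>P. \<forall>\<^sub>F y in at t within {0..}. P y \<Longrightarrow> \<forall>\<^sub>F e in F. P (t + e)" for F
  proof -
    have "((\<lambda>a. ereal (- (c / r0 a ^ ?k))) \<longlongrightarrow> ereal (- (c / rm ^ ?k))) (at_left (lam t))"
      using lim_m by simp
    moreover have "\<forall>\<^sub>F a in at_left (lam t). Limsup F (\<lambda>e. ereal (q e)) \<le> ereal (- (c / r0 a ^ ?k))"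
      using near_m
    proof eventually_elim
      case (elim a)
      then show ?case using shift[OF quot2[OF LM, of a]] by (intro Limsup_bounded) (auto simp: q_def)
    qed
    ultimately have "Limsup F (\<lambda>e. ereal (q e)) \<le> ereal (- (c / rm ^ ?k))"
      by (rule tendsto_lowerbound) simp
    then show ?thesis using rm_pos by (simp add: low_bd_eq c_def)
  qed
  have Lims: "Lim (at_right (lam t)) r0 = rp" "Lim (at_left (lam t)) r0 = rm"
    using rp rm by (auto intro: tendsto_Lim)
  have right: "low_bd TYPE('n) rp \<le> Liminf (at_right 0) (\<lambda>e. ereal (q e))"
     "Liminf (at_right 0) (\<lambda>e. ereal (q e)) \<le> Limsup (at_right 0) (\<lambda>e. ereal (q e))"
     "Limsup (at_right 0) (\<lambda>e. ereal (q e)) \<le> low_bd TYPE('n) rm"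
    by (intro lower eventually_at_within_nonneg_shift(1)[OF _ t(1)], assumption)
       (intro Liminf_le_Limsup, simp,
        intro upper eventually_at_within_nonneg_shift(1)[OF _ t(1)], assumption)
  have left: "low_bd TYPE('n) rp \<le> Liminf (at_left 0) (\<lambda>e. ereal (q e))"
     "Liminf (at_left 0) (\<lambda>e. ereal (q e)) \<le> Limsup (at_left 0) (\<lambda>e. ereal (q e))"
     "Limsup (at_left 0) (\<lambda>e. ereal (q e)) \<le> low_bd TYPE('n) rm" if "0 < t"
    by (intro lower eventually_at_within_nonneg_shift(2)[OF _ t(1) that], assumption)
       (intro Liminf_le_Limsup, simp,
        intro upper eventually_at_within_nonneg_shift(2)[OF _ t(1) that], assumption)
  show "if isCont r0 (lam t)
      then (lam has_real_derivative
              (- omega_d TYPE('n) / (alpha_d TYPE('n))\<^sup>2 * (1 / r0 (lam t) ^ (2 * CARD('n)))))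
             (at t within {0..})
      else
        (low_bd TYPE('n) (Lim (at_right (lam t)) r0)
           \<le> Liminf (at_right 0) (\<lambda>\<epsilon>. ereal ((lam (t + \<epsilon>) - lam t) / \<epsilon>)) \<and>
         Liminf (at_right 0) (\<lambda>\<epsilon>. ereal ((lam (t + \<epsilon>) - lam t) / \<epsilon>))
           \<le> Limsup (at_right 0) (\<lambda>\<epsilon>. ereal ((lam (t + \<epsilon>) - lam t) / \<epsilon>)) \<and>
         Limsup (at_right 0) (\<lambda>\<epsilon>. ereal ((lam (t + \<epsilon>) - lam t) / \<epsilon>))
           \<le> low_bd TYPE('n) (Lim (at_left (lam t)) r0)) \<and>
        (t > 0 \<longrightarrow>
          low_bd TYPE('n) (Lim (at_right (lam t)) r0)
             \<le> Liminf (at_left 0) (\<lambda>\<epsilon>. ereal ((lam (t + \<epsilon>) - lam t) / \<epsilon>)) \<and>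
          Liminf (at_left 0) (\<lambda>\<epsilon>. ereal ((lam (t + \<epsilon>) - lam t) / \<epsilon>))
             \<le> Limsup (at_left 0) (\<lambda>\<epsilon>. ereal ((lam (t + \<epsilon>) - lam t) / \<epsilon>)) \<and>
          Limsup (at_left 0) (\<lambda>\<epsilon>. ereal ((lam (t + \<epsilon>) - lam t) / \<epsilon>))
             \<le> low_bd TYPE('n) (Lim (at_left (lam t)) r0))"
  proof (cases "isCont r0 (lam t)")
    case False
    then show ?thesis using right left unfolding Lims q_def by simp
  next
    case True
    then have "(r0 \<longlongrightarrow> r0 (lam t)) (at_left (lam t))" "(r0 \<longlongrightarrow> r0 (lam t)) (at_right (lam t))"
      by (auto simp: isCont_def filterlim_at_split)
    then have eq: "rm = r0 (lam t)" "rp = r0 (lam t)"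
      using tendsto_unique[OF trivial_limit_at_left_real rm] tendsto_unique[OF trivial_limit_at_right_real rp] by auto
    \<comment> \<open>Since \<open>r0\<close> is positive at \<open>lam t\<close>, continuity there
      excludes the jump to 0 at the maximum; both families of bounds are available and share one
      limit.\<close>
    have rp0: "rp \<noteq> 0" using eq rL_pos by simp
    have "((\<lambda>y. (lam y - lam t) / (y - t)) \<longlongrightarrow> - (c / r0 (lam t) ^ ?k)) (at t within {0..})"
    proof (rule order_tendstoI)
      fix x assume "x < - (c / r0 (lam t) ^ ?k)"
      then have "\<forall>\<^sub>F b in at_right (lam t). x < - (c / r0 b ^ ?k)"
        using order_tendstoD(1)[OF lim_p[OF rp0]] eq by simp
      with near_p[OF rp0] have "\<forall>\<^sub>F b in at_right (lam t). (lam t < b \<and> b \<le> M) \<and> x < - (c / r0 b ^ ?k)"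
        by (rule eventually_conj)
      then obtain b where b: "lam t < b" "b \<le> M" "x < - (c / r0 b ^ ?k)"
        using eventually_happens'[OF trivial_limit_at_right_real] by blast
      from quot1[OF b(1,2)] show "\<forall>\<^sub>F y in at t within {0..}. x < (lam y - lam t) / (y - t)"
        by eventually_elim (use b(3) in linarith)
    next
      fix x assume "- (c / r0 (lam t) ^ ?k) < x"
      then have "\<forall>\<^sub>F a in at_left (lam t). - (c / r0 a ^ ?k) < x"
        using order_tendstoD(2)[OF lim_m] eq by simp
      with near_m have "\<forall>\<^sub>F a in at_left (lam t). (0 < a \<and> a < lam t) \<and> - (c / r0 a ^ ?k) < x"
        by (rule eventually_conj)
      then obtain a where a: "0 < a" "a < lam t" "- (c / r0 a ^ ?k) < x"
        using eventually_happens'[OF trivial_limit_at_left_real] by blast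
      from quot2[OF LM a(1,2)] show "\<forall>\<^sub>F y in at t within {0..}. (lam y - lam t) / (y - t) < x"
        by eventually_elim (use a(3) in linarith)
    qed
    then have "(lam has_real_derivative - (c / r0 (lam t) ^ ?k)) (at t within {0..})"
      by (simp add: has_field_derivative_iff)
    moreover have "- (c / r0 (lam t) ^ ?k) = - omega_d TYPE('n) / (alpha_d TYPE('n))\<^sup>2 * (1 / r0 (lam t) ^ ?k)"
      by (simp add: c_def)
    ultimately show ?thesis using True by simp
  qed
qed

end
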